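(* Let $\tilde{\mathbb{C}}^2$ be the blow-up of $\mathbb{C}^2$ at the origin, endowed with the Simanca metric $g_S$, with associated Kähler form $\omega_S$. Then $(\tilde{\mathbb{C}}^2, g_S)$ admits a regular quantization such that $\epsilon_{m g_S} = m^2$, i.e. for every integer $m\ge 1$ the function $\epsilon_{mg_S}$ on $\tilde{\mathbb{C}}^2$ is constant, equal to $m^2$.
   Context: **Geometric quantization and the epsilon function.** Let $(M,g)$ be an $n$-dimensional (not necessarily compact) Kähler manifold with associated Kähler form $\omega$, and let $L\to M$ be a holomorphic line bundle with $c_1(L)=[\omega]$. For an integer $m\ge 1$ let $h_m$ be a Hermitian metric on $L^m=L^{\otimes m}$ such that $\mathrm{Ric}(h_m)=m\omega$, where $\mathrm{Ric}(h_m)$ is the two-form given locally by $\mathrm{Ric}(h_m)=-\frac{i}{2\pi}\partial\bar\partial\log h_m(\sigma(x),\sigma(x))$ for a trivializing holomorphic section $\sigma:U\to L^m\setminus\{0\}$. The pair $(L^m,h_m)$ is called a geometric quantization of $(M,m\omega)$. Let $\mathcal{H}_m$ be the separable complex Hilbert space of global holomorphic sections $s$ of $L^m$ with $$\langle s,s\rangle_{h_m}=\int_M h_m(s(x),s(x))\,\frac{\omega^n}{n!}<\infty .$$ Let $\{s_j\}_{j=0,\dots,d_m}$ be an orthonormal basis of $\mathcal{H}_m$ ($\dim\mathcal{H}_m=d_m+1\le\infty$) and set $$\epsilon_{mg}(x)=\sum_{j=0}^{d_m}h_m(s_j(x),s_j(x)).$$ This function depends only on $mg$, not on the orthonormal basis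 or on $h_m$. **Balanced metrics, regular quantization.** $mg$ is called balanced if $\epsilon_{mg}$ is a positive constant. A geometric quantization $(L^m,h_m)$ of $(M,\omega)$ is called regular if $mg$ is balanced for every sufficiently large natural number $m$. **Simanca metric.** $\tilde{\mathbb{C}}^2=\{(z_1,z_2,[t_1,t_2])\in\mathbb{C}^2\times\mathbb{C}P^1 : t_1z_2-t_2z_1=0\}$, with exceptional divisor $H=\{(0,[t])\}\simeq\mathbb{C}P^1$. The projection $(z,[t])\mapsto z$ restricts to a biholomorphism $\tilde{\mathbb{C}}^2\setminus H\cong\mathbb{C}^2\setminus\{0\}$. The form $\frac{i}{2\pi}\partial\bar\partial(|z|^2+\log|z|^2)$ on $\mathbb{C}^2\setminus\{0\}$, with $|z|^2=|z_1|^2+|z_2|^2$, pulled back to $\tilde{\mathbb{C}}^2\setminus H$, extends (uniquely) to a Kähler form on all of $\tilde{\mathbb{C}}^2$; this extension is denoted $\omega_S$, and the associated Kähler metric $g_S$ is the Simanca metric. The form $\omega_S$ is integral and $\tilde{\mathbb{C}}^2$ is simply-connected, so there is, up to isomorphism, a unique holomorphic line bundle $L\to\tilde{\mathbb{C}}^2$ with $c_1(L)=[\omega_S]$. *)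

theory Defs
  imports "HOL-Analysis.Analysis"
begin

section \<open>Smooth and holomorphic functions on open subsets of complex coordinate space\<close>

primrec Ck_on :: "nat \<Rightarrow> ('v::real_normed_vector \<Rightarrow> 'w::real_normed_vector) \<Rightarrow> 'v set \<Rightarrow> bool" where
  "Ck_on 0 f S \<longleftrightarrow> continuous_on S f"
| "Ck_on (Suc k) f S \<longleftrightarrow> (\<forall>x\<in>S. f differentiable (at x)) \<and>
     (\<forall>v. Ck_on k (\<lambda>x. frechet_derivative f (at x) v) S)"

definition smooth_on :: "('v::real_normed_vector \<Rightarrow> 'w::real_normed_vector) \<Rightarrow> 'v set \<Rightarrow> bool" where
  "smooth_on f S \<longleftrightarrow> (\<forall>k. Ck_on k f S)"

definition holo_on :: "(complex^'n \<Rightarrow> complex) \<Rightarrow> (complex^'n) set \<Rightarrow> bool" where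
  "holo_on f S \<longleftrightarrow> (\<forall>x\<in>S. \<exists>D. (f has_derivative D) (at x) \<and> (\<forall>c v. D (c *s v) = c * D v))"

text \<open>The Wirtinger derivatives with respect to the j-th coordinate and its conjugate.\<close>

definition dz :: "'n \<Rightarrow> (complex^'n \<Rightarrow> complex) \<Rightarrow> complex^'n \<Rightarrow> complex" where
  "dz j f y = (frechet_derivative f (at y) (axis j 1)
               - \<i> * frechet_derivative f (at y) (axis j \<i>)) / 2"

definition dzbar :: "'n \<Rightarrow> (complex^'n \<Rightarrow> complex) \<Rightarrow> complex^'n \<Rightarrow> complex" where
  "dzbar j f y = (frechet_derivative f (at y) (axis j 1)
                  + \<i> * frechet_derivative f (at y) (axis j \<i>)) / 2"

text \<open>The real two-form (i / 2 pi) (d dbar u) at y, evaluated on real tangent vectors v and w;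
  for real-valued smooth u the value under Re is already real.\<close>

definition ddbar_form ::
  "(complex^'n \<Rightarrow> real) \<Rightarrow> complex^'n \<Rightarrow> complex^'n \<Rightarrow> complex^'n \<Rightarrow> real" where
  "ddbar_form u y v w = Re (\<i> / (2 * of_real pi) *
     (\<Sum>j\<in>UNIV. \<Sum>k\<in>UNIV. dz j (dzbar k (\<lambda>z. of_real (u z))) y *
        (v $ j * cnj (w $ k) - w $ j * cnj (v $ k))))"


section \<open>Complex manifolds\<close>

text \<open>A chart is its domain together with its coordinate map; a manifold is given by an atlas.\<close>

type_synonym ('a, 'n) chart = "'a set \<times> ('a \<Rightarrow> complex^'n)"
type_synonym ('a, 'n) atlas = "('a, 'n) chart set"

definition coords :: "('a, 'n) chart \<Rightarrow> 'a set \<Rightarrow> (complex^'n) set" where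
  "coords c W = snd c ` (fst c \<inter> W)"

definition chart_inv :: "('a, 'n) chart \<Rightarrow> complex^'n \<Rightarrow> 'a" where
  "chart_inv c = inv_into (fst c) (snd c)"

definition transition :: "('a, 'n) chart \<Rightarrow> ('a, 'n) chart \<Rightarrow> complex^'n \<Rightarrow> complex^'n" where
  "transition c d y = snd d (chart_inv c y)"

definition points :: "('a, 'n) atlas \<Rightarrow> 'a set" where
  "points A = (\<Union>c\<in>A. fst c)"

definition manifold_topology :: "('a, 'n::finite) atlas \<Rightarrow> 'a topology" where
  "manifold_topology A = topology (\<lambda>W. W \<subseteq> points A \<and> (\<forall>c\<in>A. open (coords c W)))"

definition complex_manifold :: "('a, 'n::finite) atlas \<Rightarrow> bool" where
  "complex_manifold A \<longleftrightarrow>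
     (\<forall>c\<in>A. inj_on (snd c) (fst c) \<and> open (coords c (fst c))) \<and>
     (\<forall>c\<in>A. \<forall>d\<in>A. open (coords c (fst d)) \<and>
        (\<forall>k. holo_on (\<lambda>y. transition c d y $ k) (coords c (fst d)))) \<and>
     Hausdorff_space (manifold_topology A) \<and> second_countable (manifold_topology A)"

definition holo_fun_on :: "('a, 'n::finite) atlas \<Rightarrow> ('a \<Rightarrow> complex) \<Rightarrow> 'a set \<Rightarrow> bool" where
  "holo_fun_on A f W \<longleftrightarrow> (\<forall>c\<in>A. holo_on (\<lambda>y. f (chart_inv c y)) (coords c W))"

definition smooth_fun_on ::
  "('a, 'n::finite) atlas \<Rightarrow> ('a \<Rightarrow> 'w::real_normed_vector) \<Rightarrow> 'a set \<Rightarrow> bool" where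
  "smooth_fun_on A f W \<longleftrightarrow> (\<forall>c\<in>A. smooth_on (\<lambda>y. f (chart_inv c y)) (coords c W))"


section \<open>Differential forms and Kaehler forms\<close>

text \<open>Forms are given by their local expressions in all charts, compatible under the
  transition maps. They are set to zero where they carry no information, so that equality
  of forms is equality of functions.\<close>

type_synonym ('a, 'n) form1 = "('a, 'n) chart \<Rightarrow> complex^'n \<Rightarrow> complex^'n \<Rightarrow> real"
type_synonym ('a, 'n) form2 = "('a, 'n) chart \<Rightarrow> complex^'n \<Rightarrow> complex^'n \<Rightarrow> complex^'n \<Rightarrow> real"

definition smooth_form1 :: "('a, 'n::finite) atlas \<Rightarrow> ('a, 'n) form1 \<Rightarrow> bool" where
  "smooth_form1 A \<alpha> \<longleftrightarrow>
     (\<forall>c y v. \<not> (c \<in> A \<and> y \<in> coords c (fst c)) \<longrightarrow> \<alpha> c y v = 0) \<and>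
     (\<forall>c\<in>A. \<forall>y\<in>coords c (fst c). linear (\<alpha> c y)) \<and>
     (\<forall>c\<in>A. \<forall>v. smooth_on (\<lambda>y. \<alpha> c y v) (coords c (fst c))) \<and>
     (\<forall>c\<in>A. \<forall>d\<in>A. \<forall>y\<in>coords c (fst d). \<forall>v.
        \<alpha> c y v = \<alpha> d (transition c d y) (frechet_derivative (transition c d) (at y) v))"

definition smooth_form2 :: "('a, 'n::finite) atlas \<Rightarrow> ('a, 'n) form2 \<Rightarrow> bool" where
  "smooth_form2 A \<omega> \<longleftrightarrow>
     (\<forall>c y v w. \<not> (c \<in> A \<and> y \<in> coords c (fst c)) \<longrightarrow> \<omega> c y v w = 0) \<and>
     (\<forall>c\<in>A. \<forall>y\<in>coords c (fst c). bilinear (\<omega> c y) \<and> (\<forall>v. \<omega> c y v v = 0)) \<and>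
     (\<forall>c\<in>A. \<forall>v w. smooth_on (\<lambda>y. \<omega> c y v w) (coords c (fst c))) \<and>
     (\<forall>c\<in>A. \<forall>d\<in>A. \<forall>y\<in>coords c (fst d). \<forall>v w.
        \<omega> c y v w = \<omega> d (transition c d y) (frechet_derivative (transition c d) (at y) v)
                                             (frechet_derivative (transition c d) (at y) w))"

text \<open>Exterior derivatives in coordinates, evaluated on constant vector fields.\<close>

definition ext_deriv1 :: "('a, 'n::finite) form1 \<Rightarrow> ('a, 'n) form2" where
  "ext_deriv1 \<alpha> c y v w =
     frechet_derivative (\<lambda>z. \<alpha> c z w) (at y) v - frechet_derivative (\<lambda>z. \<alpha> c z v) (at y) w"

definition ext_deriv2 :: "('a, 'n::finite) form2 \<Rightarrow>
    ('a, 'n) chart \<Rightarrow> complex^'n \<Rightarrow> complex^'n \<Rightarrow> complex^'n \<Rightarrow> complex^'n \<Rightarrow> real" where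
  "ext_deriv2 \<omega> c y u v w =
     frechet_derivative (\<lambda>z. \<omega> c z v w) (at y) u - frechet_derivative (\<lambda>z. \<omega> c z u w) (at y) v
     + frechet_derivative (\<lambda>z. \<omega> c z u v) (at y) w"

definition closed_form2 :: "('a, 'n::finite) atlas \<Rightarrow> ('a, 'n) form2 \<Rightarrow> bool" where
  "closed_form2 A \<omega> \<longleftrightarrow> smooth_form2 A \<omega> \<and>
     (\<forall>c\<in>A. \<forall>y\<in>coords c (fst c). \<forall>u v w. ext_deriv2 \<omega> c y u v w = 0)"

definition cohomologous :: "('a, 'n::finite) atlas \<Rightarrow> ('a, 'n) form2 \<Rightarrow> ('a, 'n) form2 \<Rightarrow> bool" where
  "cohomologous A \<eta> \<omega> \<longleftrightarrow> (\<exists>\<alpha>. smooth_form1 A \<alpha> \<and>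
     (\<forall>c\<in>A. \<forall>y\<in>coords c (fst c). \<forall>v w. \<eta> c y v w - \<omega> c y v w = ext_deriv1 \<alpha> c y v w))"

definition associated_metric :: "('a, 'n::finite) form2 \<Rightarrow> ('a, 'n) form2" where
  "associated_metric \<omega> c y v w = \<omega> c y v (\<i> *s w)"

definition kaehler_form :: "('a, 'n::finite) atlas \<Rightarrow> ('a, 'n) form2 \<Rightarrow> bool" where
  "kaehler_form A \<omega> \<longleftrightarrow> closed_form2 A \<omega> \<and>
     (\<forall>c\<in>A. \<forall>y\<in>coords c (fst c).
        (\<forall>v w. \<omega> c y (\<i> *s v) (\<i> *s w) = \<omega> c y v w) \<and>
        (\<forall>v. v \<noteq> 0 \<longrightarrow> associated_metric \<omega> c y v v > 0))"

text \<open>The n-fold wedge power of a two-form on complex n-space, divided by n factorial and evaluated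
  on the oriented real basis made of the pairs e j, i (e j). The 2n positions are indexed by
  pairs (j, False), (j, True); the order of the pairs does not affect the sign.\<close>

definition oriented_basis :: "'n \<times> bool \<Rightarrow> complex^'n" where
  "oriented_basis p = axis (fst p) (if snd p then \<i> else 1)"

definition volume_density :: "(complex^'n \<Rightarrow> complex^'n \<Rightarrow> real) \<Rightarrow> real" where
  "volume_density \<omega> =
     (\<Sum>\<sigma> | \<sigma> permutes (UNIV :: ('n::finite \<times> bool) set). of_int (sign \<sigma>) *
        (\<Prod>j\<in>UNIV. \<omega> (oriented_basis (\<sigma> (j, False))) (oriented_basis (\<sigma> (j, True)))))
     / 2 ^ CARD('n) / fact CARD('n)"

text \<open>The Borel measure on the manifold given by integrating the volume form.\<close>

definition volume_measure :: "('a, 'n::finite) atlas \<Rightarrow> ('a, 'n) form2 \<Rightarrow> 'a measure" where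
  "volume_measure A \<omega> = (THE \<mu>. space \<mu> = points A \<and>
     sets \<mu> = sigma_sets (points A) {W. openin (manifold_topology A) W} \<and>
     (\<forall>c\<in>A. \<forall>E\<in>sets \<mu>. E \<subseteq> fst c \<longrightarrow>
        emeasure \<mu> E = (\<integral>\<^sup>+y\<in>coords c E. ennreal (volume_density (\<omega> c y)) \<partial>lborel)))"


section \<open>Holomorphic line bundles and Hermitian metrics\<close>

text \<open>A line bundle is given by a countable trivializing open cover with frames e i over
  cover L i and transition functions: e j = transfun L i j * e i. A section s is given by its
  components, s = s i * e i, and a Hermitian metric by the functions h i = h(e i, e i).\<close>

record 'a line_bundle_data =
  cover :: "nat \<Rightarrow> 'a set"
  transfun :: "nat \<Rightarrow> nat \<Rightarrow> 'a \<Rightarrow> complex"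

definition line_bundle :: "('a, 'n::finite) atlas \<Rightarrow> 'a line_bundle_data \<Rightarrow> bool" where
  "line_bundle A L \<longleftrightarrow>
     (\<forall>i. openin (manifold_topology A) (cover L i)) \<and> (\<Union>i. cover L i) = points A \<and>
     (\<forall>i j. holo_fun_on A (transfun L i j) (cover L i \<inter> cover L j) \<and>
        (\<forall>x \<in> cover L i \<inter> cover L j. transfun L i j x \<noteq> 0)) \<and>
     (\<forall>i j k. \<forall>x \<in> cover L i \<inter> cover L j \<inter> cover L k.
        transfun L i j x * transfun L j k x = transfun L i k x)"

definition tensor_power :: "'a line_bundle_data \<Rightarrow> nat \<Rightarrow> 'a line_bundle_data" where
  "tensor_power L m = \<lparr>cover = cover L, transfun = (\<lambda>i j x. transfun L i j x ^ m)\<rparr>"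

type_synonym 'a bsection = "nat \<Rightarrow> 'a \<Rightarrow> complex"
type_synonym 'a bmetric = "nat \<Rightarrow> 'a \<Rightarrow> real"

definition holomorphic_section :: "('a, 'n::finite) atlas \<Rightarrow> 'a line_bundle_data \<Rightarrow> 'a bsection \<Rightarrow> bool" where
  "holomorphic_section A L s \<longleftrightarrow>
     (\<forall>i. holo_fun_on A (s i) (cover L i)) \<and> (\<forall>i x. x \<notin> cover L i \<longrightarrow> s i x = 0) \<and>
     (\<forall>i j. \<forall>x \<in> cover L i \<inter> cover L j. s i x = transfun L i j x * s j x)"

definition hermitian_metric :: "('a, 'n::finite) atlas \<Rightarrow> 'a line_bundle_data \<Rightarrow> 'a bmetric \<Rightarrow> bool" where
  "hermitian_metric A L h \<longleftrightarrow>
     (\<forall>i. smooth_fun_on A (h i) (cover L i) \<and> (\<forall>x \<in> cover L i. h i x > 0)) \<and>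
     (\<forall>i j. \<forall>x \<in> cover L i \<inter> cover L j. h j x = (cmod (transfun L i j x))\<^sup>2 * h i x)"

definition frame_at :: "'a line_bundle_data \<Rightarrow> 'a \<Rightarrow> nat" where
  "frame_at L x = (LEAST i. x \<in> cover L i)"

definition herm :: "'a line_bundle_data \<Rightarrow> 'a bmetric \<Rightarrow> 'a bsection \<Rightarrow> 'a bsection \<Rightarrow> 'a \<Rightarrow> complex" where
  "herm L h s t x =
     of_real (h (frame_at L x) x) * s (frame_at L x) x * cnj (t (frame_at L x) x)"

definition Ric :: "('a, 'n::finite) atlas \<Rightarrow> 'a line_bundle_data \<Rightarrow> 'a bmetric \<Rightarrow> ('a, 'n) form2" where
  "Ric A L h c y v w = (if c \<in> A \<and> y \<in> coords c (fst c)
     then - ddbar_form (\<lambda>z. ln (h (frame_at L (chart_inv c y)) (chart_inv c z))) y v w else 0)"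

text \<open>The first Chern class in de Rham cohomology, as the set of its representatives
  (Chern--Weil: the class of Ric of any Hermitian metric).\<close>

definition chern_class :: "('a, 'n::finite) atlas \<Rightarrow> 'a line_bundle_data \<Rightarrow> ('a, 'n) form2 set" where
  "chern_class A L = {\<eta>. closed_form2 A \<eta> \<and>
     (\<exists>h. hermitian_metric A L h \<and> cohomologous A \<eta> (Ric A L h))}"


section \<open>Geometric quantization and the epsilon function\<close>

definition sq_int_sections ::
  "('a, 'n::finite) atlas \<Rightarrow> ('a, 'n) form2 \<Rightarrow> 'a line_bundle_data \<Rightarrow> 'a bmetric \<Rightarrow> 'a bsection set" where
  "sq_int_sections A \<omega> L h = {s. holomorphic_section A L s \<and>
     (\<integral>\<^sup>+x. ennreal (Re (herm L h s s x)) \<partial>volume_measure A \<omega>) < \<infinity>}"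

definition sec_inner :: "('a, 'n::finite) atlas \<Rightarrow> ('a, 'n) form2 \<Rightarrow> 'a line_bundle_data \<Rightarrow> 'a bmetric \<Rightarrow>
    'a bsection \<Rightarrow> 'a bsection \<Rightarrow> complex" where
  "sec_inner A \<omega> L h s t = (\<integral>x. herm L h s t x \<partial>volume_measure A \<omega>)"

definition orthonormal_basis :: "('a, 'n::finite) atlas \<Rightarrow> ('a, 'n) form2 \<Rightarrow> 'a line_bundle_data \<Rightarrow>
    'a bmetric \<Rightarrow> 'a bsection set \<Rightarrow> bool" where
  "orthonormal_basis A \<omega> L h B \<longleftrightarrow> B \<subseteq> sq_int_sections A \<omega> L h \<and>
     (\<forall>s\<in>B. \<forall>t\<in>B. sec_inner A \<omega> L h s t = (if s = t then 1 else 0)) \<and>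
     (\<forall>s\<in>sq_int_sections A \<omega> L h. \<forall>e>0. \<exists>F a. finite F \<and> F \<subseteq> B \<and>
        (let r = (\<lambda>i x. s i x - (\<Sum>b\<in>F. a b * b i x)) in Re (sec_inner A \<omega> L h r r) < e))"

text \<open>The definite description refers to the value common to all orthonormal bases. The volume
  form is that of \<open>\<omega>\<close> for every power of the bundle (not that of its multiples).\<close>

definition epsilon :: "('a, 'n::finite) atlas \<Rightarrow> ('a, 'n) form2 \<Rightarrow> 'a line_bundle_data \<Rightarrow> 'a bmetric \<Rightarrow>
    'a \<Rightarrow> real" where
  "epsilon A \<omega> L h x = (THE r. \<exists>B. orthonormal_basis A \<omega> L h B \<and>
     ((\<lambda>s. Re (herm L h s s x)) has_sum r) B)"

definition geometric_quantization :: "('a, 'n::finite) atlas \<Rightarrow> ('a, 'n) form2 \<Rightarrow> 'a line_bundle_data \<Rightarrow>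
    (nat \<Rightarrow> 'a bmetric) \<Rightarrow> bool" where
  "geometric_quantization A \<omega> L h \<longleftrightarrow>
     complex_manifold A \<and> kaehler_form A \<omega> \<and> line_bundle A L \<and> \<omega> \<in> chern_class A L \<and>
     (\<forall>m\<ge>1. hermitian_metric A (tensor_power L m) (h m) \<and>
        Ric A (tensor_power L m) (h m) = (\<lambda>c y v w. real m * \<omega> c y v w))"

definition balanced :: "('a, 'n::finite) atlas \<Rightarrow> ('a, 'n) form2 \<Rightarrow> 'a line_bundle_data \<Rightarrow> 'a bmetric \<Rightarrow>
    bool" where
  "balanced A \<omega> L h \<longleftrightarrow> (\<exists>r>0. \<forall>x\<in>points A. epsilon A \<omega> L h x = r)"

definition regular_quantization :: "('a, 'n::finite) atlas \<Rightarrow> ('a, 'n) form2 \<Rightarrow> 'a line_bundle_data \<Rightarrow>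
    (nat \<Rightarrow> 'a bmetric) \<Rightarrow> bool" where
  "regular_quantization A \<omega> L h \<longleftrightarrow> geometric_quantization A \<omega> L h \<and>
     (\<exists>m0. \<forall>m\<ge>m0. balanced A \<omega> (tensor_power L m) (h m))"


section \<open>The blow-up of the plane and the Simanca form\<close>

text \<open>A point [t] of the projective line is the set of the nonzero multiples of t.\<close>

definition proj_point :: "complex^2 \<Rightarrow> (complex^2) set" where
  "proj_point t = {c *s t | c. c \<noteq> 0}"

type_synonym blowup_point = "(complex^2) \<times> (complex^2) set"

definition blowup :: "blowup_point set" where
  "blowup = {(z, proj_point t) | z t. t \<noteq> 0 \<and> t $ 1 * z $ 2 - t $ 2 * z $ 1 = 0}"

definition exceptional_divisor :: "blowup_point set" where
  "exceptional_divisor = {p \<in> blowup. fst p = 0}"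

text \<open>The charts (z, [t]) to (z1, t2 / t1) and (z, [t]) to (z2, t1 / t2).\<close>

definition blowup_chart1 :: "(blowup_point, 2) chart" where
  "blowup_chart1 = ({p \<in> blowup. \<forall>t\<in>snd p. t $ 1 \<noteq> 0},
     \<lambda>p. vector [fst p $ 1, THE r. \<exists>t\<in>snd p. r = t $ 2 / t $ 1])"

definition blowup_chart2 :: "(blowup_point, 2) chart" where
  "blowup_chart2 = ({p \<in> blowup. \<forall>t\<in>snd p. t $ 2 \<noteq> 0},
     \<lambda>p. vector [fst p $ 2, THE r. \<exists>t\<in>snd p. r = t $ 1 / t $ 2])"

definition blowup_atlas :: "(blowup_point, 2) atlas" where
  "blowup_atlas = {blowup_chart1, blowup_chart2}"

definition simanca_potential :: "complex^2 \<Rightarrow> real" where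
  "simanca_potential z = (norm z)\<^sup>2 + ln ((norm z)\<^sup>2)"

text \<open>The Kaehler form on the blow-up that restricts, away from the exceptional divisor, to the
  pullback of (i / 2 pi) d dbar of the potential along the projection to the plane.\<close>

definition simanca_form :: "(blowup_point, 2) form2" where
  "simanca_form = (THE \<omega>. kaehler_form blowup_atlas \<omega> \<and>
     (\<forall>c\<in>blowup_atlas. \<forall>y\<in>coords c (fst c - exceptional_divisor). \<forall>v w.
        let P = (\<lambda>z. fst (chart_inv c z)); DP = frechet_derivative P (at y)
        in \<omega> c y v w = ddbar_form simanca_potential (P y) (DP v) (DP w)))"

end

theory Submission
  imports Defs "HOL-Probability.Distributions" "HOL-Complex_Analysis.Cauchy_Integral_Formula"
begin

text \<open>
  Away from the exceptional divisor a point of the blow-up is a point $z \neq 0$ of the plane, where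
  the volume form has density $(1 + 1/|z|^2)/\pi^2$ and a section of $L^m$ is a holomorphic
  function $f$ vanishing at the origin to order at least $m$, with squared length
  $|f|^2 e^{-m|z|^2} |z|^{-2m}$. The monomials $z_1^a z_2^b$ with $a + b = k + m$ and $k \ge 0$
  are orthogonal with squared norms $k!\, a!\, b! / (m^{k+2} (k+m)!)$. Dividing $|z_1^a z_2^b|^2$
  by these numbers and summing over $a + b = k + m$ gives $m^{k+2} |z|^{2(k+m)} / k!$ by the
  binomial theorem, and summing over $k$ gives $m^2 |z|^{2m} e^{m|z|^2}$. The metric cancels
  everything except $m^2$.

  The computation takes place in the two charts, in which a point has coordinates $(z, t)$ and
  lies over $z \cdot (1, t)$, respectively over $z \cdot (t, 1)$. Both charts are onto all of complex
  2-space, and in both the form has the potential $|z|^2 (1 + |t|^2) + \log (1 + |t|^2)$; the change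
  of charts is $(z, t) \mapsto (z t, 1/t)$. The bundle is the pullback of the hyperplane bundle
  of the projective line, and its $m$-th power carries the $m$-th power of the Fubini--Study metric
  multiplied by $e^{-m|z|^2}$. The Ricci form of this metric is $m$ times the Simanca form since
  $\log |t|^2$ is pluriharmonic (\<open>local_potential_ddbar\<close>).

  A section is a pair of entire functions with $f(z, t) = t^m g(z t, 1/t)$. The coefficient of
  $z^k$ in $f$ is entire in $t$ and grows at most like $|t|^{k+m}$, so it is a polynomial by Liouville's
  theorem, and $f$ is a sum of monomials (\<open>two_chart_expansion\<close>). Invariance under rotations makes
  the coefficients inner products with the monomials (\<open>coefficient_integral\<close>). An orthonormal
  family into which all functions expand pointwise is complete by Fatou's lemma
  (\<open>complete_e\<close>), so the monomials give an orthonormal basis.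

  The epsilon function is specified through an unspecified orthonormal basis. The sum over any orthonormal
  basis is the squared norm of the evaluation functional at the point (\<open>orthonormal_basis_kernel\<close>),
  hence equal to the sum $m^2$ for the monomials. Two further definite descriptions have to be resolved.
  The Simanca form is determined by its values off the exceptional divisor because the complement is
  dense (\<open>simanca_form_eq\<close>). The volume measure exists because the densities in both charts
  have the same image on the plane under the fibrewise linear maps to it, $(z, t) \mapsto z \cdot (1, t)$
  and $(z, t) \mapsto z \cdot (t, 1)$
  (\<open>blowup_vol_independent\<close>, \<open>volume_measure_blowup\<close>).
\<close>

section \<open>Lebesgue measure on complex coordinate space\<close>

lemma borel_measurable_Complex [measurable]:
  "(\<lambda>p. Complex (fst p) (snd p)) \<in> borel_measurable (borel \<Otimes>\<^sub>M borel)"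
  unfolding borel_prod Complex_eq
  by (intro borel_measurable_continuous_onI continuous_intros)

lemma borel_measurable_Complex2 [measurable (raw)]:
  assumes [measurable]: "f \<in> borel_measurable M" "g \<in> borel_measurable M"
  shows "(\<lambda>x. Complex (f x) (g x)) \<in> borel_measurable M"
  unfolding Complex_eq by measurable

text \<open>
  The real and imaginary parts turn an integral over the complex numbers into an iterated
  integral, where linear substitutions can be made one real variable at a time.
\<close>
lemma lborel_complex_eq:
  "(lborel :: complex measure) = distr (lborel \<Otimes>\<^sub>M lborel) borel (\<lambda>(x, y). Complex x y)"
proof (rule lborel_eqI)
  fix l u :: complex
  assume le: "\<And>b. b \<in> Basis \<Longrightarrow> l \<bullet> b \<le> u \<bullet> b"
  have le': "Re l \<le> Re u" "Im l \<le> Im u"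
    using le[of 1] le[of \<i>] by (auto simp: Basis_complex_def inner_complex_def)
  have meas: "(\<lambda>(x, y). Complex x y) \<in> (lborel \<Otimes>\<^sub>M lborel) \<rightarrow>\<^sub>M borel"
    unfolding split_beta by measurable
  have vim: "(\<lambda>(x, y). Complex x y) -` box l u \<inter> space (lborel \<Otimes>\<^sub>M lborel)
      = box (Re l) (Re u) \<times> box (Im l) (Im u)"
    by (auto simp: box_def space_pair_measure Basis_complex_def inner_complex_def)
  show "emeasure (distr (lborel \<Otimes>\<^sub>M lborel) borel (\<lambda>(x, y). Complex x y)) (box l u)
      = ennreal (\<Prod>b\<in>Basis. (u - l) \<bullet> b)"
    using le' meas
    by (simp add: emeasure_distr vim lborel.emeasure_pair_measure_Times Basis_complex_def
        inner_complex_def ennreal_mult)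
qed simp

lemma nn_integral_complex:
  fixes f :: "complex \<Rightarrow> ennreal"
  assumes [measurable]: "f \<in> borel_measurable borel"
  shows "(\<integral>\<^sup>+z. f z \<partial>lborel) = (\<integral>\<^sup>+x. \<integral>\<^sup>+y. f (Complex x y) \<partial>lborel \<partial>lborel)"
  by (subst lborel_complex_eq, subst nn_integral_distr)
     (simp_all add: split_beta' lborel.nn_integral_fst[symmetric])

lemma nn_integral_lborel_swap:
  fixes f :: "'a::euclidean_space \<Rightarrow> 'b::euclidean_space \<Rightarrow> ennreal"
  assumes "case_prod f \<in> borel_measurable (borel \<Otimes>\<^sub>M borel)"
  shows "(\<integral>\<^sup>+x. \<integral>\<^sup>+y. f x y \<partial>lborel \<partial>lborel) = (\<integral>\<^sup>+y. \<integral>\<^sup>+x. f x y \<partial>lborel \<partial>lborel)"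
  using assms by (intro lborel_pair.Fubini'[symmetric]) (simp cong: measurable_cong_sets)

text \<open>
  Multiplication by $c = a + ib$ with $a \neq 0$ is a composition of two real affine
  substitutions, $x \mapsto ax - by$ for fixed $y$ and then $y \mapsto (b/a) x + (|c|^2/a) y$
  for fixed new $x$, whose factors multiply to $|c|^2$.
\<close>
lemma nn_integral_complex_scale:
  fixes f :: "complex \<Rightarrow> ennreal"
  assumes f[measurable]: "f \<in> borel_measurable borel" and c: "c \<noteq> 0"
  shows "(\<integral>\<^sup>+z. f z \<partial>lborel) = ennreal ((cmod c)\<^sup>2) * (\<integral>\<^sup>+z. f (c * z) \<partial>lborel)"
proof -
  define a b where "a = Re c" and "b = Im c"
  have cab: "c = Complex a b" by (simp add: a_def b_def)
  have mult: "c * Complex x y = Complex (a * x - b * y) (b * x + a * y)" for x y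
    by (simp add: cab complex_mult)
  have nsq: "(cmod c)\<^sup>2 = a\<^sup>2 + b\<^sup>2" by (simp add: cab cmod_power2)
  have R: "(\<integral>\<^sup>+z. f (c * z) \<partial>lborel)
      = (\<integral>\<^sup>+x. \<integral>\<^sup>+y. f (Complex (a * x - b * y) (b * x + a * y)) \<partial>lborel \<partial>lborel)"
    by (subst nn_integral_complex) (simp_all add: mult)
  show ?thesis
  proof (cases "a = 0")
    case True
    with c have b: "b \<noteq> 0" by (auto simp: cab complex_eq_iff)
    have "(\<integral>\<^sup>+z. f z \<partial>lborel) = (\<integral>\<^sup>+x. \<integral>\<^sup>+y. f (Complex x y) \<partial>lborel \<partial>lborel)"
      by (rule nn_integral_complex[OF f])
    also have "\<dots> = ennreal \<bar>b\<bar> * (\<integral>\<^sup>+x. \<integral>\<^sup>+y. f (Complex (- b * x) y) \<partial>lborel \<partial>lborel)"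
      using b by (subst nn_integral_real_affine[where c="-b" and t=0]) simp_all
    also have "\<dots> = ennreal \<bar>b\<bar> * (\<integral>\<^sup>+x. ennreal \<bar>b\<bar> * (\<integral>\<^sup>+y. f (Complex (- b * x) (b * y)) \<partial>lborel) \<partial>lborel)"
      using b by (subst (2) nn_integral_real_affine[where c="b" and t=0]) simp_all
    also have "\<dots> = ennreal (b\<^sup>2) * (\<integral>\<^sup>+x. (\<integral>\<^sup>+y. f (Complex (- b * x) (b * y)) \<partial>lborel) \<partial>lborel)"
      by (subst nn_integral_cmult)
         (simp_all add: mult.assoc[symmetric] ennreal_mult[symmetric] power2_eq_square abs_mult[symmetric])
    also have "(\<integral>\<^sup>+x. (\<integral>\<^sup>+y. f (Complex (- b * x) (b * y)) \<partial>lborel) \<partial>lborel)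
        = (\<integral>\<^sup>+y. (\<integral>\<^sup>+x. f (Complex (- b * x) (b * y)) \<partial>lborel) \<partial>lborel)"
      by (rule nn_integral_lborel_swap) simp
    finally show ?thesis by (simp add: R True nsq)
  next
    case a: False
    define d where "d = (a\<^sup>2 + b\<^sup>2) / a"
    have d: "d \<noteq> 0" using a by (simp add: d_def sum_power2_eq_zero_iff)
    have "(\<integral>\<^sup>+z. f z \<partial>lborel) = (\<integral>\<^sup>+x. \<integral>\<^sup>+y. f (Complex x y) \<partial>lborel \<partial>lborel)"
      by (rule nn_integral_complex[OF f])
    also have "\<dots> = (\<integral>\<^sup>+x. ennreal \<bar>d\<bar> * (\<integral>\<^sup>+y. f (Complex x (b / a * x + d * y)) \<partial>lborel) \<partial>lborel)"
      using d by (intro nn_integral_cong nn_integral_real_affine) simp_all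
    also have "\<dots> = ennreal \<bar>d\<bar> * (\<integral>\<^sup>+x. \<integral>\<^sup>+y. f (Complex x (b / a * x + d * y)) \<partial>lborel \<partial>lborel)"
      by (subst nn_integral_cmult) simp_all
    also have "(\<integral>\<^sup>+x. \<integral>\<^sup>+y. f (Complex x (b / a * x + d * y)) \<partial>lborel \<partial>lborel)
        = (\<integral>\<^sup>+y. \<integral>\<^sup>+x. f (Complex x (b / a * x + d * y)) \<partial>lborel \<partial>lborel)"
      by (rule nn_integral_lborel_swap) simp
    also have "\<dots> = (\<integral>\<^sup>+y. ennreal \<bar>a\<bar> * (\<integral>\<^sup>+x. f (Complex (- b * y + a * x)
        (b / a * (- b * y + a * x) + d * y)) \<partial>lborel) \<partial>lborel)"
      using a by (intro nn_integral_cong nn_integral_real_affine) simp_all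
    also have "\<dots> = ennreal \<bar>a\<bar> * (\<integral>\<^sup>+y. \<integral>\<^sup>+x. f (Complex (- b * y + a * x)
        (b / a * (- b * y + a * x) + d * y)) \<partial>lborel \<partial>lborel)"
      by (subst nn_integral_cmult) simp_all
    also have "(\<integral>\<^sup>+y. \<integral>\<^sup>+x. f (Complex (- b * y + a * x)
        (b / a * (- b * y + a * x) + d * y)) \<partial>lborel \<partial>lborel)
       = (\<integral>\<^sup>+y. \<integral>\<^sup>+x. f (Complex (a * x - b * y) (b * x + a * y)) \<partial>lborel \<partial>lborel)"
    proof -
      have "b / a * (- b * y + a * x) + d * y = b * x + a * y" for x y
        using a by (simp add: d_def field_simps power2_eq_square)
      then show ?thesis by (simp add: algebra_simps)
    qed
    also have "\<dots> = (\<integral>\<^sup>+x. \<integral>\<^sup>+y. f (Complex (a * x - b * y) (b * x + a * y)) \<partial>lborel \<partial>lborel)"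
      by (rule nn_integral_lborel_swap) simp
    finally have "(\<integral>\<^sup>+z. f z \<partial>lborel) = ennreal \<bar>d\<bar> * (ennreal \<bar>a\<bar> * (\<integral>\<^sup>+z. f (c * z) \<partial>lborel))"
      by (simp only: R)
    moreover have "ennreal \<bar>d\<bar> * ennreal \<bar>a\<bar> = ennreal ((cmod c)\<^sup>2)"
      using a by (simp add: ennreal_mult[symmetric] nsq d_def abs_mult[symmetric])
    ultimately show ?thesis by (simp add: mult.assoc[symmetric])
  qed
qed

lemma lborel_complex_rotate:
  assumes "cmod c = 1"
  shows "distr lborel borel ((*) c) = (lborel :: complex measure)"
proof (rule measure_eqI)
  fix A assume "A \<in> sets (distr lborel borel ((*) c))"
  then have A[measurable]: "A \<in> sets borel" by simp
  have "c \<noteq> 0" using assms by auto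
  then have "emeasure lborel A = (\<integral>\<^sup>+z. indicator A (c * z) \<partial>lborel)"
    using nn_integral_complex_scale[of "indicator A" c] assms by simp
  also have "\<dots> = (\<integral>\<^sup>+z. indicator ((*) c -` A) z \<partial>lborel)"
    by (intro nn_integral_cong) (simp split: split_indicator)
  also have "\<dots> = emeasure lborel ((*) c -` A)"
    by (rule nn_integral_indicator) (simp add: measurable_sets_borel[of "(*) c" borel])
  also have "\<dots> = emeasure (distr lborel borel ((*) c)) A"
    by (simp add: emeasure_distr)
  finally show "emeasure (distr lborel borel ((*) c)) A = emeasure lborel A" by simp
qed simp

text \<open>
  The image of Lebesgue measure under $|z|^2$ is determined by the areas $\pi r^2$ of the discs.
\<close>
lemma nn_integral_complex_radial:
  fixes g :: "real \<Rightarrow> ennreal"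
  assumes [measurable]: "g \<in> borel_measurable borel"
  shows "(\<integral>\<^sup>+z. g ((cmod z)\<^sup>2) \<partial>lborel) = ennreal pi * (\<integral>\<^sup>+x. g x * indicator {0..} x \<partial>lborel)"
proof -
  \<comment> \<open>The sign makes the measures of the rays $\{x<..\}$ finite, so that these determine the measure.\<close>
  let ?M = "distr lborel borel (\<lambda>z. - (cmod z)\<^sup>2)"
  let ?N = "density lborel (\<lambda>x::real. ennreal pi * indicator {..0} x)"
  have M: "emeasure ?M {x<..} = ennreal (pi * max 0 (- x))" for x
  proof -
    have "emeasure ?M {x<..} = emeasure lborel {z. (cmod z)\<^sup>2 < - x}"
      by (subst emeasure_distr) (auto intro!: arg_cong[where f="emeasure lborel"])
    also have "{z. (cmod z)\<^sup>2 < - x} = (if x < 0 then ball 0 (sqrt (- x)) else {})"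
    proof (cases "x < 0")
      case True
      have "{z. (cmod z)\<^sup>2 < - x} = {z. sqrt ((cmod z)\<^sup>2) < sqrt (- x)}"
        by (simp only: real_sqrt_less_iff)
      with True show ?thesis by (simp add: ball_def)
    next
      case False
      then have "\<not> (cmod z)\<^sup>2 < - x" for z
        using zero_le_power2[of "cmod z"] by linarith
      with False show ?thesis by (simp only: if_False Collect_empty_eq) simp
    qed
    also have "emeasure lborel \<dots> = ennreal (pi * max 0 (- x))"
      using emeasure_ball[of "sqrt (-x)" "0::complex"] by (auto simp: unit_ball_vol_2)
    finally show ?thesis .
  qed
  have N: "emeasure ?N {x<..} = ennreal (pi * max 0 (- x))" for x :: real
  proof -
    have "emeasure ?N {x<..} = (\<integral>\<^sup>+y. ennreal pi * indicator ({x<..0}) y \<partial>lborel)"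
      by (subst emeasure_density) (auto intro!: nn_integral_cong split: split_indicator)
    also have "\<dots> = ennreal (pi * max 0 (- x))"
      by (cases "x \<le> 0") (simp_all add: nn_integral_cmult ennreal_mult'[symmetric])
    finally show ?thesis .
  qed
  have MN: "?M = ?N"
    by (rule measure_eqI_lessThan) (simp_all only: M N, simp_all)
  have "(\<integral>\<^sup>+z. g ((cmod z)\<^sup>2) \<partial>lborel) = (\<integral>\<^sup>+x. g (- x) \<partial>?M)"
    by (subst nn_integral_distr) simp_all
  also have "\<dots> = (\<integral>\<^sup>+x. ennreal pi * (g (- x) * indicator {..0} x) \<partial>lborel)"
    unfolding MN by (subst nn_integral_density) (simp_all add: mult_ac)
  also have "\<dots> = ennreal pi * (\<integral>\<^sup>+x. g (- x) * indicator {..0} x \<partial>lborel)"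
    by (rule nn_integral_cmult) simp
  also have "(\<integral>\<^sup>+x. g (- x) * indicator {..0} x \<partial>lborel) = (\<integral>\<^sup>+x. g x * indicator {0..} x \<partial>lborel)"
    using nn_integral_real_affine[of "\<lambda>x. g (- x) * indicator {..0} x" "-1" 0] by (simp add: indicator_def)
  finally show ?thesis .
qed

lemma continuous_on_vector2: "continuous_on UNIV (\<lambda>(z, t). vector [z, t] :: complex^2)"
proof -
  have "(\<lambda>p::complex \<times> complex. vector [fst p, snd p] :: complex^2)
      = (\<lambda>p. \<chi> j. if j = 1 then fst p else snd p)"
    by (auto simp: vec_eq_iff forall_2)
  moreover have "continuous_on UNIV (\<lambda>p::complex \<times> complex. (if j = 1 then fst p else snd p))" for j :: 2
    by (cases "j = 1") (auto intro!: continuous_intros)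
  ultimately show ?thesis by (simp only: split_beta' continuous_on_vec_lambda)
qed

lemma lborel_complex2_eq:
  "(lborel :: (complex^2) measure) = distr (lborel \<Otimes>\<^sub>M lborel) borel (\<lambda>p. vector [fst p, snd p])"
  and measurable_vector2 [measurable]:
  "(\<lambda>p. vector [fst p, snd p] :: complex^2) \<in> borel_measurable (borel \<Otimes>\<^sub>M borel)"
proof -
  have cont: "continuous_on UNIV (\<lambda>p::complex \<times> complex. vector [fst p, snd p] :: complex^2)"
    using continuous_on_vector2 by (simp only: split_beta')
  show meas: "(\<lambda>p. vector [fst p, snd p] :: complex^2) \<in> borel_measurable (borel \<Otimes>\<^sub>M borel)"
    unfolding borel_prod by (intro borel_measurable_continuous_onI cont)
  show "(lborel :: (complex^2) measure) = distr (lborel \<Otimes>\<^sub>M lborel) borel (\<lambda>p. vector [fst p, snd p])"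
  proof (rule lborel_eqI)
    fix l u :: "complex^2"
    assume le: "\<And>b. b \<in> Basis \<Longrightarrow> l \<bullet> b \<le> u \<bullet> b"
    have le': "l $ j \<bullet> b \<le> u $ j \<bullet> b" if "b \<in> Basis" for j b
      using le[of "axis j b"] that by (auto simp: Basis_vec_def inner_axis)
    have B: "(Basis :: (complex^2) set) = axis 1 ` Basis \<union> axis 2 ` Basis"
      by (auto simp: Basis_vec_def UNIV_2)
    have vim: "(\<lambda>p. vector [fst p, snd p]) -` box l u \<inter> space (lborel \<Otimes>\<^sub>M lborel)
        = box (l$1) (u$1) \<times> box (l$2) (u$2)"
      by (auto simp: box_def space_pair_measure B inner_axis ball_Un)
    have P: "(\<Prod>b\<in>Basis. (u - l) \<bullet> b)
        = (\<Prod>b\<in>Basis. (u$1 - l$1) \<bullet> b) * (\<Prod>b\<in>Basis. (u$2 - l$2) \<bullet> b)"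
      unfolding B
      by (subst prod.union_disjoint)
         (auto simp: axis_eq_axis prod.reindex inj_on_def inner_axis)
    show "emeasure (distr (lborel \<Otimes>\<^sub>M lborel) borel (\<lambda>p. vector [fst p, snd p])) (box l u)
        = ennreal (\<Prod>b\<in>Basis. (u - l) \<bullet> b)"
      using le' meas unfolding P
      by (simp add: emeasure_distr vim lborel.emeasure_pair_measure_Times ennreal_mult
          inner_diff_left prod_nonneg)
  qed simp
qed

lemma measurable_vector2' [measurable (raw)]:
  assumes [measurable]: "f \<in> borel_measurable M" "g \<in> borel_measurable M"
  shows "(\<lambda>x. vector [f x, g x] :: complex^2) \<in> borel_measurable M"
  using measurable_compose[OF _ measurable_vector2, of "\<lambda>x. (f x, g x)" M] by simp

lemma measurable_nth2 [measurable]: "(\<lambda>y::complex^2. y $ j) \<in> borel_measurable borel"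
  by (intro borel_measurable_continuous_onI continuous_intros)

lemma nn_integral_complex2:
  fixes f :: "complex^2 \<Rightarrow> ennreal"
  assumes [measurable]: "f \<in> borel_measurable borel"
  shows "(\<integral>\<^sup>+y. f y \<partial>lborel) = (\<integral>\<^sup>+z. \<integral>\<^sup>+t. f (vector [z, t]) \<partial>lborel \<partial>lborel)"
  by (subst lborel_complex2_eq, subst nn_integral_distr)
     (simp_all add: split_beta' lborel.nn_integral_fst[symmetric])

section \<open>Power series against rotation-invariant weights\<close>

lemma borel_measurable_cnj [measurable]: "cnj \<in> borel_measurable borel"
  by (intro borel_measurable_continuous_onI continuous_intros)

lemma integral_rotate:
  fixes g :: "complex \<Rightarrow> complex"
  assumes c: "cmod c = 1" and [measurable]: "g \<in> borel_measurable borel"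
  shows "(\<integral>z. g (c * z) \<partial>lborel) = (\<integral>z. g z \<partial>lborel)"
proof -
  have "(\<integral>z. g z \<partial>lborel) = (\<integral>z. g z \<partial>distr lborel borel ((*) c))"
    by (simp add: lborel_complex_rotate[OF c])
  also have "\<dots> = (\<integral>z. g (c * z) \<partial>lborel)"
    by (rule integral_distr) simp_all
  finally show ?thesis ..
qed

text \<open>
  A rotation by the angle $\pi/(j-k)$ preserves the weight and changes the sign of the
  integrand.
\<close>
lemma monomials_orthogonal:
  fixes w :: "complex \<Rightarrow> real"
  assumes [measurable]: "w \<in> borel_measurable borel"
    and rot: "\<And>c z. cmod c = 1 \<Longrightarrow> w (c * z) = w z" and jk: "j \<noteq> k"
  shows "(\<integral>z. z ^ j * cnj (z ^ k) * of_real (w z) \<partial>lborel) = 0"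
proof -
  \<comment> \<open>Then $c^j \overline{c}^k = e^{i \pi} = -1$.\<close>
  define c where "c = cis (pi / (real j - real k))"
  have c: "cmod c = 1" by (simp add: c_def)
  have "c ^ j * cnj (c ^ k) = cis (real j * (pi / (real j - real k)) - real k * (pi / (real j - real k)))"
    by (simp add: c_def cis_cnj Complex.DeMoivre cis_mult)
  also have "real j * (pi / (real j - real k)) - real k * (pi / (real j - real k)) = pi"
    using jk by (simp only: left_diff_distrib[symmetric]) simp
  finally have m1: "c ^ j * cnj (c ^ k) = -1" by simp
  have "(\<integral>z. z ^ j * cnj (z ^ k) * of_real (w z) \<partial>lborel)
      = (\<integral>z. (c * z) ^ j * cnj ((c * z) ^ k) * of_real (w (c * z)) \<partial>lborel)"
    by (rule integral_rotate[OF c, symmetric]) measurable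
  also have "\<dots> = (\<integral>z. (c ^ j * cnj (c ^ k)) * (z ^ j * cnj (z ^ k) * of_real (w z)) \<partial>lborel)"
    unfolding rot[OF c] by (simp only: power_mult_distrib complex_cnj_mult mult_ac)
  also have "\<dots> = - (\<integral>z. z ^ j * cnj (z ^ k) * of_real (w z) \<partial>lborel)"
    unfolding m1 by simp
  finally show ?thesis by simp
qed

text \<open>
  On a disc the power series converges uniformly, so integration term by term is allowed and
  orthogonality leaves only the $k$-th term. Dominated convergence then exhausts the plane by
  discs.
\<close>
lemma power_series_coefficient_integral:
  fixes F :: "complex \<Rightarrow> complex" and w :: "complex \<Rightarrow> real"
  assumes F: "\<And>z. (\<lambda>j. a j * z ^ j) sums F z"
    and contw: "continuous_on UNIV w" and w0: "\<And>z. 0 \<le> w z"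
    and rot: "\<And>c z. cmod c = 1 \<Longrightarrow> w (c * z) = w z"
    and int: "integrable lborel (\<lambda>z. F z * cnj (z ^ k) * of_real (w z))"
    and intk: "integrable lborel (\<lambda>z. (cmod z) ^ (2 * k) * w z)"
  shows "(\<integral>z. F z * cnj (z ^ k) * of_real (w z) \<partial>lborel)
       = a k * of_real (\<integral>z. (cmod z) ^ (2 * k) * w z \<partial>lborel)"
proof -
  have [measurable]: "w \<in> borel_measurable borel"
    by (rule borel_measurable_continuous_onI[OF contw])
  have [measurable]: "F \<in> borel_measurable borel"
    by (rule borel_measurable_LIMSEQ_metric[of "\<lambda>n z. \<Sum>j<n. a j * z ^ j"])
       (use F in \<open>auto simp: sums_def\<close>)
  let ?D = "\<lambda>n z. if cmod z \<le> real n then 1 else 0 :: real"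
  have Dn: "(\<lambda>n. ?D n z) \<longlonglongrightarrow> 1" for z :: complex
  proof (rule tendsto_eventually)
    show "\<forall>\<^sub>F n in sequentially. ?D n z = 1"
      using eventually_ge_at_top[of "nat \<lceil>cmod z\<rceil>"]
      by eventually_elim (auto simp: nat_ceiling_le_eq)
  qed
  have fin: "(\<integral>z. F z * cnj (z ^ k) * of_real (?D N z * w z) \<partial>lborel)
      = a k * of_real (\<integral>z. (cmod z) ^ (2 * k) * (?D N z * w z) \<partial>lborel)" for N
  proof -
    let ?w = "\<lambda>z. ?D N z * w z"
    have rot': "?w (c * z) = ?w z" if "cmod c = 1" for c z
      using that by (simp add: rot norm_mult)
    have mono: "(\<integral>z. z ^ j * cnj (z ^ k) * of_real (?w z) \<partial>lborel)
        = (if j = k then of_real (\<integral>z. (cmod z) ^ (2 * k) * ?w z \<partial>lborel) else 0)" for j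
    proof (cases "j = k")
      case True
      have "z ^ k * cnj (z ^ k) * of_real (?w z) = of_real ((cmod z) ^ (2 * k) * ?w z)" for z
        by (simp only: complex_norm_square[symmetric] norm_power of_real_mult of_real_power
            power_mult[symmetric] mult.commute)
      then show ?thesis using True by (simp only: simp_thms if_True integral_complex_of_real)
    next
      case False
      have "?w \<in> borel_measurable borel" by measurable
      from monomials_orthogonal[OF this rot' False] show ?thesis using False by (simp only: if_False)
    qed
    \<comment> \<open>\<open>S\<close> bounds the partial sums on the disc of radius \<open>N\<close>, and \<open>W\<close> below bounds the weight.\<close>
    define S where "S = (\<Sum>j. cmod (a j) * real N ^ j)"
    have "summable (\<lambda>j. a j * of_nat (Suc N) ^ j)"
      using F sums_summable by blast
    then have sN: "summable (\<lambda>j. norm (a j * of_nat N ^ j))"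
      by (rule powser_insidea) (simp only: norm_of_nat of_nat_less_iff lessI)
    have bound: "cmod (\<Sum>j<n. a j * z ^ j) \<le> S" if "cmod z \<le> real N" for n z
    proof -
      have "cmod (\<Sum>j<n. a j * z ^ j) \<le> (\<Sum>j<n. cmod (a j) * real N ^ j)"
        by (rule order_trans[OF norm_sum])
           (auto intro!: sum_mono mult_left_mono power_mono simp: norm_mult norm_power that)
      also have "\<dots> \<le> S"
        unfolding S_def using sN by (intro sum_le_suminf) (auto simp: norm_mult norm_power)
      finally show ?thesis .
    qed
    have "bounded (w ` cball 0 (real N))"
      by (intro compact_imp_bounded compact_continuous_image continuous_on_subset[OF contw] compact_cball) auto
    then obtain W where "\<forall>z\<in>cball 0 (real N). norm (w z) \<le> W"
      unfolding bounded_iff by auto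
    then have W: "w z \<le> W" if "cmod z \<le> real N" for z
      using that by force
    have W0: "0 \<le> W" using W[of 0] w0[of 0] by simp
    have int0: "integrable lborel (?D N)"
    proof -
      have "integrable lborel (indicator (cball 0 (real N)) :: complex \<Rightarrow> real)"
        using emeasure_bounded_finite[OF bounded_cball, of "0::complex" "real N"]
        by (simp add: integrable_indicator_iff infinity_ennreal_def)
      then show ?thesis
        by (rule Bochner_Integration.integrable_cong[THEN iffD1, rotated -1]) auto
    qed
    have int1: "integrable lborel (\<lambda>z. ?D N z *\<^sub>R (C * real N ^ k * W))" for C :: real
      using int0 by (rule integrable_scaleR_left)
    have dom: "cmod (G * cnj (z ^ k) * of_real (?w z)) \<le> ?D N z *\<^sub>R (C * real N ^ k * W)"
      if "cmod z \<le> real N \<Longrightarrow> cmod G \<le> C" for G z C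
      using that W[of z] w0[of z] W0 norm_ge_zero[of G]
      by (auto simp: norm_mult norm_power intro!: mult_mono power_mono mult_nonneg_nonneg
          intro: order_trans[OF norm_ge_zero])
    have lim: "(\<lambda>n. \<integral>z. (\<Sum>j<n. a j * z ^ j) * cnj (z ^ k) * of_real (?w z) \<partial>lborel)
        \<longlonglongrightarrow> (\<integral>z. F z * cnj (z ^ k) * of_real (?w z) \<partial>lborel)"
    proof (rule integral_dominated_convergence[OF _ _ int1])
      show "AE z in lborel. (\<lambda>n. (\<Sum>j<n. a j * z ^ j) * cnj (z ^ k) * of_real (?w z))
          \<longlonglongrightarrow> F z * cnj (z ^ k) * of_real (?w z)"
        using F by (intro AE_I2 tendsto_intros) (auto simp: sums_def)
      show "AE z in lborel. norm ((\<Sum>j<n. a j * z ^ j) * cnj (z ^ k) * of_real (?w z))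
          \<le> ?D N z *\<^sub>R (S * real N ^ k * W)" for n
        by (intro AE_I2 dom bound)
    qed measurable
    have partial: "(\<integral>z. (\<Sum>j<n. a j * z ^ j) * cnj (z ^ k) * of_real (?w z) \<partial>lborel)
        = (\<Sum>j<n. a j * (\<integral>z. z ^ j * cnj (z ^ k) * of_real (?w z) \<partial>lborel))" for n
    proof -
      have "integrable lborel (\<lambda>z. z ^ j * cnj (z ^ k) * of_real (?w z))" for j
      proof (rule Bochner_Integration.integrable_bound[OF int1[of "real N ^ j"]])
        show "AE z in lborel. norm (z ^ j * cnj (z ^ k) * of_real (?w z))
            \<le> norm (?D N z *\<^sub>R (real N ^ j * real N ^ k * W))"
          by (intro AE_I2 order_trans[OF dom[where C="real N ^ j"]])
             (auto simp: norm_power power_mono)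
      qed measurable
      then have "(\<integral>z. (\<Sum>j<n. a j * (z ^ j * cnj (z ^ k) * of_real (?w z))) \<partial>lborel)
          = (\<Sum>j<n. a j * (\<integral>z. z ^ j * cnj (z ^ k) * of_real (?w z) \<partial>lborel))"
        by (subst Bochner_Integration.integral_sum) (simp_all only: integrable_mult_right integral_mult_right_zero)
      then show ?thesis by (simp only: sum_distrib_right mult.assoc)
    qed
    have "(\<lambda>n. \<Sum>j<n. a j * (\<integral>z. z ^ j * cnj (z ^ k) * of_real (?w z) \<partial>lborel))
        \<longlonglongrightarrow> a k * of_real (\<integral>z. (cmod z) ^ (2 * k) * ?w z \<partial>lborel)"
    proof (rule tendsto_eventually)
      show "\<forall>\<^sub>F n in sequentially. (\<Sum>j<n. a j * (\<integral>z. z ^ j * cnj (z ^ k) * of_real (?w z) \<partial>lborel))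
          = a k * of_real (\<integral>z. (cmod z) ^ (2 * k) * ?w z \<partial>lborel)"
        using eventually_gt_at_top[of k]
        by eventually_elim (simp only: mono if_distrib[of "(*) _"] mult_zero_right sum.delta'
          sum.delta finite_lessThan lessThan_iff if_True)
    qed
    from LIMSEQ_unique[OF lim[unfolded partial] this] show ?thesis .
  qed
  have lim1: "(\<lambda>N. \<integral>z. F z * cnj (z ^ k) * of_real (?D N z * w z) \<partial>lborel)
      \<longlonglongrightarrow> (\<integral>z. F z * cnj (z ^ k) * of_real (w z) \<partial>lborel)"
  proof (rule integral_dominated_convergence[OF _ _ integrable_norm[OF int]])
    show "AE z in lborel. (\<lambda>N. F z * cnj (z ^ k) * of_real (?D N z * w z))
        \<longlonglongrightarrow> F z * cnj (z ^ k) * of_real (w z)"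
    proof (rule AE_I2)
      fix z
      have "(\<lambda>N. F z * cnj (z ^ k) * of_real (?D N z * w z)) \<longlonglongrightarrow> F z * cnj (z ^ k) * of_real (1 * w z)"
        by (intro tendsto_intros Dn)
      then show "(\<lambda>N. F z * cnj (z ^ k) * of_real (?D N z * w z)) \<longlonglongrightarrow> F z * cnj (z ^ k) * of_real (w z)"
        by (simp only: mult_1_left)
    qed
    show "AE z in lborel. norm (F z * cnj (z ^ k) * of_real (?D N z * w z))
        \<le> norm (F z * cnj (z ^ k) * of_real (w z))" for N
      by (intro AE_I2) auto
  qed measurable
  have lim2: "(\<lambda>N. \<integral>z. (cmod z) ^ (2 * k) * (?D N z * w z) \<partial>lborel)
      \<longlonglongrightarrow> (\<integral>z. (cmod z) ^ (2 * k) * w z \<partial>lborel)"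
  proof (rule integral_dominated_convergence[OF _ _ intk])
    show "AE z in lborel. (\<lambda>N. (cmod z) ^ (2 * k) * (?D N z * w z)) \<longlonglongrightarrow> (cmod z) ^ (2 * k) * w z"
    proof (rule AE_I2)
      fix z
      have "(\<lambda>N. (cmod z) ^ (2 * k) * (?D N z * w z)) \<longlonglongrightarrow> (cmod z) ^ (2 * k) * (1 * w z)"
        by (intro tendsto_intros Dn)
      then show "(\<lambda>N. (cmod z) ^ (2 * k) * (?D N z * w z)) \<longlonglongrightarrow> (cmod z) ^ (2 * k) * w z"
        by (simp only: mult_1_left)
    qed
    show "AE z in lborel. norm ((cmod z) ^ (2 * k) * (?D N z * w z)) \<le> (cmod z) ^ (2 * k) * w z" for N
      using w0 by (intro AE_I2) auto
  qed measurable
  have "(\<lambda>N. \<integral>z. F z * cnj (z ^ k) * of_real (?D N z * w z) \<partial>lborel)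
      \<longlonglongrightarrow> a k * of_real (\<integral>z. (cmod z) ^ (2 * k) * w z \<partial>lborel)"
    unfolding fin by (intro tendsto_intros lim2)
  with lim1 show ?thesis by (rule LIMSEQ_unique)
qed

section \<open>Weighted integrals of monomials in two variables\<close>

lemma nn_integral_power_exp:
  assumes c: "c > 0"
  shows "(\<integral>\<^sup>+x. ennreal (x ^ k * exp (- c * x)) * indicator {0..} x \<partial>lborel) = ennreal (fact k / c ^ Suc k)"
proof -
  have "ennreal (fact k) = (\<integral>\<^sup>+x. ennreal (x ^ k * exp (- x)) * indicator {0..} x \<partial>lborel)"
    using nn_intergal_power_times_exp_Ici[of k] by simp
  also have "\<dots> = ennreal c * (\<integral>\<^sup>+x. ennreal ((c * x) ^ k * exp (- (c * x))) * indicator {0..} (c * x) \<partial>lborel)"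
    using nn_integral_real_affine[of "\<lambda>x. ennreal (x ^ k * exp (- x)) * indicator {0..} x" c 0] c by simp
  also have "\<dots> = ennreal c * (\<integral>\<^sup>+x. ennreal (c ^ k) * (ennreal (x ^ k * exp (- c * x)) * indicator {0..} x) \<partial>lborel)"
  proof (rule arg_cong2[where f="(*)", OF refl nn_integral_cong])
    fix x :: real
    show "ennreal ((c * x) ^ k * exp (- (c * x))) * indicator {0..} (c * x)
        = ennreal (c ^ k) * (ennreal (x ^ k * exp (- c * x)) * indicator {0..} x)"
    proof (cases "0 \<le> x")
      case True
      with c have "0 \<le> c * x" by simp
      with True c show ?thesis
        by (simp only: indicator_simps atLeast_iff mult_1_right power_mult_distrib mult.assoc
            ennreal_mult'[symmetric] zero_le_power less_imp_le mult_minus_left)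
    next
      case False
      with c have "\<not> 0 \<le> c * x" by (simp add: zero_le_mult_iff)
      with False show ?thesis by simp
    qed
  qed
  also have "\<dots> = ennreal (c ^ Suc k) * (\<integral>\<^sup>+x. ennreal (x ^ k * exp (- c * x)) * indicator {0..} x \<partial>lborel)"
    using c by (subst nn_integral_cmult) (simp_all add: ennreal_mult mult.assoc)
  finally have *: "ennreal (fact k)
      = ennreal (c ^ Suc k) * (\<integral>\<^sup>+x. ennreal (x ^ k * exp (- c * x)) * indicator {0..} x \<partial>lborel)" .
  have "ennreal (fact k / c ^ Suc k) = ennreal (1 / c ^ Suc k) * ennreal (fact k)"
    using c by (simp add: ennreal_mult'[symmetric])
  also have "\<dots> = ennreal (1 / c ^ Suc k * c ^ Suc k) *
      (\<integral>\<^sup>+x. ennreal (x ^ k * exp (- c * x)) * indicator {0..} x \<partial>lborel)"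
    unfolding * using c by (subst ennreal_mult) (simp_all only: mult.assoc, simp_all)
  also have "1 / c ^ Suc k * c ^ Suc k = 1" using c by simp
  finally show ?thesis by simp
qed

text \<open>
  The Beta integral: writing $(1+y)^{-(n+2)}$ as the integral of $s^{n+1} e^{-(1+y)s} / (n+1)!$
  over $s$ and exchanging the integrals leaves two Gamma integrals.
\<close>
lemma nn_integral_beta:
  assumes b: "b \<le> n"
  shows "(\<integral>\<^sup>+y. ennreal (y ^ b / (1 + y) ^ (n + 2)) * indicator {0..} y \<partial>lborel)
       = ennreal (fact b * fact (n - b) / fact (n + 1))"
proof -
  let ?I = "indicator {0..} :: real \<Rightarrow> ennreal"
  have 1: "ennreal (y ^ b / (1 + y) ^ (n + 2)) * ?I y
      = (\<integral>\<^sup>+s. ennreal (y ^ b * (s ^ (n + 1) * exp (- (1 + y) * s)) / fact (n + 1)) * ?I s * ?I y \<partial>lborel)" for y :: real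
  proof (cases "y \<ge> 0")
    case True
    have "(\<integral>\<^sup>+s. ennreal (y ^ b * (s ^ (n + 1) * exp (- (1 + y) * s)) / fact (n + 1)) * ?I s * ?I y \<partial>lborel)
        = (\<integral>\<^sup>+s. ennreal (y ^ b / fact (n + 1)) * (ennreal (s ^ (n + 1) * exp (- (1 + y) * s)) * ?I s) \<partial>lborel)"
      using True by (intro nn_integral_cong)
        (auto simp: ennreal_mult'[symmetric] field_simps split: split_indicator)
    also have "\<dots> = ennreal (y ^ b / fact (n + 1)) * ennreal (fact (n + 1) / (1 + y) ^ Suc (n + 1))"
      using True by (subst nn_integral_cmult) (simp_all only: nn_integral_power_exp add_pos_nonneg zero_less_one, measurable)
    also have "\<dots> = ennreal (y ^ b / (1 + y) ^ (n + 2)) * ?I y"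
      using True by (simp add: ennreal_mult'[symmetric])
    finally show ?thesis ..
  qed simp
  have "(\<integral>\<^sup>+y. ennreal (y ^ b / (1 + y) ^ (n + 2)) * ?I y \<partial>lborel)
      = (\<integral>\<^sup>+s. \<integral>\<^sup>+y. ennreal (y ^ b * (s ^ (n + 1) * exp (- (1 + y) * s)) / fact (n + 1)) * ?I s * ?I y \<partial>lborel \<partial>lborel)"
    unfolding 1 by (rule nn_integral_lborel_swap) measurable
  also have "\<dots> = (\<integral>\<^sup>+s. ennreal (fact b / fact (n + 1)) * (ennreal (s ^ (n - b) * exp (- 1 * s)) * ?I s) \<partial>lborel)"
  proof (rule nn_integral_cong_AE)
    have "AE s in lborel. s \<noteq> (0::real)" by (rule AE_lborel_singleton)
    then show "AE s in lborel.
        (\<integral>\<^sup>+y. ennreal (y ^ b * (s ^ (n + 1) * exp (- (1 + y) * s)) / fact (n + 1)) * ?I s * ?I y \<partial>lborel)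
        = ennreal (fact b / fact (n + 1)) * (ennreal (s ^ (n - b) * exp (- 1 * s)) * ?I s)"
    proof eventually_elim
      fix s :: real assume s0: "s \<noteq> 0"
      show "(\<integral>\<^sup>+y. ennreal (y ^ b * (s ^ (n + 1) * exp (- (1 + y) * s)) / fact (n + 1)) * ?I s * ?I y \<partial>lborel)
        = ennreal (fact b / fact (n + 1)) * (ennreal (s ^ (n - b) * exp (- 1 * s)) * ?I s)"
      proof (cases "s > 0")
        case True
        have "(\<integral>\<^sup>+y. ennreal (y ^ b * (s ^ (n + 1) * exp (- (1 + y) * s)) / fact (n + 1)) * ?I s * ?I y \<partial>lborel)
          = (\<integral>\<^sup>+y. ennreal (s ^ (n + 1) * exp (- s) / fact (n + 1)) * (ennreal (y ^ b * exp (- s * y)) * ?I y) \<partial>lborel)"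
          using True by (intro nn_integral_cong)
            (auto simp: ennreal_mult'[symmetric] field_simps exp_add[symmetric] exp_minus exp_diff split: split_indicator)
        also have "\<dots> = ennreal (s ^ (n + 1) * exp (- s) / fact (n + 1)) * ennreal (fact b / s ^ Suc b)"
          using True by (subst nn_integral_cmult) (simp_all only: nn_integral_power_exp, measurable)
        also have "\<dots> = ennreal (fact b / fact (n + 1)) * (ennreal (s ^ (n - b) * exp (- 1 * s)) * ?I s)"
        proof -
          have "s ^ (n + 1) = s ^ (n - b) * s ^ Suc b"
            using b by (simp only: power_add[symmetric]) simp
          then show ?thesis using True by (simp add: ennreal_mult'[symmetric])
        qed
        finally show ?thesis .
      qed (use s0 in \<open>simp add: indicator_def\<close>)
    qed
  qed
  also have "\<dots> = ennreal (fact b / fact (n + 1)) * ennreal (fact (n - b) / 1 ^ Suc (n - b))"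
    by (subst nn_integral_cmult) (simp_all only: nn_integral_power_exp zero_less_one, measurable)
  also have "\<dots> = ennreal (fact b * fact (n - b) / fact (n + 1))"
    by (simp add: ennreal_mult'[symmetric])
  finally show ?thesis .
qed

text \<open>
  The squared length of the frame over the first chart for the $m$-th power of the bundle times
  the density of the volume form, in the chart coordinates $(z, t)$.
\<close>
definition weight :: "nat \<Rightarrow> complex \<Rightarrow> complex \<Rightarrow> real" where
  "weight m z t = exp (- (real m * ((cmod z)\<^sup>2 * (1 + (cmod t)\<^sup>2)))) / (1 + (cmod t)\<^sup>2) ^ m *
     ((cmod z)\<^sup>2 + 1 / (1 + (cmod t)\<^sup>2)) / pi\<^sup>2"

text \<open>
  The squared norm of the section $z^k t^b$.
\<close>
definition monomial_norm :: "nat \<Rightarrow> nat \<Rightarrow> nat \<Rightarrow> real" where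
  "monomial_norm m k b = fact k * fact b * fact (k + m - b) / (real m ^ (k + 2) * fact (k + m))"

text \<open>
  The integral of $|z|^{2k}$ against the weight over the fibre $t = $ const, as a function of $s
  = |t|^2$.
\<close>
definition fibre_norm :: "nat \<Rightarrow> nat \<Rightarrow> real \<Rightarrow> real" where
  "fibre_norm m k s = real (k + m + 1) * fact k / (pi * real m ^ (k + 2)) / (1 + s) ^ (k + m + 2)"

lemma one_plus_cmod2 [simp]: "0 < 1 + (cmod t)\<^sup>2" "1 + (cmod t)\<^sup>2 \<noteq> 0" "0 \<le> 1 + (cmod t)\<^sup>2"
  using zero_le_power2[of "cmod t"] by linarith+

lemma weight_nonneg [simp]: "0 \<le> weight m z t"
  by (simp add: weight_def)

lemma fibre_norm_nonneg [simp]: "0 \<le> s \<Longrightarrow> 0 \<le> fibre_norm m k s"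
  by (simp add: fibre_norm_def)

lemma weight_measurable [measurable (raw)]:
  assumes [measurable]: "f \<in> borel_measurable M" "g \<in> borel_measurable M"
  shows "(\<lambda>x. weight m (f x) (g x)) \<in> borel_measurable M"
  unfolding weight_def by measurable

text \<open>
  With $x = |z|^2$ and $s = 1 + |t|^2$ the integrand is a combination of $x^{k+1} e^{-msx}$ and
  $x^k e^{-msx}$.
\<close>
lemma nn_integral_fibre:
  assumes m: "m \<ge> 1"
  shows "(\<integral>\<^sup>+z. ennreal (cmod z ^ (2 * k) * weight m z t) \<partial>lborel) = ennreal (fibre_norm m k ((cmod t)\<^sup>2))"
proof -
  define s where "s = 1 + (cmod t)\<^sup>2"
  have s: "s > 0" by (simp add: s_def)
  let ?g = "\<lambda>x. ennreal (x ^ k * (exp (- (real m * (x * s))) / s ^ m * (x + 1 / s) / pi\<^sup>2))"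
  have "(\<integral>\<^sup>+z. ennreal (cmod z ^ (2 * k) * weight m z t) \<partial>lborel) = (\<integral>\<^sup>+z. ?g ((cmod z)\<^sup>2) \<partial>lborel)"
    by (simp add: weight_def s_def power_mult)
  also have "\<dots> = ennreal pi * (\<integral>\<^sup>+x. ?g x * indicator {0..} x \<partial>lborel)"
    by (rule nn_integral_complex_radial) measurable
  also have "(\<integral>\<^sup>+x. ?g x * indicator {0..} x \<partial>lborel)
      = (\<integral>\<^sup>+x. ennreal (1 / (pi\<^sup>2 * s ^ m)) * (ennreal (x ^ Suc k * exp (- (real m * s) * x)) * indicator {0..} x)
         + ennreal (1 / (pi\<^sup>2 * s ^ Suc m)) * (ennreal (x ^ k * exp (- (real m * s) * x)) * indicator {0..} x) \<partial>lborel)"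
    using s by (intro nn_integral_cong)
      (auto simp: ennreal_mult'[symmetric] ennreal_plus[symmetric] field_simps split: split_indicator simp del: ennreal_plus)
  also have "\<dots> = ennreal (1 / (pi\<^sup>2 * s ^ m)) * ennreal (fact (Suc k) / (real m * s) ^ Suc (Suc k))
      + ennreal (1 / (pi\<^sup>2 * s ^ Suc m)) * ennreal (fact k / (real m * s) ^ Suc k)"
  proof -
    have "0 < real m * s" using m s by simp
    then show ?thesis
      by (simp only: nn_integral_power_exp[symmetric]) (simp add: nn_integral_add nn_integral_cmult)
  qed
  also have "ennreal pi * \<dots> = ennreal (pi * (1 / (pi\<^sup>2 * s ^ m) * (fact (Suc k) / (real m * s) ^ Suc (Suc k))
      + 1 / (pi\<^sup>2 * s ^ Suc m) * (fact k / (real m * s) ^ Suc k)))"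
  proof -
    have gen: "ennreal pi * (ennreal a * ennreal b + ennreal c * ennreal d) = ennreal (pi * (a * b + c * d))"
      if "0 \<le> a" "0 \<le> b" "0 \<le> c" "0 \<le> d" for a b c d :: real
      using that by (simp add: ennreal_mult)
    show ?thesis by (rule gen) (use s in simp_all)
  qed
  also have "pi * (1 / (pi\<^sup>2 * s ^ m) * (fact (Suc k) / (real m * s) ^ Suc (Suc k))
      + 1 / (pi\<^sup>2 * s ^ Suc m) * (fact k / (real m * s) ^ Suc k)) = fibre_norm m k ((cmod t)\<^sup>2)"
  proof -
    have alg: "pi * (1 / (pi\<^sup>2 * T) * ((1 + K) * F / (x * (x * P) * (s * (s * S))))
        + 1 / (pi\<^sup>2 * (s * T)) * (F / (x * P * (s * S)))) = (K + x + 1) * F / (pi * (P * (x * x))) / (S * T * (s * s))"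
      if "x > 0" "P > 0" "S > 0" "T > 0" for T K F x P S :: real
    proof -
      have "pi * (1 / (pi\<^sup>2 * T) * ((1 + K) * F / (x * (x * P) * (s * (s * S))))
          + 1 / (pi\<^sup>2 * (s * T)) * (F / (x * P * (s * S))))
          = (1 + K) * F / (pi * T * x * x * P * s * s * S) + F / (pi * T * x * P * s * s * S)"
        using that s by (simp add: power2_eq_square distrib_left distrib_right add_divide_distrib mult_ac)
      also have "\<dots> = (1 + K) * F / (pi * T * x * x * P * s * s * S) + x * F / (pi * T * x * x * P * s * s * S)"
        using that s by simp
      also have "\<dots> = ((1 + K) * F + x * F) / (pi * T * x * x * P * s * s * S)"
        by (rule add_divide_distrib[symmetric])
      also have "\<dots> = (K + x + 1) * F / (pi * (P * (x * x))) / (S * T * (s * s))"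
        by (simp add: algebra_simps)
      finally show ?thesis .
    qed
    show ?thesis
      using alg[of "real m" "real m ^ k" "s ^ k" "s ^ m" "real k" "fact k"] s m
      unfolding fibre_norm_def s_def[symmetric]
      by (simp add: power_add power_mult_distrib power2_eq_square mult_ac add_ac)
  qed
  finally show ?thesis .
qed

lemma nn_integral_base:
  assumes m: "m \<ge> 1" and b: "b \<le> k + m"
  shows "(\<integral>\<^sup>+t. ennreal (cmod t ^ (2 * b) * fibre_norm m k ((cmod t)\<^sup>2)) \<partial>lborel) = ennreal (monomial_norm m k b)"
proof -
  let ?C = "real (k + m + 1) * fact k / (pi * real m ^ (k + 2))"
  let ?g = "\<lambda>y. ennreal (y ^ b * fibre_norm m k y)"
  have "(\<integral>\<^sup>+t. ennreal (cmod t ^ (2 * b) * fibre_norm m k ((cmod t)\<^sup>2)) \<partial>lborel) = (\<integral>\<^sup>+t. ?g ((cmod t)\<^sup>2) \<partial>lborel)"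
    by (simp add: power_mult)
  also have "\<dots> = ennreal pi * (\<integral>\<^sup>+y. ?g y * indicator {0..} y \<partial>lborel)"
    by (rule nn_integral_complex_radial) (unfold fibre_norm_def, measurable)
  also have "(\<integral>\<^sup>+y. ?g y * indicator {0..} y \<partial>lborel)
      = (\<integral>\<^sup>+y. ennreal ?C * (ennreal (y ^ b / (1 + y) ^ (k + m + 2)) * indicator {0..} y) \<partial>lborel)"
    unfolding fibre_norm_def
    by (intro nn_integral_cong) (auto simp: ennreal_mult'[symmetric] split: split_indicator)
  also have "\<dots> = ennreal ?C * ennreal (fact b * fact (k + m - b) / fact (k + m + 1))"
    by (subst nn_integral_cmult) (measurable, simp only: nn_integral_beta[OF b])
  also have "ennreal pi * \<dots> = ennreal (pi * (?C * (fact b * fact (k + m - b) / fact (k + m + 1))))"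
    by (simp add: ennreal_mult'[symmetric] del: fact_Suc)
  also have "pi * (?C * (fact b * fact (k + m - b) / fact (k + m + 1))) = monomial_norm m k b"
  proof -
    have cancel: "pi * (X * A / (pi * M) * (B * C / (X * F))) = A * B * C / (M * F)"
      if "X > 0" for X A M B C F :: real
      using that by simp
    have "fact (k + m + 1) = real (k + m + 1) * fact (k + m)" by simp
    then show ?thesis unfolding monomial_norm_def by (simp only: cancel of_nat_0_less_iff add_pos_pos)
  qed
  finally show ?thesis .
qed

lemma nn_integral_monomial:
  assumes m: "m \<ge> 1" and b: "b \<le> k + m"
  shows "(\<integral>\<^sup>+y. ennreal ((cmod ((y :: complex^2)$1 ^ k * y$2 ^ b))\<^sup>2 * weight m (y$1) (y$2)) \<partial>lborel) = ennreal (monomial_norm m k b)"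
proof -
  have "(\<integral>\<^sup>+y. ennreal ((cmod ((y :: complex^2)$1 ^ k * y$2 ^ b))\<^sup>2 * weight m (y$1) (y$2)) \<partial>lborel)
     = (\<integral>\<^sup>+z. \<integral>\<^sup>+t. ennreal ((cmod (z ^ k * t ^ b))\<^sup>2 * weight m z t) \<partial>lborel \<partial>lborel)"
    using nn_integral_complex2[of "\<lambda>y. ennreal ((cmod (y$1 ^ k * y$2 ^ b))\<^sup>2 * weight m (y$1) (y$2))"]
    by simp
  also have "\<dots> = (\<integral>\<^sup>+t. \<integral>\<^sup>+z. ennreal ((cmod (z ^ k * t ^ b))\<^sup>2 * weight m z t) \<partial>lborel \<partial>lborel)"
    by (rule nn_integral_lborel_swap) measurable
  also have "\<dots> = (\<integral>\<^sup>+t. \<integral>\<^sup>+z. ennreal (cmod t ^ (2 * b)) * ennreal (cmod z ^ (2 * k) * weight m z t) \<partial>lborel \<partial>lborel)"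
    by (intro nn_integral_cong)
       (simp add: ennreal_mult'[symmetric] norm_mult norm_power power_mult_distrib power_mult[symmetric] mult_ac)
  also have "\<dots> = (\<integral>\<^sup>+t. ennreal (cmod t ^ (2 * b)) * ennreal (fibre_norm m k ((cmod t)\<^sup>2)) \<partial>lborel)"
    by (intro nn_integral_cong, subst nn_integral_cmult) (measurable, simp only: nn_integral_fibre[OF m])
  also have "\<dots> = ennreal (monomial_norm m k b)"
    by (simp only: nn_integral_base[OF m b, symmetric] ennreal_mult'[symmetric] zero_le_power norm_ge_zero)
  finally show ?thesis .
qed

lemma has_integral_fibre:
  assumes m: "m \<ge> 1"
  shows "integrable lborel (\<lambda>z. cmod z ^ (2 * k) * weight m z t)"
    and "(\<integral>z. cmod z ^ (2 * k) * weight m z t \<partial>lborel) = fibre_norm m k ((cmod t)\<^sup>2)"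
proof -
  have "has_bochner_integral lborel (\<lambda>z. cmod z ^ (2 * k) * weight m z t) (fibre_norm m k ((cmod t)\<^sup>2))"
    by (rule has_bochner_integral_nn_integral) (simp_all add: nn_integral_fibre[OF m])
  then show "integrable lborel (\<lambda>z. cmod z ^ (2 * k) * weight m z t)"
    and "(\<integral>z. cmod z ^ (2 * k) * weight m z t \<partial>lborel) = fibre_norm m k ((cmod t)\<^sup>2)"
    by (simp_all add: has_bochner_integral_iff)
qed

lemma monomial_norm_pos: "m \<ge> 1 \<Longrightarrow> monomial_norm m k b > 0"
  by (simp add: monomial_norm_def)

lemma fibre_norm_measurable [measurable (raw)]:
  assumes [measurable]: "f \<in> borel_measurable M"
  shows "(\<lambda>x. fibre_norm m k (f x)) \<in> borel_measurable M"
  unfolding fibre_norm_def by measurable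

lemma has_integral_base:
  assumes m: "m \<ge> 1" and b: "b \<le> k + m"
  shows "integrable lborel (\<lambda>t. cmod t ^ (2 * b) * fibre_norm m k ((cmod t)\<^sup>2))"
    and "(\<integral>t. cmod t ^ (2 * b) * fibre_norm m k ((cmod t)\<^sup>2) \<partial>lborel) = monomial_norm m k b"
proof -
  have "has_bochner_integral lborel (\<lambda>t. cmod t ^ (2 * b) * fibre_norm m k ((cmod t)\<^sup>2)) (monomial_norm m k b)"
    using monomial_norm_pos[OF m, of k b]
    by (intro has_bochner_integral_nn_integral) (simp_all add: nn_integral_base[OF m b])
  then show "integrable lborel (\<lambda>t. cmod t ^ (2 * b) * fibre_norm m k ((cmod t)\<^sup>2))"
    and "(\<integral>t. cmod t ^ (2 * b) * fibre_norm m k ((cmod t)\<^sup>2) \<partial>lborel) = monomial_norm m k b"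
    by (simp_all add: has_bochner_integral_iff)
qed

lemma base_orthogonality:
  assumes m: "m \<ge> 1" and b: "b \<le> k + m" and b': "b' \<le> k + m"
  shows "integrable lborel (\<lambda>t. t ^ b' * cnj (t ^ b) * of_real (fibre_norm m k ((cmod t)\<^sup>2)))"
    and "(\<integral>t. t ^ b' * cnj (t ^ b) * of_real (fibre_norm m k ((cmod t)\<^sup>2)) \<partial>lborel)
       = (if b' = b then of_real (monomial_norm m k b) else 0)"
proof -
  show "integrable lborel (\<lambda>t. t ^ b' * cnj (t ^ b) * of_real (fibre_norm m k ((cmod t)\<^sup>2)))"
  proof (rule Bochner_Integration.integrable_bound)
    show "integrable lborel (\<lambda>t. cmod t ^ (2 * b) * fibre_norm m k ((cmod t)\<^sup>2)
        + cmod t ^ (2 * b') * fibre_norm m k ((cmod t)\<^sup>2))"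
      by (intro Bochner_Integration.integrable_add has_integral_base m b b')
    show "AE t in lborel. norm (t ^ b' * cnj (t ^ b) * of_real (fibre_norm m k ((cmod t)\<^sup>2)))
        \<le> norm (cmod t ^ (2 * b) * fibre_norm m k ((cmod t)\<^sup>2)
          + cmod t ^ (2 * b') * fibre_norm m k ((cmod t)\<^sup>2))"
    proof (rule AE_I2)
      fix t
      have "0 \<le> (cmod t ^ b - cmod t ^ b')\<^sup>2" by simp
      then have "2 * (cmod t ^ b' * cmod t ^ b) \<le> cmod t ^ (2 * b) + cmod t ^ (2 * b')"
        unfolding power2_diff by (simp add: power_mult[symmetric] mult_ac)
      moreover have "0 \<le> cmod t ^ b' * cmod t ^ b" by simp
      ultimately have "cmod t ^ b' * cmod t ^ b \<le> cmod t ^ (2 * b) + cmod t ^ (2 * b')"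
        by linarith
      then have "cmod t ^ b' * cmod t ^ b * fibre_norm m k ((cmod t)\<^sup>2)
          \<le> (cmod t ^ (2 * b) + cmod t ^ (2 * b')) * fibre_norm m k ((cmod t)\<^sup>2)"
        by (intro mult_right_mono) simp_all
      then show "norm (t ^ b' * cnj (t ^ b) * of_real (fibre_norm m k ((cmod t)\<^sup>2)))
        \<le> norm (cmod t ^ (2 * b) * fibre_norm m k ((cmod t)\<^sup>2)
          + cmod t ^ (2 * b') * fibre_norm m k ((cmod t)\<^sup>2))"
        by (simp add: norm_mult norm_power distrib_right)
    qed
  qed measurable
  show "(\<integral>t. t ^ b' * cnj (t ^ b) * of_real (fibre_norm m k ((cmod t)\<^sup>2)) \<partial>lborel)
       = (if b' = b then of_real (monomial_norm m k b) else 0)"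
  proof (cases "b' = b")
    case True
    have "t ^ b * cnj (t ^ b) * of_real (fibre_norm m k ((cmod t)\<^sup>2))
        = of_real (cmod t ^ (2 * b) * fibre_norm m k ((cmod t)\<^sup>2))" for t
      by (simp only: complex_norm_square[symmetric] norm_power of_real_mult of_real_power
            power_mult[symmetric] mult.commute)
    then show ?thesis using True
      by (simp only: simp_thms if_True integral_complex_of_real has_integral_base[OF m b])
  next
    case False
    have "(\<lambda>t. fibre_norm m k ((cmod t)\<^sup>2)) \<in> borel_measurable borel" by measurable
    from monomials_orthogonal[OF this _ False] show ?thesis
      using False by (simp add: norm_mult)
  qed
qed

text \<open>
  Fubini reduces the double integral to the one-variable statement in $z$ for almost every $t$,
  and then to the orthogonality of powers of $t$ for the rotation-invariant weight
  \<open>fibre_norm\<close>.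
\<close>
lemma coefficient_integral:
  fixes f :: "complex^2 \<Rightarrow> complex"
  assumes m: "m \<ge> 1" and b: "b \<le> k + m" and [measurable]: "f \<in> borel_measurable borel"
    and exp: "\<And>z t. (\<lambda>j. z ^ j * (\<Sum>b\<le>j + m. c j b * t ^ b)) sums f (vector [z, t])"
    and int: "integrable lborel (\<lambda>y. f y * cnj (y$1 ^ k * y$2 ^ b) * of_real (weight m (y$1) (y$2)))"
  shows "(\<integral>y. f y * cnj (y$1 ^ k * y$2 ^ b) * of_real (weight m (y$1) (y$2)) \<partial>lborel)
       = c k b * of_real (monomial_norm m k b)"
proof -
  let ?P = "lborel \<Otimes>\<^sub>M lborel :: (complex \<times> complex) measure"
  let ?v = "\<lambda>p. vector [fst p, snd p] :: complex^2"
  define H where "H y = f y * cnj (y$1 ^ k * y$2 ^ b) * of_real (weight m (y$1) (y$2))" for y :: "complex^2"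
  define G where "G z t = f (vector [z, t]) * cnj (z ^ k * t ^ b) * of_real (weight m z t)" for z t
  have H[measurable]: "H \<in> borel_measurable borel" unfolding H_def by measurable
  have v[measurable]: "?v \<in> ?P \<rightarrow>\<^sub>M borel" by measurable
  have GH: "G (fst p) (snd p) = H (?v p)" for p by (simp add: G_def H_def)
  have "integrable (distr ?P borel ?v) H"
    using int unfolding lborel_complex2_eq[symmetric] H_def .
  then have intG: "integrable ?P (\<lambda>p. G (fst p) (snd p))"
    unfolding GH by (subst (asm) integrable_distr_eq) (rule v H)+
  then have intG': "integrable ?P (case_prod G)" by (simp add: split_beta')
  have "(\<integral>y. H y \<partial>lborel) = (\<integral>p. G (fst p) (snd p) \<partial>?P)"
    unfolding GH by (subst lborel_complex2_eq) (rule integral_distr[OF v H])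
  also have "\<dots> = (\<integral>t. \<integral>z. G z t \<partial>lborel \<partial>lborel)"
    using lborel_pair.integral_snd[OF intG'] by (simp add: split_beta')
  also have "\<dots> = (\<integral>t. (\<Sum>b'\<le>k + m. c k b' * (t ^ b' * cnj (t ^ b) * of_real (fibre_norm m k ((cmod t)\<^sup>2)))) \<partial>lborel)"
  proof (rule integral_cong_AE)
    show "(\<lambda>t. \<integral>z. G z t \<partial>lborel) \<in> borel_measurable lborel"
      unfolding G_def by measurable
    have "AE t in lborel. integrable lborel (\<lambda>z. G z t)"
      using lborel_pair.AE_integrable_snd[OF intG'] .
    then show "AE t in lborel. (\<integral>z. G z t \<partial>lborel)
        = (\<Sum>b'\<le>k + m. c k b' * (t ^ b' * cnj (t ^ b) * of_real (fibre_norm m k ((cmod t)\<^sup>2))))"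
    proof eventually_elim
      fix t assume t: "integrable lborel (\<lambda>z. G z t)"
      let ?F = "\<lambda>z. f (vector [z, t]) * cnj (t ^ b)"
      let ?a = "\<lambda>j. (\<Sum>b\<le>j + m. c j b * t ^ b) * cnj (t ^ b)"
      have G: "G z t = ?F z * cnj (z ^ k) * of_real (weight m z t)" for z
        by (simp add: G_def mult_ac)
      have "(\<integral>z. ?F z * cnj (z ^ k) * of_real (weight m z t) \<partial>lborel)
          = ?a k * of_real (\<integral>z. (cmod z) ^ (2 * k) * weight m z t \<partial>lborel)"
      proof (rule power_series_coefficient_integral)
        show "(\<lambda>j. ?a j * z ^ j) sums ?F z" for z
          using sums_mult2[OF exp[of z t], of "cnj (t ^ b)"] by (simp add: mult_ac)
        show "continuous_on UNIV (\<lambda>z. weight m z t)"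
          unfolding weight_def by (intro continuous_intros) auto
        show "weight m (c * z) t = weight m z t" if "cmod c = 1" for c z
          using that by (simp add: weight_def norm_mult)
        show "integrable lborel (\<lambda>z. ?F z * cnj (z ^ k) * of_real (weight m z t))"
          using t unfolding G .
        show "integrable lborel (\<lambda>z. (cmod z) ^ (2 * k) * weight m z t)"
          by (rule has_integral_fibre[OF m])
      qed simp
      then show "(\<integral>z. G z t \<partial>lborel)
        = (\<Sum>b'\<le>k + m. c k b' * (t ^ b' * cnj (t ^ b) * of_real (fibre_norm m k ((cmod t)\<^sup>2))))"
        unfolding G has_integral_fibre[OF m] by (simp only: sum_distrib_right mult.assoc)
    qed
  qed measurable
  also have "\<dots> = (\<Sum>b'\<le>k + m. c k b' * (\<integral>t. t ^ b' * cnj (t ^ b) * of_real (fibre_norm m k ((cmod t)\<^sup>2)) \<partial>lborel))"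
    by (subst Bochner_Integration.integral_sum)
       (auto intro!: integrable_mult_right base_orthogonality m b simp del: complex_cnj_power)
  also have "\<dots> = (\<Sum>b'\<le>k + m. c k b' * (if b' = b then of_real (monomial_norm m k b) else 0))"
    by (intro sum.cong refl arg_cong2[where f="(*)"] base_orthogonality m b) simp
  also have "\<dots> = c k b * of_real (monomial_norm m k b)"
    using b by (simp add: if_distrib[of "(*) _"] cong: if_cong)
  finally show ?thesis unfolding H_def .
qed

section \<open>Expansion of a function given in two charts\<close>

lemma continuous_on_circle_integral:
  fixes G :: "'a::topological_space \<Rightarrow> complex \<Rightarrow> complex"
  assumes cont: "continuous_on (U \<times> sphere c r) (\<lambda>(x, w). G x w)" and r: "r \<ge> 0"
  shows "continuous_on U (\<lambda>x. contour_integral (circlepath c r) (G x))"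
proof -
  have "continuous_on (U \<times> {0..1}) (\<lambda>(x, s). G x (circlepath c r s) *
      vector_derivative (circlepath c r) (at s))"
    unfolding vector_derivative_circlepath split_beta
  proof (intro continuous_intros)
    have "continuous_on (U \<times> {0..1}) ((\<lambda>(x, w). G x w) \<circ> (\<lambda>x. (fst x, circlepath c r (snd x))))"
    proof (rule continuous_on_compose)
      show "continuous_on (U \<times> {0..1}) (\<lambda>x. (fst x, circlepath c r (snd x)))"
        unfolding circlepath by (intro continuous_intros)
      show "continuous_on ((\<lambda>x. (fst x, circlepath c r (snd x))) ` (U \<times> {0..1})) (\<lambda>(x, w). G x w)"
        by (rule continuous_on_subset[OF cont])
           (use r in \<open>auto simp: circlepath dist_norm norm_mult\<close>)
    qed
    then show "continuous_on (U \<times> {0..1}) (\<lambda>x. G (fst x) (circlepath c r (snd x)))"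
      by (simp add: o_def)
  qed
  then show ?thesis
    unfolding contour_integral_integral using integral_continuous_on_param[of U 0 "1::real"] by simp
qed

text \<open>
  Cauchy's integral formula expresses the derivative through the values of the function on a
  circle, which depend continuously on both variables.
\<close>
lemma continuous_on_deriv_parameter:
  assumes cont: "continuous_on UNIV (\<lambda>(z, t). F z t :: complex)"
    and hol: "\<And>z. (\<lambda>t. F z t) holomorphic_on UNIV"
  shows "continuous_on UNIV (\<lambda>(z::'a::topological_space, t). deriv (\<lambda>w. F z w) t)"
proof -
  have 1: "continuous_on (UNIV \<times> ball t0 1) (\<lambda>(z::'a, t). deriv (\<lambda>w. F z w) t)" for t0
  proof -
    have "continuous_on ((UNIV \<times> ball t0 1) \<times> sphere t0 1) (\<lambda>(x::'a \<times> complex, w). F (fst x) w / (w - snd x)\<^sup>2)"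
      unfolding split_beta
    proof (intro continuous_intros)
      show "continuous_on ((UNIV \<times> ball t0 1) \<times> sphere t0 1) (\<lambda>x. F (fst (fst x)) (snd x))"
        using continuous_on_compose2[OF cont, of "(UNIV \<times> ball t0 1) \<times> sphere t0 1" "\<lambda>x. (fst (fst x), snd x)"]
        by (simp add: continuous_intros)
    qed auto
    then have "continuous_on (UNIV \<times> ball t0 1)
        (\<lambda>x::'a \<times> complex. contour_integral (circlepath t0 1) (\<lambda>w. F (fst x) w / (w - snd x)\<^sup>2))"
      by (rule continuous_on_circle_integral) simp
    then have "continuous_on (UNIV \<times> ball t0 1)
        (\<lambda>x::'a \<times> complex. contour_integral (circlepath t0 1) (\<lambda>w. F (fst x) w / (w - snd x)\<^sup>2) / (2 * pi * \<i>))"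
      by (intro continuous_intros) auto
    then show ?thesis
    proof (rule continuous_on_eq)
      fix x :: "'a \<times> complex" assume "x \<in> UNIV \<times> ball t0 1"
      then have "snd x \<in> ball t0 1" by auto
      then show "contour_integral (circlepath t0 1) (\<lambda>w. F (fst x) w / (w - snd x)\<^sup>2) / (2 * pi * \<i>)
          = (case x of (z, t) \<Rightarrow> deriv (F z) t)"
        by (subst Cauchy_contour_integral_circlepath_2)
           (auto intro!: holomorphic_on_imp_continuous_on holomorphic_on_subset[OF hol] simp: split_beta)
    qed
  qed
  have "continuous_on (\<Union>t0. UNIV \<times> ball t0 1) (\<lambda>(z::'a, t). deriv (\<lambda>w. F z w) t)"
    using 1 by (intro continuous_on_open_UN open_Times) auto
  moreover have "(\<Union>t0. UNIV \<times> ball t0 (1::real)) = (UNIV :: ('a \<times> complex) set)"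
  proof (intro equalityI subset_UNIV subsetI)
    fix p :: "'a \<times> complex"
    show "p \<in> (\<Union>t0. UNIV \<times> ball t0 1)"
      by (rule UN_I[of "snd p"]) (simp_all add: mem_Times_iff)
  qed
  ultimately show ?thesis by metis
qed

text \<open>
  The coefficient is an integral over the unit circle of a function that is holomorphic in $t$;
  joint continuity of the $t$-derivative allows differentiation under the integral.
\<close>
lemma holomorphic_taylor_coefficient:
  assumes cont: "continuous_on UNIV (\<lambda>(z, t). F z t)"
    and hol1: "\<And>t. (\<lambda>z. F z t) holomorphic_on UNIV"
    and hol2: "\<And>z. (\<lambda>t. F z t) holomorphic_on UNIV"
  shows "(\<lambda>t. (deriv ^^ k) (\<lambda>z. F z t) 0) holomorphic_on UNIV"
proof -
  let ?K = "\<lambda>s. vector_derivative (circlepath 0 1) (at s) / circlepath 0 1 s ^ Suc k"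
  have nz: "circlepath 0 1 s \<noteq> 0" for s by (simp add: circlepath)
  have contK: "continuous_on A ?K" for A
    using nz unfolding vector_derivative_circlepath unfolding circlepath
    by (intro continuous_intros) auto
  have contK': "continuous_on A (\<lambda>x. ?K (snd x))" for A :: "(complex \<times> real) set"
    by (rule continuous_on_compose2[OF contK[of UNIV]]) (auto intro!: continuous_intros)
  have contc: "continuous_on A (\<lambda>x. circlepath 0 1 (snd x))" for A :: "(complex \<times> real) set"
    unfolding circlepath by (intro continuous_intros)
  have "(\<lambda>t. integral (cbox 0 1) (\<lambda>s. F (circlepath 0 1 s) t * ?K s)) holomorphic_on UNIV"
  proof (rule leibniz_rule_holomorphic[where fx="\<lambda>t s. deriv (\<lambda>w. F (circlepath 0 1 s) w) t * ?K s"])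
    fix t s
    show "((\<lambda>x. F (circlepath 0 1 s) x * ?K s) has_field_derivative
        deriv (\<lambda>w. F (circlepath 0 1 s) w) t * ?K s) (at t within UNIV)"
      by (rule DERIV_cmult_right) (rule holomorphic_derivI[OF hol2]; simp)
  next
    fix t
    have "continuous_on {0..1} (\<lambda>s. F (circlepath 0 1 s) t)"
      using continuous_on_compose2[OF cont, of "{0..1}" "\<lambda>s. (circlepath 0 1 s, t)"]
      by (simp add: circlepath continuous_intros)
    then show "(\<lambda>s. F (circlepath 0 1 s) t * ?K s) integrable_on cbox 0 1"
      by (intro integrable_continuous continuous_on_mult contK) simp
  next
    have "continuous_on (UNIV \<times> cbox 0 1) (\<lambda>x. deriv (F (circlepath 0 1 (snd x))) (fst x))"
      using continuous_on_compose2[OF continuous_on_deriv_parameter[OF cont hol2],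
          of "UNIV \<times> cbox 0 1" "\<lambda>x. (circlepath 0 1 (snd x), fst x)"]
      by (simp add: continuous_intros contc)
    then show "continuous_on (UNIV \<times> cbox 0 1)
        (\<lambda>(x, t). deriv (F (circlepath 0 1 t)) x * ?K t)"
      unfolding split_beta by (intro continuous_on_mult contK')
  qed simp
  then have "(\<lambda>t. fact k / (2 * pi * \<i>) * integral (cbox 0 1) (\<lambda>s. F (circlepath 0 1 s) t * ?K s)) holomorphic_on UNIV"
    by (intro holomorphic_intros)
  moreover have "(deriv ^^ k) (\<lambda>z. F z t) 0
      = fact k / (2 * pi * \<i>) * integral (cbox 0 1) (\<lambda>s. F (circlepath 0 1 s) t * ?K s)" for t
  proof -
    have "(deriv ^^ k) (\<lambda>z. F z t) 0
        = fact k / (2 * pi * \<i>) * contour_integral (circlepath 0 1) (\<lambda>u. F u t / (u - 0) ^ Suc k)"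
      by (rule Cauchy_higher_derivative_integral_circlepath(2))
         (auto intro!: holomorphic_on_imp_continuous_on holomorphic_on_subset[OF hol1])
    then show ?thesis by (simp add: contour_integral_integral)
  qed
  ultimately show ?thesis by simp
qed

lemma entire_taylor:
  assumes "f holomorphic_on UNIV"
  shows "(\<lambda>k. (deriv ^^ k) f 0 / fact k * z ^ k) sums f z"
  using holomorphic_power_series[of f 0 "cmod z + 1" z] holomorphic_on_subset[OF assms] by auto

text \<open>
  Comparing the power series of both functions in the first variable gives $A_k(t) = t^{k+m}
  B_k(1/t)$ for their coefficients. As $B_k$ is bounded near $0$, the entire function $A_k$ has
  polynomial growth of order $k+m$, so it is a polynomial of that degree, and $B_k$ is the
  reversed polynomial.
\<close>
lemma two_chart_expansion:
  assumes cf: "continuous_on UNIV (\<lambda>(z, t). f z t)" and cg: "continuous_on UNIV (\<lambda>(z, t). g z t)"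
    and f1: "\<And>t. (\<lambda>z. f z t) holomorphic_on UNIV" and f2: "\<And>z. (\<lambda>t. f z t) holomorphic_on UNIV"
    and g1: "\<And>t. (\<lambda>z. g z t) holomorphic_on UNIV" and g2: "\<And>z. (\<lambda>t. g z t) holomorphic_on UNIV"
    and glue: "\<And>z t. t \<noteq> 0 \<Longrightarrow> f z t = t ^ m * g (z * t) (1 / t)"
  obtains c :: "nat \<Rightarrow> nat \<Rightarrow> complex" where
    "\<And>z t. (\<lambda>k. z ^ k * (\<Sum>b\<le>k + m. c k b * t ^ b)) sums f z t"
    "\<And>z t. (\<lambda>k. z ^ k * (\<Sum>b\<le>k + m. c k b * t ^ (k + m - b))) sums g z t"
proof -
  define A where "A k t = (deriv ^^ k) (\<lambda>z. f z t) 0 / fact k" for k t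
  define B where "B k t = (deriv ^^ k) (\<lambda>z. g z t) 0 / fact k" for k t
  have A: "(\<lambda>k. A k t * z ^ k) sums f z t" for z t
    unfolding A_def by (rule entire_taylor[OF f1])
  have B: "(\<lambda>k. B k t * z ^ k) sums g z t" for z t
    unfolding B_def by (rule entire_taylor[OF g1])
  have holA: "A k holomorphic_on UNIV" and holB: "B k holomorphic_on UNIV" for k
    unfolding A_def B_def
    by (intro holomorphic_intros holomorphic_taylor_coefficient cf f1 f2; simp)
       (intro holomorphic_intros holomorphic_taylor_coefficient cg g1 g2; simp)
  have AB: "A k t = t ^ (k + m) * B k (1 / t)" if t: "t \<noteq> 0" for k t
  proof -
    have "(\<lambda>z. f z t) = (\<lambda>z. t ^ m * g (t * z) (1 / t))"
      using glue[OF t] by (simp add: mult.commute)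
    moreover have "(deriv ^^ k) (\<lambda>z. t ^ m * g (t * z) (1 / t)) 0
        = t ^ m * (deriv ^^ k) (\<lambda>z. g (t * z) (1 / t)) 0"
      by (rule higher_deriv_cmult[of _ UNIV])
         (auto intro!: holomorphic_on_compose[of _ _ "\<lambda>z. g z (1 / t)", unfolded o_def]
           holomorphic_intros holomorphic_on_subset[OF g1])
    moreover have "(deriv ^^ k) (\<lambda>z. g (t * z) (1 / t)) 0 = t ^ k * (deriv ^^ k) (\<lambda>z. g z (1 / t)) (t * 0)"
      by (rule higher_deriv_compose_linear[of "\<lambda>z. g z (1 / t)" UNIV UNIV]) (auto simp: g1)
    ultimately show ?thesis by (simp add: A_def B_def power_add mult_ac)
  qed
  define c where "c k b = (deriv ^^ b) (A k) 0 / fact b" for k b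
  have Apoly: "A k t = (\<Sum>b\<le>k + m. c k b * t ^ b)" for k t
  proof -
    have "bounded (B k ` cball 0 1)"
      by (intro compact_imp_bounded compact_continuous_image)
         (auto intro!: holomorphic_on_imp_continuous_on holomorphic_on_subset[OF holB])
    then obtain M where M: "\<And>s. s \<in> cball 0 1 \<Longrightarrow> cmod (B k s) \<le> M"
      unfolding bounded_iff by blast
    have "cmod (A k t) \<le> M * cmod t ^ (k + m)" if "1 \<le> cmod t" for t
    proof -
      have "t \<noteq> 0" "1 / t \<in> cball 0 1" using that by (auto simp: norm_divide divide_le_eq)
      then show ?thesis
        using M[of "1 / t"] by (auto simp: AB norm_mult norm_power mult.commute intro!: mult_right_mono)
    qed
    then show ?thesis
      unfolding c_def by (rule Liouville_polynomial[OF holA])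
  qed
  have Bpoly0: "B k s = (\<Sum>b\<le>k + m. c k b * s ^ (k + m - b))" if s: "s \<noteq> 0" for k s
  proof -
    have "s ^ (k + m) * A k (1 / s) = B k s"
      using AB[of "1 / s" k] s by (simp add: power_divide)
    then have "B k s = (\<Sum>b\<le>k + m. c k b * (s ^ (k + m) * (1 / s) ^ b))"
      by (simp add: Apoly sum_distrib_left mult_ac)
    also have "\<dots> = (\<Sum>b\<le>k + m. c k b * s ^ (k + m - b))"
      using s by (intro sum.cong) (auto simp: power_diff power_divide)
    finally show ?thesis .
  qed
  have Bpoly: "B k s = (\<Sum>b\<le>k + m. c k b * s ^ (k + m - b))" for k s
  proof (cases "s = 0")
    case True
    let ?P = "\<lambda>s. (\<Sum>b\<le>k + m. c k b * s ^ (k + m - b))"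
    have 1: "(B k \<longlongrightarrow> B k 0) (at 0)"
      using holomorphic_on_imp_continuous_on[OF holB] by (auto simp: continuous_on_def)
    have "(?P \<longlongrightarrow> ?P 0) (at 0)" by (intro tendsto_intros)
    then have 2: "(B k \<longlongrightarrow> ?P 0) (at 0)"
      by (rule Lim_transform_eventually) (auto simp: eventually_at_filter Bpoly0)
    show ?thesis using tendsto_unique[OF _ 1 2] True by simp
  qed (rule Bpoly0)
  show ?thesis
    using A B that[of c] by (simp add: Apoly Bpoly mult.commute)
qed

section \<open>Orthonormal bases and evaluation in spaces of functions\<close>

text \<open>
  A space of genuine functions, not of classes modulo null sets, so that evaluation at a point
  makes sense.
\<close>
locale L2_function_space =
  fixes M :: "'a measure" and V :: "('a \<Rightarrow> complex) set"
  assumes measurable_V: "f \<in> V \<Longrightarrow> f \<in> borel_measurable M"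
    and square_integrable_V: "f \<in> V \<Longrightarrow> integrable M (\<lambda>x. (cmod (f x))\<^sup>2)"
    and zero_V: "(\<lambda>x. 0) \<in> V"
    and add_scaled_V: "f \<in> V \<Longrightarrow> g \<in> V \<Longrightarrow> (\<lambda>x. f x + a * g x) \<in> V"
begin

definition ip :: "('a \<Rightarrow> complex) \<Rightarrow> ('a \<Rightarrow> complex) \<Rightarrow> complex" where
  "ip f g = (\<integral>x. f x * cnj (g x) \<partial>M)"

definition nsq :: "('a \<Rightarrow> complex) \<Rightarrow> real" where
  "nsq f = (\<integral>x. (cmod (f x))\<^sup>2 \<partial>M)"

definition orthonormal :: "'i set \<Rightarrow> ('i \<Rightarrow> 'a \<Rightarrow> complex) \<Rightarrow> bool" where
  "orthonormal B \<phi> \<longleftrightarrow> (\<forall>b\<in>B. \<phi> b \<in> V) \<and>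
     (\<forall>b\<in>B. \<forall>c\<in>B. ip (\<phi> b) (\<phi> c) = (if b = c then 1 else 0))"

lemma integrable_ip:
  assumes f: "f \<in> V" and g: "g \<in> V"
  shows "integrable M (\<lambda>x. f x * cnj (g x))"
proof (rule Bochner_Integration.integrable_bound)
  show "integrable M (\<lambda>x. (cmod (f x))\<^sup>2 + (cmod (g x))\<^sup>2)"
    by (intro Bochner_Integration.integrable_add square_integrable_V f g)
  have cnj: "cnj \<in> borel_measurable borel"
    by (intro borel_measurable_continuous_onI continuous_intros)
  show "(\<lambda>x. f x * cnj (g x)) \<in> borel_measurable M"
    by (intro borel_measurable_times measurable_V f measurable_compose[OF measurable_V[OF g] cnj])
  show "AE x in M. norm (f x * cnj (g x)) \<le> norm ((cmod (f x))\<^sup>2 + (cmod (g x))\<^sup>2)"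
  proof (rule AE_I2)
    fix x
    have "0 \<le> (cmod (f x) - cmod (g x))\<^sup>2" by simp
    then have "2 * (cmod (f x) * cmod (g x)) \<le> (cmod (f x))\<^sup>2 + (cmod (g x))\<^sup>2"
      by (simp add: power2_diff)
    moreover have "0 \<le> cmod (f x) * cmod (g x)" by simp
    ultimately have "cmod (f x) * cmod (g x) \<le> (cmod (f x))\<^sup>2 + (cmod (g x))\<^sup>2" by linarith
    then show "norm (f x * cnj (g x)) \<le> norm ((cmod (f x))\<^sup>2 + (cmod (g x))\<^sup>2)"
      by (simp add: norm_mult)
  qed
qed

lemma sum_V: "finite F \<Longrightarrow> (\<And>b. b \<in> F \<Longrightarrow> \<phi> b \<in> V) \<Longrightarrow> (\<lambda>x. \<Sum>b\<in>F. a b * \<phi> b x) \<in> V"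
proof (induction F rule: finite_induct)
  case (insert b F)
  have "(\<lambda>x. (\<Sum>b\<in>F. a b * \<phi> b x) + a b * \<phi> b x) \<in> V"
    using insert by (intro add_scaled_V) auto
  then show ?case using insert by (simp add: add.commute)
qed (simp add: zero_V)

lemma diff_V: "f \<in> V \<Longrightarrow> g \<in> V \<Longrightarrow> (\<lambda>x. f x - g x) \<in> V"
  using add_scaled_V[of f g "-1"] by simp

lemma nsq_nonneg: "0 \<le> nsq f"
  by (simp add: nsq_def)

lemma ip_self: "ip f f = of_real (nsq f)"
  by (simp add: ip_def nsq_def complex_norm_square[symmetric] flip: of_real_power)

lemma ip_commute: "ip g f = cnj (ip f g)"
  unfolding ip_def by (subst Bochner_Integration.integral_cnj[symmetric]) (simp add: mult.commute)

lemma ip_sum_left: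
  assumes "finite F" "\<And>b. b \<in> F \<Longrightarrow> \<phi> b \<in> V" "g \<in> V"
  shows "ip (\<lambda>x. \<Sum>b\<in>F. a b * \<phi> b x) g = (\<Sum>b\<in>F. a b * ip (\<phi> b) g)"
  unfolding ip_def
  using assms by (simp add: sum_distrib_right mult.assoc integrable_ip)

lemma nsq_diff:
  assumes f: "f \<in> V" and g: "g \<in> V"
  shows "nsq (\<lambda>x. f x - g x) = nsq f - 2 * Re (ip f g) + nsq g"
proof -
  have "(cmod (f x - g x))\<^sup>2 = (cmod (f x))\<^sup>2 - 2 * Re (f x * cnj (g x)) + (cmod (g x))\<^sup>2" for x
    by (simp only: cmod_power2) (simp add: power2_eq_square algebra_simps)
  then have "nsq (\<lambda>x. f x - g x)
      = (\<integral>x. (cmod (f x))\<^sup>2 - 2 * Re (f x * cnj (g x)) + (cmod (g x))\<^sup>2 \<partial>M)"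
    by (simp add: nsq_def)
  also have "\<dots> = nsq f - 2 * (\<integral>x. Re (f x * cnj (g x)) \<partial>M) + nsq g"
    unfolding nsq_def
    using square_integrable_V[OF f] square_integrable_V[OF g] integrable_Re[OF integrable_ip[OF f g]]
    by (subst Bochner_Integration.integral_add)
       (auto simp: Bochner_Integration.integral_diff simp del: times_complex.sel)
  finally show ?thesis
    unfolding ip_def by (simp only: integral_Re[OF integrable_ip[OF f g]])
qed

lemma nsq_orthonormal_sum:
  assumes o: "orthonormal B \<phi>" and F: "finite F" "F \<subseteq> B"
  shows "nsq (\<lambda>x. \<Sum>b\<in>F. a b * \<phi> b x) = (\<Sum>b\<in>F. (cmod (a b))\<^sup>2)"
proof -
  let ?s = "\<lambda>x. \<Sum>b\<in>F. a b * \<phi> b x"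
  have V: "\<And>b. b \<in> F \<Longrightarrow> \<phi> b \<in> V" and orth: "\<And>b c. b \<in> F \<Longrightarrow> c \<in> F \<Longrightarrow> ip (\<phi> b) (\<phi> c) = (if b = c then 1 else 0)"
    using o F unfolding orthonormal_def by blast+
  have sV: "?s \<in> V" by (rule sum_V[OF F(1) V])
  have "ip ?s (\<phi> b) = a b" if "b \<in> F" for b
    using that F by (simp add: ip_sum_left[OF F(1) V V[OF that]] orth if_distrib[of "(*) _"] cong: if_cong)
  then have "ip (\<phi> b) ?s = cnj (a b)" if "b \<in> F" for b
    using that by (subst ip_commute) simp
  then have "ip ?s ?s = (\<Sum>b\<in>F. a b * cnj (a b))"
    by (simp add: ip_sum_left[OF F(1) V sV])
  then have "of_real (nsq ?s) = (of_real (\<Sum>b\<in>F. (cmod (a b))\<^sup>2) :: complex)"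
    by (simp add: ip_self complex_norm_square[symmetric] del: of_real_power flip: of_real_power)
  then show ?thesis by (simp only: of_real_eq_iff)
qed

text \<open>
  Pythagoras: the Fourier coefficients give the best approximation from the span of a finite
  orthonormal family.
\<close>
lemma nsq_diff_orthonormal_sum:
  assumes o: "orthonormal B \<phi>" and F: "finite F" "F \<subseteq> B" and f: "f \<in> V"
  shows "nsq (\<lambda>x. f x - (\<Sum>b\<in>F. a b * \<phi> b x))
    = nsq f - (\<Sum>b\<in>F. (cmod (ip f (\<phi> b)))\<^sup>2) + (\<Sum>b\<in>F. (cmod (a b - ip f (\<phi> b)))\<^sup>2)"
proof -
  let ?s = "\<lambda>x. \<Sum>b\<in>F. a b * \<phi> b x"
  have V: "\<And>b. b \<in> F \<Longrightarrow> \<phi> b \<in> V" using o F by (auto simp: orthonormal_def)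
  have sV: "?s \<in> V" by (rule sum_V[OF F(1) V])
  have "ip f ?s = cnj (\<Sum>b\<in>F. a b * ip (\<phi> b) f)"
    by (subst ip_commute) (simp only: ip_sum_left[OF F(1) V f])
  also have "\<dots> = (\<Sum>b\<in>F. cnj (a b) * ip f (\<phi> b))"
    by (simp add: ip_commute[of _ f])
  finally have ip: "Re (ip f ?s) = (\<Sum>b\<in>F. Re (cnj (a b) * ip f (\<phi> b)))" by (simp only: Re_sum)
  have sq: "(cmod (a b - ip f (\<phi> b)))\<^sup>2
      = (cmod (a b))\<^sup>2 - 2 * Re (cnj (a b) * ip f (\<phi> b)) + (cmod (ip f (\<phi> b)))\<^sup>2" for b
    by (simp only: cmod_power2) (simp add: power2_eq_square algebra_simps)
  show ?thesis
    unfolding nsq_diff[OF f sV] ip nsq_orthonormal_sum[OF o F] sq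
    by (simp add: sum.distrib sum_subtractf sum_distrib_left del: times_complex.sel)
qed

lemma bessel:
  assumes "orthonormal B \<phi>" "finite F" "F \<subseteq> B" "f \<in> V"
  shows "(\<Sum>b\<in>F. (cmod (ip f (\<phi> b)))\<^sup>2) \<le> nsq f"
  using nsq_diff_orthonormal_sum[OF assms, of "\<lambda>b. ip f (\<phi> b)"]
    nsq_nonneg[of "\<lambda>x. f x - (\<Sum>b\<in>F. ip f (\<phi> b) * \<phi> b x)"] by simp

lemma cmod_sum_mult_square_le:
  "(cmod (\<Sum>i\<in>F. c i * d i))\<^sup>2 \<le> (\<Sum>i\<in>F. (cmod (c i))\<^sup>2) * (\<Sum>i\<in>F. (cmod (d i))\<^sup>2)"
proof -
  have "cmod (\<Sum>i\<in>F. c i * d i) \<le> (\<Sum>i\<in>F. cmod (c i) * cmod (d i))"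
    using norm_sum[of "\<lambda>i. c i * d i" F] by (simp add: norm_mult)
  then have "(cmod (\<Sum>i\<in>F. c i * d i))\<^sup>2 \<le> (\<Sum>i\<in>F. cmod (c i) * cmod (d i))\<^sup>2"
    by (intro power_mono) simp_all
  also have "\<dots> \<le> (\<Sum>i\<in>F. (cmod (c i))\<^sup>2) * (\<Sum>i\<in>F. (cmod (d i))\<^sup>2)"
    by (rule Cauchy_Schwarz_ineq_sum)
  finally show ?thesis .
qed

end

text \<open>
  An orthonormal family into which every function of the space expands pointwise. The function
  \<open>C\<close> is the reproducing kernel on the diagonal.
\<close>
locale pointwise_expansion = L2_function_space M V for M :: "'a measure" and V +
  fixes e :: "'j \<Rightarrow> 'a \<Rightarrow> complex" and I :: "nat \<Rightarrow> 'j set" and J :: "'j set" and C :: "'a \<Rightarrow> real"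
  assumes orth_e: "orthonormal J e"
    and fin_I: "finite (I n)" and I_J: "I n \<subseteq> J" and I_mono: "n \<le> n' \<Longrightarrow> I n \<subseteq> I n'"
    and expansion: "f \<in> V \<Longrightarrow> x \<in> space M \<Longrightarrow> (\<lambda>n. \<Sum>i\<in>I n. ip f (e i) * e i x) \<longlonglongrightarrow> f x"
    and kernel: "x \<in> space M \<Longrightarrow> (\<lambda>n. \<Sum>i\<in>I n. (cmod (e i x))\<^sup>2) \<longlonglongrightarrow> C x"
begin

text \<open>
  Pointwise expansion implies expansion in norm. By Fatou's lemma the squared distance from $f$
  to a partial sum is at most the limit of the squared distances between partial sums, which are
  tails of the convergent series of squared coefficients.
\<close>
lemma complete_e:
  assumes f: "f \<in> V" and \<epsilon>: "\<epsilon> > 0"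
  shows "\<exists>n. nsq (\<lambda>x. f x - (\<Sum>i\<in>I n. ip f (e i) * e i x)) < \<epsilon>"
proof -
  define S where "S n = (\<Sum>i\<in>I n. (cmod (ip f (e i)))\<^sup>2)" for n
  define s where "s n x = (\<Sum>i\<in>I n. ip f (e i) * e i x)" for n x
  have eV: "\<And>i. i \<in> J \<Longrightarrow> e i \<in> V" using orth_e by (auto simp: orthonormal_def)
  have sV: "s n \<in> V" for n
    unfolding s_def using eV I_J fin_I by (intro sum_V) auto
  have "incseq S"
    unfolding S_def incseq_def using I_mono fin_I by (auto intro!: sum_mono2)
  moreover have "S n \<le> nsq f" for n
    unfolding S_def by (rule bessel[OF orth_e fin_I I_J f])
  ultimately obtain L where L: "S \<longlonglongrightarrow> L" "\<And>n. S n \<le> L"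
    using incseq_convergent[of S "nsq f"] by auto
  \<comment> \<open>$L - S_n$ is the tail of the series of squared coefficients.\<close>
  obtain n where n: "L - S n < \<epsilon>"
    using order_tendstoD(1)[OF L(1), of "L - \<epsilon>"] \<epsilon> by (auto simp: eventually_sequentially algebra_simps)
  have tail: "nsq (\<lambda>x. s N x - s n x) \<le> L - S n" if "n \<le> N" for N
  proof -
    have "s N x - s n x = (\<Sum>i\<in>I N - I n. ip f (e i) * e i x)" for x
      unfolding s_def using I_mono[OF that] fin_I by (simp add: sum_diff)
    then have "nsq (\<lambda>x. s N x - s n x) = (\<Sum>i\<in>I N - I n. (cmod (ip f (e i)))\<^sup>2)"
      using nsq_orthonormal_sum[OF orth_e, of "I N - I n"] fin_I I_J[of N] by (simp add: subset_iff)
    also have "\<dots> = S N - S n"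
      unfolding S_def using I_mono[OF that] fin_I by (simp add: sum_diff)
    finally show ?thesis using L(2)[of N] by simp
  qed
  have nn: "(\<integral>\<^sup>+x. ennreal ((cmod (g x))\<^sup>2) \<partial>M) = ennreal (nsq g)" if "g \<in> V" for g
    unfolding nsq_def using square_integrable_V[OF that] by (intro nn_integral_eq_integral) auto
  have "ennreal (nsq (\<lambda>x. f x - s n x)) = (\<integral>\<^sup>+x. ennreal ((cmod (f x - s n x))\<^sup>2) \<partial>M)"
    by (rule nn[symmetric, OF diff_V[OF f sV]])
  also have "\<dots> = (\<integral>\<^sup>+x. liminf (\<lambda>N. ennreal ((cmod (s N x - s n x))\<^sup>2)) \<partial>M)"
  proof (rule nn_integral_cong)
    fix x assume "x \<in> space M"
    then have "(\<lambda>N. s N x) \<longlonglongrightarrow> f x" unfolding s_def by (rule expansion[OF f])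
    then have "(\<lambda>N. ennreal ((cmod (s N x - s n x))\<^sup>2)) \<longlonglongrightarrow> ennreal ((cmod (f x - s n x))\<^sup>2)"
      by (intro tendsto_intros)
    then show "ennreal ((cmod (f x - s n x))\<^sup>2) = liminf (\<lambda>N. ennreal ((cmod (s N x - s n x))\<^sup>2))"
      by (simp only: lim_imp_Liminf trivial_limit_sequentially simp_thms)
  qed
  also have "\<dots> \<le> liminf (\<lambda>N. \<integral>\<^sup>+x. ennreal ((cmod (s N x - s n x))\<^sup>2) \<partial>M)"
    using measurable_V[OF sV] by (intro nn_integral_liminf) measurable
  also have "\<dots> = liminf (\<lambda>N. ennreal (nsq (\<lambda>x. s N x - s n x)))"
    by (simp add: nn[OF diff_V[OF sV sV]])
  also have "\<dots> \<le> liminf (\<lambda>N. ennreal (L - S n))"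
    by (intro Liminf_mono eventually_mono[OF eventually_ge_at_top[of n]] ennreal_leI tail)
  also have "\<dots> = ennreal (L - S n)" by (simp add: Liminf_const)
  finally have "nsq (\<lambda>x. f x - s n x) \<le> L - S n"
    using L(2)[of n] by (simp add: ennreal_le_iff)
  with n show ?thesis unfolding s_def by (intro exI[of _ n]) simp
qed

lemma kernel_partial_le:
  assumes "x \<in> space M"
  shows "(\<Sum>i\<in>I n. (cmod (e i x))\<^sup>2) \<le> C x"
  using I_mono fin_I by (intro incseq_le[OF _ kernel[OF assms]]) (auto simp: incseq_def intro!: sum_mono2)

lemma kernel_nonneg: "x \<in> space M \<Longrightarrow> 0 \<le> C x"
  by (rule order_trans[OF sum_nonneg kernel_partial_le[of x 0]]) simp_all

text \<open>
  Cauchy--Schwarz for the partial sums of the expansion, followed by Bessel's inequality.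
\<close>
lemma evaluation_bound:
  assumes f: "f \<in> V" and x: "x \<in> space M"
  shows "(cmod (f x))\<^sup>2 \<le> nsq f * C x"
proof (rule LIMSEQ_le_const2)
  show "(\<lambda>n. (cmod (\<Sum>i\<in>I n. ip f (e i) * e i x))\<^sup>2) \<longlonglongrightarrow> (cmod (f x))\<^sup>2"
    by (intro tendsto_intros expansion f x)
  have "(cmod (\<Sum>i\<in>I n. ip f (e i) * e i x))\<^sup>2 \<le> nsq f * C x" for n
    by (rule order_trans[OF cmod_sum_mult_square_le])
       (intro mult_mono bessel[OF orth_e fin_I I_J f] kernel_partial_le x nsq_nonneg sum_nonneg zero_le_power2)
  then show "\<exists>N. \<forall>n\<ge>N. (cmod (\<Sum>i\<in>I n. ip f (e i) * e i x))\<^sup>2 \<le> nsq f * C x" by blast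
qed

text \<open>
  For any orthonormal basis the sum of $|\varphi_b(x)|^2$ is the squared norm of the evaluation
  at $x$: applying the bound on evaluations to $\sum_b \overline{\varphi_b(x)}\, \varphi_b$
  shows that partial sums do not exceed \<open>C x\<close>, and approximating $f$ by its Fourier
  sums shows $|f(x)|^2 \le \|f\|^2 \sum_b |\varphi_b(x)|^2$, which is applied to the same kind
  of test function built from \<open>e\<close>.
\<close>
theorem orthonormal_basis_kernel:
  assumes o: "orthonormal B \<phi>" and x: "x \<in> space M"
    and complete: "\<And>f \<epsilon>. f \<in> V \<Longrightarrow> \<epsilon> > 0 \<Longrightarrow>
      \<exists>F a. finite F \<and> F \<subseteq> B \<and> nsq (\<lambda>x. f x - (\<Sum>b\<in>F. a b * \<phi> b x)) < \<epsilon>"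
  shows "((\<lambda>b. (cmod (\<phi> b x))\<^sup>2) has_sum C x) B"
proof -
  let ?q = "\<lambda>b. (cmod (\<phi> b x))\<^sup>2"
  have V: "\<And>b. b \<in> B \<Longrightarrow> \<phi> b \<in> V" using o by (auto simp: orthonormal_def)
  have test: "q \<le> D" if "q * q \<le> q * D" "0 \<le> D" for q D :: real
    using that by (cases "q > 0") auto
  have upper: "sum ?q F \<le> C x" if F: "finite F" "F \<subseteq> B" for F
  proof -
    let ?f = "\<lambda>y. \<Sum>b\<in>F. cnj (\<phi> b x) * \<phi> b y"
    have fV: "?f \<in> V" using F V by (intro sum_V) auto
    have nf: "nsq ?f = sum ?q F" by (simp add: nsq_orthonormal_sum[OF o F])
    have "?f x = of_real (sum ?q F)"
      by (simp only: of_real_sum complex_norm_square) (simp only: mult.commute)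
    then have fx: "cmod (?f x) = sum ?q F" by (simp only: norm_of_real) (simp add: sum_nonneg)
    have "sum ?q F * sum ?q F \<le> sum ?q F * C x"
      using evaluation_bound[OF fV x] unfolding fx nf by (simp only: power2_eq_square)
    then show ?thesis by (rule test[OF _ kernel_nonneg[OF x]])
  qed
  have summ: "?q summable_on B"
    by (rule nonneg_bdd_above_summable_on) (auto intro!: bdd_aboveI2[of _ _ "C x"] upper)
  define S where "S = infsum ?q B"
  have S: "sum ?q F \<le> S" if "finite F" "F \<subseteq> B" for F
    unfolding S_def using that by (intro finite_sum_le_infsum summ) auto
  have S0: "0 \<le> S" using S[of "{}"] by simp
  have lower: "(cmod (f x))\<^sup>2 \<le> nsq f * S" if f: "f \<in> V" for f
  proof -
    have "cmod (f x) \<le> sqrt (nsq f * S) + \<delta>" if \<delta>: "\<delta> > 0" for \<delta>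
    proof -
      \<comment> \<open>An error of squared norm $\epsilon$ changes the value at \<open>x\<close> by at most $\delta$; adding $1$ avoids division by $0$.\<close>
      define \<epsilon> where "\<epsilon> = \<delta>\<^sup>2 / (C x + 1)"
      have \<epsilon>: "\<epsilon> > 0" using \<delta> kernel_nonneg[OF x] by (simp add: \<epsilon>_def add_nonneg_pos)
      obtain F a where F: "finite F" "F \<subseteq> B" and small: "nsq (\<lambda>x. f x - (\<Sum>b\<in>F. a b * \<phi> b x)) < \<epsilon>"
        using complete[OF f \<epsilon>] by blast
      let ?s = "\<lambda>y. \<Sum>b\<in>F. ip f (\<phi> b) * \<phi> b y"
      let ?r = "\<lambda>y. f y - ?s y"
      have rV: "?r \<in> V" using F V by (intro diff_V f sum_V) auto
      have "nsq ?r \<le> nsq (\<lambda>x. f x - (\<Sum>b\<in>F. a b * \<phi> b x))"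
        unfolding nsq_diff_orthonormal_sum[OF o F f] by (simp add: sum_nonneg)
      with small have nr: "nsq ?r < \<epsilon>" by simp
      have "(cmod (?r x))\<^sup>2 \<le> nsq ?r * C x" by (rule evaluation_bound[OF rV x])
      also have "\<dots> \<le> \<epsilon> * (C x + 1)"
        using nr kernel_nonneg[OF x] \<epsilon> by (intro mult_mono) auto
      also have "\<dots> = \<delta>\<^sup>2" using kernel_nonneg[OF x] by (simp add: \<epsilon>_def)
      finally have r: "cmod (?r x) \<le> \<delta>" using \<delta> by (simp add: power2_le_iff_abs_le)
      have "(cmod (?s x))\<^sup>2 \<le> nsq f * S"
        by (rule order_trans[OF cmod_sum_mult_square_le])
           (intro mult_mono bessel[OF o F f] S F nsq_nonneg sum_nonneg zero_le_power2)
      then have s: "cmod (?s x) \<le> sqrt (nsq f * S)" by (rule real_le_rsqrt)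
      have "cmod (f x) \<le> cmod (?s x) + cmod (?r x)"
        using norm_triangle_ineq[of "?s x" "?r x"] by simp
      with r s show ?thesis by linarith
    qed
    then have "cmod (f x) \<le> sqrt (nsq f * S)" by (rule field_le_epsilon)
    then have "(cmod (f x))\<^sup>2 \<le> (sqrt (nsq f * S))\<^sup>2" by (intro power_mono) simp_all
    then show ?thesis using nsq_nonneg[of f] S0 by simp
  qed
  have "(\<Sum>i\<in>I n. (cmod (e i x))\<^sup>2) \<le> S" for n
  proof -
    let ?q = "\<Sum>i\<in>I n. (cmod (e i x))\<^sup>2"
    let ?f = "\<lambda>y. \<Sum>i\<in>I n. cnj (e i x) * e i y"
    have fV: "?f \<in> V" using fin_I I_J orth_e by (intro sum_V) (auto simp: orthonormal_def)
    have nf: "nsq ?f = ?q" by (simp add: nsq_orthonormal_sum[OF orth_e fin_I I_J])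
    have "?f x = of_real ?q"
      by (simp only: of_real_sum complex_norm_square) (simp only: mult.commute)
    then have fx: "cmod (?f x) = ?q" by (simp only: norm_of_real) (simp add: sum_nonneg)
    have "?q * ?q \<le> ?q * S"
      using lower[OF fV] unfolding fx nf by (simp only: power2_eq_square)
    then show ?thesis by (rule test[OF _ S0])
  qed
  then have "C x \<le> S" by (intro LIMSEQ_le_const2[OF kernel[OF x]]) auto
  moreover have "S \<le> C x"
    unfolding S_def by (rule infsum_le_finite_sums[OF summ]) (rule upper)
  ultimately show ?thesis using has_sum_infsum[OF summ] S_def by simp
qed

end

section \<open>Calculus of smooth functions\<close>

lemma Ck_on_cong:
  assumes "open S" "\<And>x. x \<in> S \<Longrightarrow> f x = g x" "Ck_on k f S"
  shows "Ck_on k g S"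
  using assms(2,3)
proof (induction k arbitrary: f g)
  case 0
  then show ?case using continuous_on_cong[of S S f g] by simp
next
  case (Suc k)
  have der: "(f has_derivative D) (at x) \<longleftrightarrow> (g has_derivative D) (at x)" if "x \<in> S" for x D
    using Suc.prems(1) that \<open>open S\<close> has_derivative_transform_within_open[of _ _ x UNIV S]
    by metis
  then have "frechet_derivative f (at x) = frechet_derivative g (at x)" if "x \<in> S" for x
    using that by (simp add: frechet_derivative_def)
  then show ?case
    using Suc der by (auto simp: differentiable_def intro: Suc.IH[of "\<lambda>x. frechet_derivative f (at x) _"])
qed

text \<open>
  Reduces the iterated derivatives to any explicit formula for the first one.
\<close>
lemma Ck_on_SucI:
  assumes "open S" "\<And>x. x \<in> S \<Longrightarrow> (f has_derivative D x) (at x)"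
    and "\<And>v. Ck_on k (\<lambda>x. D x v) S"
  shows "Ck_on (Suc k) f S"
proof -
  have "Ck_on k (\<lambda>x. frechet_derivative f (at x) v) S" for v
    by (rule Ck_on_cong[OF assms(1) _ assms(3)[of v]]) (simp add: frechet_derivative_at[OF assms(2), symmetric])
  then show ?thesis using assms(2) by (auto simp: differentiable_def)
qed

lemma Ck_on_SucD:
  assumes "Ck_on (Suc k) f S"
  shows "Ck_on k (\<lambda>x. frechet_derivative f (at x) v) S"
    and "x \<in> S \<Longrightarrow> (f has_derivative frechet_derivative f (at x)) (at x)"
  using assms by (auto simp: frechet_derivative_works)

lemma Ck_on_imp_continuous_on: "Ck_on k f S \<Longrightarrow> continuous_on S f"
  by (cases k) (auto intro!: continuous_at_imp_continuous_on differentiable_imp_continuous_within)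

lemma Ck_on_pred: "Ck_on (Suc k) f S \<Longrightarrow> Ck_on k f S"
proof (induction k arbitrary: f)
  case 0
  then show ?case using Ck_on_imp_continuous_on[OF 0] by simp
next
  case (Suc k)
  then show ?case by auto
qed

lemma Ck_on_const: "open S \<Longrightarrow> Ck_on k (\<lambda>x. c) S"
proof (induction k arbitrary: c)
  case (Suc k)
  show ?case
    by (rule Ck_on_SucI[where D="\<lambda>x v. 0"]) (use Suc in auto)
qed simp

lemma Ck_on_bounded_linear:
  assumes "open S" "bounded_linear L"
  shows "Ck_on k L S"
proof (cases k)
  case 0
  then show ?thesis using assms by (simp add: linear_continuous_on)
next
  case (Suc j)
  then show ?thesis
    by (auto intro!: Ck_on_SucI[where D="\<lambda>x. L"] Ck_on_const assms bounded_linear_imp_has_derivative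
        simp del: Ck_on.simps)
qed

lemma Ck_on_compose_bounded_linear:
  assumes "open S" "bounded_linear L" "Ck_on k f S"
  shows "Ck_on k (\<lambda>x. L (f x)) S"
  using assms(3)
proof (induction k arbitrary: f)
  case 0
  then show ?case
    using continuous_on_compose2[OF linear_continuous_on[OF assms(2), of UNIV]] by auto
next
  case (Suc k)
  show ?case
    by (rule Ck_on_SucI[where D="\<lambda>x v. L (frechet_derivative f (at x) v)"])
       (auto intro!: assms(1) bounded_linear.has_derivative[OF assms(2)] Ck_on_SucD[OF Suc.prems] Suc.IH
         simp del: Ck_on.simps)
qed

lemma Ck_on_add:
  assumes "open S" "Ck_on k f S" "Ck_on k g S"
  shows "Ck_on k (\<lambda>x. f x + g x) S"
  using assms(2,3)
proof (induction k arbitrary: f g)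
  case 0
  then show ?case by (simp add: continuous_on_add)
next
  case (Suc k)
  show ?case
    by (rule Ck_on_SucI[where D="\<lambda>x v. frechet_derivative f (at x) v + frechet_derivative g (at x) v"])
       (auto intro!: assms(1) has_derivative_add Ck_on_SucD[OF Suc.prems(1)] Ck_on_SucD[OF Suc.prems(2)] Suc.IH
         simp del: Ck_on.simps)
qed

lemma Ck_on_mult:
  fixes f g :: "'a::real_normed_vector \<Rightarrow> 'b::real_normed_algebra"
  assumes "open S" "Ck_on k f S" "Ck_on k g S"
  shows "Ck_on k (\<lambda>x. f x * g x) S"
  using assms(2,3)
proof (induction k arbitrary: f g)
  case 0
  then show ?case by (simp add: continuous_on_mult)
next
  case (Suc k)
  show ?case
    by (rule Ck_on_SucI[where D="\<lambda>x v. f x * frechet_derivative g (at x) v + frechet_derivative f (at x) v * g x"])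
       (auto intro!: assms(1) has_derivative_mult Ck_on_SucD[OF Suc.prems(1)] Ck_on_SucD[OF Suc.prems(2)]
         Suc.IH Ck_on_add Ck_on_pred[OF Suc.prems(1)] Ck_on_pred[OF Suc.prems(2)]
         simp del: Ck_on.simps)
qed

lemma Ck_on_inverse:
  fixes f :: "'a::real_normed_vector \<Rightarrow> 'b::real_normed_field"
  assumes "open S" "Ck_on k f S" "\<And>x. x \<in> S \<Longrightarrow> f x \<noteq> 0"
  shows "Ck_on k (\<lambda>x. inverse (f x)) S"
  using assms(2)
proof (induction k)
  case 0
  then show ?case using assms(3) by (simp add: continuous_on_inverse)
next
  case (Suc k)
  show ?case
  proof (rule Ck_on_SucI[OF assms(1)])
    fix x assume "x \<in> S"
    then show "((\<lambda>x. inverse (f x)) has_derivative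
        (\<lambda>v. (-1) * (inverse (f x) * frechet_derivative f (at x) v * inverse (f x)))) (at x)"
      using Deriv.has_derivative_inverse[OF assms(3) Ck_on_SucD(2)[OF Suc.prems], of x] by simp
  next
    show "Ck_on k (\<lambda>x. (-1) * (inverse (f x) * frechet_derivative f (at x) v * inverse (f x))) S" for v
      by (intro Ck_on_mult Ck_on_const assms(1) Suc.IH Ck_on_pred[OF Suc.prems] Ck_on_SucD(1)[OF Suc.prems])
  qed
qed

lemma Ck_on_exp:
  fixes f :: "'a::real_normed_vector \<Rightarrow> real"
  assumes "open S" "Ck_on k f S"
  shows "Ck_on k (\<lambda>x. exp (f x)) S"
  using assms(2)
proof (induction k)
  case 0
  then show ?case by (simp add: continuous_on_exp)
next
  case (Suc k)
  show ?case
  proof (rule Ck_on_SucI[OF assms(1)])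
    fix x assume "x \<in> S"
    then show "((\<lambda>x. exp (f x)) has_derivative (\<lambda>v. frechet_derivative f (at x) v * exp (f x))) (at x)"
      using Ck_on_SucD(2)[OF Suc.prems, of x] by (auto intro!: derivative_eq_intros)
  next
    show "Ck_on k (\<lambda>x. frechet_derivative f (at x) v * exp (f x)) S" for v
      by (intro Ck_on_mult assms(1) Suc.IH Ck_on_pred[OF Suc.prems] Ck_on_SucD(1)[OF Suc.prems])
  qed
qed

lemma smooth_on_const: "open S \<Longrightarrow> smooth_on (\<lambda>x. c) S"
  by (simp add: smooth_on_def Ck_on_const)

lemma smooth_on_bounded_linear: "open S \<Longrightarrow> bounded_linear L \<Longrightarrow> smooth_on L S"
  by (simp add: smooth_on_def Ck_on_bounded_linear)

lemma smooth_on_compose_bounded_linear: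
  "open S \<Longrightarrow> bounded_linear L \<Longrightarrow> smooth_on f S \<Longrightarrow> smooth_on (\<lambda>x. L (f x)) S"
  by (simp add: smooth_on_def Ck_on_compose_bounded_linear)

lemma smooth_on_add: "open S \<Longrightarrow> smooth_on f S \<Longrightarrow> smooth_on g S \<Longrightarrow> smooth_on (\<lambda>x. f x + g x) S"
  by (simp add: smooth_on_def Ck_on_add)

lemma smooth_on_mult:
  fixes f g :: "'a::real_normed_vector \<Rightarrow> 'b::real_normed_algebra"
  shows "open S \<Longrightarrow> smooth_on f S \<Longrightarrow> smooth_on g S \<Longrightarrow> smooth_on (\<lambda>x. f x * g x) S"
  by (simp add: smooth_on_def Ck_on_mult)

lemma smooth_on_inverse:
  fixes f :: "'a::real_normed_vector \<Rightarrow> 'b::real_normed_field"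
  shows "open S \<Longrightarrow> smooth_on f S \<Longrightarrow> (\<And>x. x \<in> S \<Longrightarrow> f x \<noteq> 0) \<Longrightarrow> smooth_on (\<lambda>x. inverse (f x)) S"
  by (simp add: smooth_on_def Ck_on_inverse)

lemma smooth_on_exp:
  fixes f :: "'a::real_normed_vector \<Rightarrow> real"
  shows "open S \<Longrightarrow> smooth_on f S \<Longrightarrow> smooth_on (\<lambda>x. exp (f x)) S"
  by (simp add: smooth_on_def Ck_on_exp)

lemma smooth_on_power:
  fixes f :: "'a::real_normed_vector \<Rightarrow> 'b::real_normed_algebra_1"
  shows "open S \<Longrightarrow> smooth_on f S \<Longrightarrow> smooth_on (\<lambda>x. f x ^ n) S"
  by (induction n) (simp_all add: smooth_on_const smooth_on_mult)

lemma smooth_on_Re: "open S \<Longrightarrow> smooth_on f S \<Longrightarrow> smooth_on (\<lambda>x. Re (f x)) S"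
  by (rule smooth_on_compose_bounded_linear[OF _ bounded_linear_Re])

lemma smooth_on_Im: "open S \<Longrightarrow> smooth_on f S \<Longrightarrow> smooth_on (\<lambda>x. Im (f x)) S"
  by (rule smooth_on_compose_bounded_linear[OF _ bounded_linear_Im])

lemma smooth_on_cnj: "open S \<Longrightarrow> smooth_on f S \<Longrightarrow> smooth_on (\<lambda>x. cnj (f x)) S"
  by (rule smooth_on_compose_bounded_linear[OF _ bounded_linear_cnj])

lemma smooth_on_nth: "open S \<Longrightarrow> smooth_on (\<lambda>x. x $ j) S"
  by (rule smooth_on_bounded_linear[OF _ bounded_linear_vec_nth])

lemma smooth_on_cmod_square:
  assumes "open S" "smooth_on f S"
  shows "smooth_on (\<lambda>x. (cmod (f x))\<^sup>2) S"
  unfolding cmod_power2 using assms by (intro smooth_on_add smooth_on_power smooth_on_Re smooth_on_Im)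

section \<open>The atlas of the blow-up\<close>

text \<open>
  The representative of a projective point whose \<open>i\<close>-th homogeneous coordinate is
  $1$.
\<close>
definition affine_rep :: "2 \<Rightarrow> complex \<Rightarrow> complex^2" where
  "affine_rep i u = (\<chi> j. if j = i then 1 else u)"

text \<open>
  The inverses of the two charts. They are defined on all of complex 2-space by one formula,
  which makes every later statement symmetric in the charts.
\<close>
definition cpoint :: "2 \<Rightarrow> complex^2 \<Rightarrow> blowup_point" where
  "cpoint i y = (y$1 *s affine_rep i (y$2), proj_point (affine_rep i (y$2)))"

definition bchart :: "2 \<Rightarrow> (blowup_point, 2) chart" where
  "bchart i = (if i = 1 then blowup_chart1 else blowup_chart2)"

text \<open>
  The transition map, the same in both directions.
\<close>
definition chart_change :: "complex^2 \<Rightarrow> complex^2" where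
  "chart_change y = vector [y$1 * y$2, 1 / y$2]"

definition chart_change_deriv :: "complex^2 \<Rightarrow> complex^2 \<Rightarrow> complex^2" where
  "chart_change_deriv y v = vector [v$1 * y$2 + y$1 * v$2, - v$2 / (y$2)\<^sup>2]"

lemma affine_rep_nth [simp]: "affine_rep i u $ j = (if j = i then 1 else u)"
  by (simp add: affine_rep_def)

lemma affine_rep_nonzero [simp]: "affine_rep i u \<noteq> 0"
  by (metis affine_rep_nth zero_index zero_neq_one)

lemma self_in_proj_point [simp]: "t \<in> proj_point t"
  unfolding proj_point_def by (rule CollectI, rule exI[of _ 1]) simp

lemma proj_point_scale: "c \<noteq> 0 \<Longrightarrow> proj_point (c *s t) = proj_point t"
  unfolding proj_point_def
proof (intro set_eqI iffI; clarify)
  fix d :: complex assume "c \<noteq> 0" "d \<noteq> 0"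
  then show "\<exists>c'. d *s (c *s t) = c' *s t \<and> c' \<noteq> 0"
    by (intro exI[of _ "d * c"]) (simp add: vector_smult_assoc)
  show "\<exists>c'. d *s t = c' *s (c *s t) \<and> c' \<noteq> 0"
    using \<open>c \<noteq> 0\<close> \<open>d \<noteq> 0\<close> by (intro exI[of _ "d / c"]) (simp add: vector_smult_assoc)
qed

lemma proj_point_eqD: "proj_point s = proj_point t \<Longrightarrow> \<exists>c. c \<noteq> 0 \<and> s = c *s t"
  using self_in_proj_point[of s] by (auto simp: proj_point_def)

lemma bchart_atlas: "blowup_atlas = range bchart"
  unfolding blowup_atlas_def image_def UNIV_2 by (auto simp: bchart_def)

lemma other_index: "(i::2) \<noteq> j \<Longrightarrow> k \<noteq> i \<Longrightarrow> k = j"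
  using exhaust_2[of i] exhaust_2[of j] exhaust_2[of k] by auto

lemma cpoint_blowup: "cpoint i y \<in> blowup"
  unfolding blowup_def cpoint_def
  by (intro CollectI exI conjI refl affine_rep_nonzero) (use exhaust_2[of i] in auto)

lemma fst_bchart_cond: "fst (bchart i) = {p \<in> blowup. \<forall>t\<in>snd p. t $ i \<noteq> 0}"
  using exhaust_2[of i] by (auto simp: bchart_def blowup_chart1_def blowup_chart2_def)

lemma blowup_point_in_chart:
  assumes p: "p \<in> blowup" and t: "snd p = proj_point t" "t $ i \<noteq> 0"
  shows "p \<in> range (cpoint i)"
proof -
  obtain z s where zs: "p = (z, proj_point s)" "s \<noteq> 0" "s $ 1 * z $ 2 - s $ 2 * z $ 1 = 0"
    using p by (auto simp: blowup_def)
  have si: "s $ i \<noteq> 0"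
    using proj_point_eqD[of t s] zs t by auto
  define j where "j = (if i = 1 then 2 else 1 :: 2)"
  have ij: "i \<noteq> j" "\<And>k. k = i \<or> k = j" using exhaust_2[of i] exhaust_2 by (auto simp: j_def)
  have rel: "s $ i * z $ j = s $ j * z $ i"
    using zs(3) exhaust_2[of i] by (auto simp: j_def mult.commute)
  let ?u = "s $ j / s $ i"
  have s: "s = s $ i *s affine_rep i ?u"
    using si by (auto simp: vec_eq_iff) (metis ij(2))
  have "z = z $ i *s affine_rep i ?u"
    using si rel by (auto simp: vec_eq_iff field_simps) (metis ij(2))
  moreover have "proj_point s = proj_point (affine_rep i ?u)"
    by (subst s) (rule proj_point_scale[OF si])
  ultimately have "p = cpoint i (vector [z $ i, ?u])"
    by (simp add: zs cpoint_def)
  then show ?thesis by blast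
qed

lemma cpoint_avoids: "t \<in> snd (cpoint i y) \<Longrightarrow> t $ i \<noteq> 0"
  by (auto simp: cpoint_def proj_point_def)

lemma fst_bchart: "fst (bchart i) = range (cpoint i)"
proof -
  have "p \<in> range (cpoint i)" if "p \<in> blowup" "\<forall>t\<in>snd p. t $ i \<noteq> 0" for p
  proof -
    obtain t where "snd p = proj_point t" using \<open>p \<in> blowup\<close> by (auto simp: blowup_def)
    with that show ?thesis using blowup_point_in_chart by auto
  qed
  then show ?thesis
    unfolding fst_bchart_cond using cpoint_blowup cpoint_avoids by blast
qed

lemma snd_bchart: "snd (bchart i) (cpoint i y) = y"
proof -
  have the: "(THE r. \<exists>t\<in>proj_point (affine_rep i u). r = t $ k / t $ i) = u" if "k \<noteq> i" for k u
  proof (rule the_equality)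
    show "\<exists>t\<in>proj_point (affine_rep i u). u = t $ k / t $ i"
      using that by (intro bexI[of _ "affine_rep i u"]) auto
    show "r = u" if "\<exists>t\<in>proj_point (affine_rep i u). r = t $ k / t $ i" for r
      using that \<open>k \<noteq> i\<close> by (auto simp: proj_point_def)
  qed
  have "snd (bchart i) (cpoint i y) = vector [y$1, y$2]"
  proof (cases "i = 1")
    case True
    then show ?thesis using the[of 2 "y$2"] by (simp add: bchart_def blowup_chart1_def cpoint_def)
  next
    case False
    then have "i = 2" using exhaust_2 by blast
    then show ?thesis using the[of 1 "y$2"] by (simp add: bchart_def blowup_chart2_def cpoint_def)
  qed
  also have "\<dots> = y" by (simp add: vec_eq_iff forall_2)
  finally show ?thesis .
qed

lemma cpoint_inj: "cpoint i x = cpoint i y \<longleftrightarrow> x = y"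
  by (metis snd_bchart)

lemma inj_on_bchart: "inj_on (snd (bchart i)) (fst (bchart i))"
  unfolding fst_bchart by (rule inj_on_inverseI[of _ "cpoint i"]) (elim rangeE, simp only: snd_bchart)

lemma chart_inv_bchart: "chart_inv (bchart i) = cpoint i"
proof
  show "chart_inv (bchart i) y = cpoint i y" for y
    unfolding chart_inv_def
    by (rule inv_into_f_eq[OF inj_on_bchart _ snd_bchart]) (simp add: fst_bchart)
qed

lemma coords_bchart: "coords (bchart i) W = cpoint i -` W"
  unfolding coords_def fst_bchart by (force simp: snd_bchart image_iff)

lemma affine_rep_chart_change: "i \<noteq> j \<Longrightarrow> u \<noteq> 0 \<Longrightarrow> affine_rep i u = u *s affine_rep j (1 / u)"
  by (auto simp: vec_eq_iff dest: other_index)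

lemma cpoint_chart_change: "i \<noteq> j \<Longrightarrow> y$2 \<noteq> 0 \<Longrightarrow> cpoint i y = cpoint j (chart_change y)"
  by (simp add: cpoint_def chart_change_def affine_rep_chart_change[of i j] proj_point_scale vector_smult_assoc)

lemma cpoint_other: "i \<noteq> j \<Longrightarrow> cpoint i y \<in> range (cpoint j) \<longleftrightarrow> y$2 \<noteq> 0"
proof
  assume ij: "i \<noteq> j" and "cpoint i y \<in> range (cpoint j)"
  then obtain x where x: "cpoint i y = cpoint j x" by blast
  have "affine_rep i (y$2) \<in> snd (cpoint i y)" by (simp add: cpoint_def)
  then have "affine_rep i (y$2) $ j \<noteq> 0" unfolding x by (rule cpoint_avoids)
  then show "y$2 \<noteq> 0" using ij by auto
qed (use cpoint_chart_change in blast)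

lemma chart_change_nth2 [simp]: "chart_change y $ 2 = 1 / y$2" "chart_change y $ 1 = y$1 * y$2"
  by (simp_all add: chart_change_def)

lemma points_blowup: "points blowup_atlas = blowup"
proof -
  have "p \<in> range (cpoint 1) \<or> p \<in> range (cpoint 2)" if p_in: "p \<in> blowup" for p
  proof -
    obtain z t where p: "p = (z, proj_point t)" "t \<noteq> 0" using p_in unfolding blowup_def by blast
    then have "t $ 1 \<noteq> 0 \<or> t $ 2 \<noteq> 0" by (auto simp: vec_eq_iff forall_2)
    then show ?thesis using blowup_point_in_chart[OF p_in] p by fastforce
  qed
  then show ?thesis
    unfolding points_def bchart_atlas using cpoint_blowup by (simp add: fst_bchart set_eq_iff del: split_paired_All) blast
qed

lemma blowup_cases:
  assumes "p \<in> blowup" obtains i y where "p = cpoint i y"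
  using assms unfolding points_blowup[symmetric] points_def bchart_atlas by (auto simp: fst_bchart)

lemma openin_blowup:
  "openin (manifold_topology blowup_atlas) W \<longleftrightarrow> W \<subseteq> blowup \<and> (\<forall>i. open (cpoint i -` W))"
proof -
  have "istopology (\<lambda>W. W \<subseteq> blowup \<and> (\<forall>i. open (cpoint i -` W)))"
    unfolding istopology_def by (auto simp: vimage_Union)
  then show ?thesis
    unfolding manifold_topology_def points_blowup
    by (simp add: bchart_atlas coords_bchart topology_inverse')
qed

lemma topspace_blowup: "topspace (manifold_topology blowup_atlas) = blowup"
proof -
  have "cpoint i -` blowup = UNIV" for i using cpoint_blowup by auto
  then have "openin (manifold_topology blowup_atlas) blowup" by (simp add: openin_blowup)
  then show ?thesis
    using openin_subset[of "manifold_topology blowup_atlas" blowup] openin_blowup[of "topspace (manifold_topology blowup_atlas)"]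
    by auto
qed

lemma open_nth2_nonzero: "open {y::complex^2. y$2 \<noteq> 0}"
  by (intro open_Collect_neq continuous_intros)

lemma has_derivative_nth: "((\<lambda>x. x $ k) has_derivative (\<lambda>v. v $ k)) (at y within S)"
  by (rule bounded_linear_imp_has_derivative[OF bounded_linear_vec_nth])

lemma chart_change_has_derivative:
  assumes "y$2 \<noteq> 0"
  shows "(chart_change has_derivative chart_change_deriv y) (at y)"
proof -
  have "((\<lambda>x. chart_change x $ k) has_derivative (\<lambda>v. chart_change_deriv y v $ k)) (at y)" for k
  proof (cases "k = 1")
    case True
    have "((\<lambda>x. x $ 1 * x $ 2) has_derivative (\<lambda>v. y $ 1 * v $ 2 + v $ 1 * y $ 2)) (at y)"
      by (intro has_derivative_mult has_derivative_nth)
    then show ?thesis using True by (simp add: chart_change_def chart_change_deriv_def add.commute)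
  next
    case False
    then have k: "k = 2" using exhaust_2 by blast
    have "((\<lambda>x. inverse (x $ 2)) has_derivative (\<lambda>v. - (inverse (y $ 2) * v $ 2 * inverse (y $ 2)))) (at y)"
      by (rule Deriv.has_derivative_inverse[OF assms has_derivative_nth])
    then show ?thesis using k by (simp add: chart_change_def chart_change_deriv_def power2_eq_square divide_inverse mult_ac)
  qed
  then show ?thesis
    by (subst has_derivative_componentwise_within)
       (auto simp: Basis_vec_def inner_axis intro: has_derivative_inner_left)
qed

lemma chart_change_deriv_scale: "chart_change_deriv y (c *s v) = c *s chart_change_deriv y v"
  by (auto simp: chart_change_deriv_def vec_eq_iff forall_2 algebra_simps)

lemma continuous_on_chart_change: "continuous_on {y. y$2 \<noteq> 0} chart_change"
  using chart_change_has_derivative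
  by (intro continuous_at_imp_continuous_on) (auto intro: has_derivative_continuous)

text \<open>
  The inverse charts are open maps, because the change of charts is continuous where it is
  defined.
\<close>
lemma openin_cpoint_image:
  assumes "open S" shows "openin (manifold_topology blowup_atlas) (cpoint i ` S)"
proof -
  have "open (cpoint j -` (cpoint i ` S))" for j
  proof (cases "j = i")
    case True
    then have "cpoint j -` (cpoint i ` S) = S" by (auto simp: cpoint_inj)
    then show ?thesis using assms by simp
  next
    case False
    have "cpoint j y \<in> cpoint i ` S \<longleftrightarrow> y$2 \<noteq> 0 \<and> chart_change y \<in> S" for y
    proof
      assume "cpoint j y \<in> cpoint i ` S"
      then obtain s where s: "s \<in> S" "cpoint j y = cpoint i s" by blast
      then have "y$2 \<noteq> 0" using cpoint_other[OF False, of y] by simp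
      with s show "y$2 \<noteq> 0 \<and> chart_change y \<in> S" using cpoint_chart_change[OF False, of y] by (simp add: cpoint_inj)
    next
      assume "y$2 \<noteq> 0 \<and> chart_change y \<in> S"
      then show "cpoint j y \<in> cpoint i ` S" using cpoint_chart_change[OF False, of y] by simp
    qed
    then have "cpoint j -` (cpoint i ` S) = {y. y$2 \<noteq> 0} \<inter> chart_change -` S" by blast
    then show ?thesis
      using continuous_open_preimage[OF continuous_on_chart_change open_nth2_nonzero assms] by simp
  qed
  then show ?thesis using cpoint_blowup by (auto simp: openin_blowup)
qed

lemma second_countable_blowup: "second_countable (manifold_topology blowup_atlas)"
proof -
  obtain \<B> :: "(complex^2) set set" where B: "countable \<B>" "topological_basis \<B>"
    using ex_countable_basis by blast
  let ?C = "(\<Union>i. (\<lambda>S. cpoint i ` S) ` \<B>)"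
  show ?thesis
    unfolding second_countable_def
  proof (intro exI[of _ ?C] conjI allI impI ballI)
    show "countable ?C" using B by (intro countable_UN countable_image) auto
    show "openin (manifold_topology blowup_atlas) V" if "V \<in> ?C" for V
      using that B(2) openin_cpoint_image topological_basis_open by blast
    fix U x assume Ux: "openin (manifold_topology blowup_atlas) U \<and> x \<in> U"
    then obtain i y where x: "x = cpoint i y" using blowup_cases openin_blowup by blast
    have "open (cpoint i -` U)" "y \<in> cpoint i -` U" using Ux x by (auto simp: openin_blowup)
    then obtain S where "S \<in> \<B>" "y \<in> S" "S \<subseteq> cpoint i -` U"
      using B(2) topological_basisE by metis
    then show "\<exists>V\<in>?C. x \<in> V \<and> V \<subseteq> U"
      using x by (intro bexI[of _ "cpoint i ` S"]) auto
  qed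
qed

text \<open>
  Two points that lie in no common chart both have second coordinate $0$, each in its own chart;
  the sets where this coordinate has modulus below $1$ are disjoint, as the two second
  coordinates of a common point are inverse to each other.
\<close>
lemma Hausdorff_blowup: "Hausdorff_space (manifold_topology blowup_atlas)"
  unfolding Hausdorff_space_def topspace_blowup
proof (intro allI impI)
  fix p q assume pq: "p \<in> blowup \<and> q \<in> blowup \<and> p \<noteq> q"
  let ?G = "\<exists>U V. openin (manifold_topology blowup_atlas) U \<and> openin (manifold_topology blowup_atlas) V \<and>
      p \<in> U \<and> q \<in> V \<and> disjnt U V"
  have same: ?G if "p = cpoint i x" "q = cpoint i y" for i x y
  proof -
    have "x \<noteq> y" using pq unfolding that by (simp only: cpoint_inj simp_thms)
    then obtain S T where "open S" "open T" "x \<in> S" "y \<in> T" "S \<inter> T = {}"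
      using hausdorff[OF \<open>x \<noteq> y\<close>] by blast
    have inj: "inj (cpoint i)" by (rule injI) (simp only: cpoint_inj)
    have "disjnt (cpoint i ` S) (cpoint i ` T)"
      unfolding disjnt_def image_Int[OF inj, symmetric] \<open>S \<inter> T = {}\<close> by (rule image_empty)
    moreover have "p \<in> cpoint i ` S" "q \<in> cpoint i ` T"
      unfolding that by (rule imageI, fact)+
    ultimately show ?G
      using openin_cpoint_image[OF \<open>open S\<close>, of i] openin_cpoint_image[OF \<open>open T\<close>, of i] by (intro exI conjI)
  qed
  have "p \<in> blowup" "q \<in> blowup" using pq by simp_all
  obtain i x where p: "p = cpoint i x" by (rule blowup_cases[OF \<open>p \<in> blowup\<close>])
  obtain j y where q: "q = cpoint j y" by (rule blowup_cases[OF \<open>q \<in> blowup\<close>])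
  show ?G
  proof (cases "i = j")
    case True
    show ?G by (rule same[OF p]) (simp only: q True)
  next
    case ij: False
    show ?G
    proof (cases "x$2 = 0 \<and> y$2 = 0")
      case True
      let ?S = "{y::complex^2. cmod (y$2) < 1}"
      have "open ?S" by (intro open_Collect_less continuous_intros)
      moreover have "disjnt (cpoint i ` ?S) (cpoint j ` ?S)"
      proof -
        have False if "cmod (a$2) < 1" "cmod (b$2) < 1" and ab: "cpoint i a = cpoint j b" for a b
        proof -
          have "a$2 \<noteq> 0" using cpoint_other[OF ij, of a] ab by simp
          then have "b = chart_change a" using cpoint_chart_change[OF ij, of a] ab by (simp add: cpoint_inj)
          then have "cmod (a$2) * cmod (b$2) = 1"
            using \<open>a$2 \<noteq> 0\<close> by (simp only: chart_change_nth2 norm_mult[symmetric]) simp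
          moreover have "cmod (a$2) * cmod (b$2) < 1 * 1"
            using that by (intro mult_strict_mono') simp_all
          ultimately show False by linarith
        qed
        then show ?thesis unfolding disjnt_iff by blast
      qed
      moreover have "p \<in> cpoint i ` ?S" "q \<in> cpoint j ` ?S"
        unfolding p q using True by (intro imageI; simp)+
      ultimately show ?G
        using openin_cpoint_image[of ?S i] openin_cpoint_image[of ?S j] by (intro exI conjI)
    next
      case False
      then consider "x$2 \<noteq> 0" | "y$2 \<noteq> 0" by blast
      then show ?G
      proof cases
        case 1
        show ?G by (rule same[OF trans[OF p cpoint_chart_change[OF ij 1]] q])
      next
        case 2
        show ?G by (rule same[OF p trans[OF q cpoint_chart_change[OF ij[symmetric] 2]]])
      qed
    qed
  qed
qed

lemma transition_same: "transition (bchart i) (bchart i) y = y"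
  by (simp add: transition_def chart_inv_bchart snd_bchart)

lemma transition_other: "i \<noteq> j \<Longrightarrow> y$2 \<noteq> 0 \<Longrightarrow> transition (bchart i) (bchart j) y = chart_change y"
  by (simp add: transition_def chart_inv_bchart cpoint_chart_change snd_bchart)

lemma coords_whole: "coords (bchart i) (range (cpoint i)) = UNIV"
  by (auto simp: coords_bchart)

lemma coords_other: "i \<noteq> j \<Longrightarrow> coords (bchart i) (range (cpoint j)) = {y. y$2 \<noteq> 0}"
  unfolding coords_bchart vimage_def by (rule Collect_cong) (rule cpoint_other)

lemma holo_on_cong:
  assumes "open S" "\<And>x. x \<in> S \<Longrightarrow> f x = g x" "holo_on f S"
  shows "holo_on g S"
  unfolding holo_on_def
proof
  fix x assume x: "x \<in> S"
  then obtain D where D: "(f has_derivative D) (at x)" "\<forall>c v. D (c *s v) = c * D v"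
    using assms(3) by (auto simp: holo_on_def)
  have "(g has_derivative D) (at x)"
    by (rule has_derivative_transform_within_open[OF D(1) assms(1) x]) (rule assms(2))
  with D(2) show "\<exists>D. (g has_derivative D) (at x) \<and> (\<forall>c v. D (c *s v) = c * D v)" by blast
qed

lemma holo_on_nth: "holo_on (\<lambda>y. y $ k) S"
  unfolding holo_on_def
  by (intro ballI exI[of _ "\<lambda>v. v $ k"]) (simp add: has_derivative_nth)

lemma holo_on_compose_chart_change:
  assumes "holo_on f UNIV"
  shows "holo_on (\<lambda>y. f (chart_change y)) {y. y$2 \<noteq> 0}"
  unfolding holo_on_def
proof clarify
  fix y :: "complex^2" assume y: "y$2 \<noteq> 0"
  obtain D where D: "(f has_derivative D) (at (chart_change y))" "\<forall>c v. D (c *s v) = c * D v"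
    using assms unfolding holo_on_def by blast
  have "((\<lambda>y. f (chart_change y)) has_derivative (\<lambda>v. D (chart_change_deriv y v))) (at y)"
    by (rule has_derivative_compose[OF chart_change_has_derivative[OF y] D(1)])
  then show "\<exists>D. ((\<lambda>y. f (chart_change y)) has_derivative D) (at y) \<and> (\<forall>c v. D (c *s v) = c * D v)"
    by (intro exI[of _ "\<lambda>v. D (chart_change_deriv y v)"]) (simp add: D(2) chart_change_deriv_scale)
qed

lemma complex_manifold_blowup: "complex_manifold blowup_atlas"
  unfolding complex_manifold_def
proof (intro conjI ballI allI)
  fix c assume "c \<in> blowup_atlas"
  then obtain i where c: "c = bchart i" by (auto simp: bchart_atlas)
  show "inj_on (snd c) (fst c)" unfolding c by (rule inj_on_bchart)
  show "open (coords c (fst c))" by (simp add: c fst_bchart coords_whole)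
  fix d assume "d \<in> blowup_atlas"
  then obtain j where d: "d = bchart j" by (auto simp: bchart_atlas)
  show "open (coords c (fst d))"
    by (cases "i = j") (simp_all add: c d fst_bchart coords_whole coords_other open_nth2_nonzero)
  fix k
  show "holo_on (\<lambda>y. transition c d y $ k) (coords c (fst d))"
  proof (cases "i = j")
    case True
    then show ?thesis by (simp add: c d transition_same holo_on_nth)
  next
    case False
    show ?thesis
      unfolding c d fst_bchart coords_other[OF False]
      by (rule holo_on_cong[OF open_nth2_nonzero _ holo_on_compose_chart_change[OF holo_on_nth[of k]]])
         (simp add: transition_other[OF False])
  qed
qed (rule Hausdorff_blowup second_countable_blowup)+

section \<open>The Simanca form\<close>

text \<open>
  The differential of the coordinate $z t$ of the plane, in the direction \<open>v\<close>.
\<close>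
definition plane_lift :: "complex^2 \<Rightarrow> complex^2 \<Rightarrow> complex" where
  "plane_lift y v = v$1 * y$2 + y$1 * v$2"

text \<open>
  The coefficient of the Fubini--Study form in the coordinate $t$.
\<close>
definition fs_factor :: "complex^2 \<Rightarrow> real" where
  "fs_factor y = inverse ((1 + (cmod (y$2))\<^sup>2)\<^sup>2)"

text \<open>
  The Hermitian form whose negative imaginary part, divided by $\pi$, is the Simanca form: the
  Euclidean form of the plane in terms of the differentials of $z$ and $z t$, plus the
  Fubini--Study form.
\<close>
definition simanca_herm :: "complex^2 \<Rightarrow> complex^2 \<Rightarrow> complex^2 \<Rightarrow> complex" where
  "simanca_herm y v w = v$1 * cnj (w$1) + plane_lift y v * cnj (plane_lift y w) + v$2 * cnj (w$2) * of_real (fs_factor y)"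

definition simanca_local :: "complex^2 \<Rightarrow> complex^2 \<Rightarrow> complex^2 \<Rightarrow> real" where
  "simanca_local y v w = - Im (simanca_herm y v w) / pi"

definition simanca_local_atlas :: "(blowup_point, 2) form2" where
  "simanca_local_atlas c y v w = (if c \<in> blowup_atlas then simanca_local y v w else 0)"

lemma fs_factor_pos: "0 < fs_factor y"
  by (simp add: fs_factor_def)

lemma bilinear_simanca_local: "bilinear (simanca_local y)"
proof -
  have "simanca_local y (v + v') w = simanca_local y v w + simanca_local y v' w"
    "simanca_local y v (w + w') = simanca_local y v w + simanca_local y v w'"
    "simanca_local y (c *\<^sub>R v) w = c *\<^sub>R simanca_local y v w" "simanca_local y v (c *\<^sub>R w) = c *\<^sub>R simanca_local y v w" for v v' w w' c
    by (simp_all add: simanca_local_def simanca_herm_def plane_lift_def field_simps)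
  then show ?thesis unfolding bilinear_def by (intro conjI allI linearI)
qed

lemma simanca_local_self: "simanca_local y v v = 0"
  by (simp add: simanca_local_def simanca_herm_def)

lemma simanca_local_smooth: "smooth_on (\<lambda>y. simanca_local y v w) UNIV"
  unfolding simanca_local_def simanca_herm_def plane_lift_def fs_factor_def divide_inverse minus_mult_left[symmetric] minus_mult_right
  by (intro smooth_on_mult smooth_on_Im smooth_on_add smooth_on_cnj smooth_on_const smooth_on_nth
      smooth_on_compose_bounded_linear[OF _ bounded_linear_of_real] smooth_on_inverse smooth_on_power
      smooth_on_cmod_square open_UNIV) (simp only: power_eq_0_iff one_plus_cmod2 simp_thms)

text \<open>
  The change of charts exchanges the differentials of $z$ and $z t$, and it leaves the
  Fubini--Study form invariant.
\<close>
lemma simanca_local_chart_change: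
  assumes "y$2 \<noteq> 0"
  shows "simanca_local (chart_change y) (chart_change_deriv y v) (chart_change_deriv y w) = simanca_local y v w"
proof -
  have l: "plane_lift (chart_change y) (chart_change_deriv y v) = v$1" for v
    using assms by (simp add: plane_lift_def chart_change_deriv_def field_simps power2_eq_square)
  have f: "chart_change_deriv y v $ 1 = plane_lift y v" for v by (simp add: chart_change_deriv_def plane_lift_def)
  have "chart_change_deriv y v $ 2 * cnj (chart_change_deriv y w $ 2) * of_real (fs_factor (chart_change y))
      = v$2 * cnj (w$2) * of_real (fs_factor y)"
  proof -
    define q where "q = (cmod (y$2))\<^sup>2"
    have q: "q > 0" using assms by (simp add: q_def)
    have "fs_factor (chart_change y) = q\<^sup>2 * fs_factor y"
    proof -
      have "(cmod (chart_change y $ 2))\<^sup>2 = 1 / q" by (simp add: norm_divide power_divide q_def)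
      then have "fs_factor (chart_change y) = inverse ((1 + 1 / q)\<^sup>2)" by (simp only: fs_factor_def)
      also have "1 + 1 / q = (1 + q) / q" using q by (simp add: field_simps)
      also have "inverse (((1 + q) / q)\<^sup>2) = q\<^sup>2 * inverse ((1 + q)\<^sup>2)"
        by (subst power_divide, subst inverse_divide, rule divide_inverse)
      finally show ?thesis by (simp add: fs_factor_def q_def)
    qed
    moreover have "complex_of_real q = y$2 * cnj (y$2)" by (simp only: q_def complex_norm_square)
    ultimately show ?thesis
      using assms by (simp add: chart_change_deriv_def field_simps power2_eq_square)
  qed
  then show ?thesis by (simp add: simanca_local_def simanca_herm_def l f add.commute)
qed

lemma frechet_transition_same: "frechet_derivative (transition (bchart i) (bchart i)) (at y) v = v"
proof -
  have "transition (bchart i) (bchart i) = (\<lambda>y. y)" by (simp add: fun_eq_iff transition_same)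
  then show ?thesis by (simp add: frechet_derivative_at[OF has_derivative_ident, symmetric])
qed

lemma frechet_transition_other:
  assumes "i \<noteq> j" "y$2 \<noteq> 0"
  shows "frechet_derivative (transition (bchart i) (bchart j)) (at y) = chart_change_deriv y"
proof -
  have "(transition (bchart i) (bchart j) has_derivative chart_change_deriv y) (at y)"
    by (rule has_derivative_transform_within_open[OF chart_change_has_derivative[OF assms(2)] open_nth2_nonzero])
       (use assms in \<open>simp_all add: transition_other\<close>)
  then show ?thesis by (rule frechet_derivative_at[symmetric])
qed

lemma smooth_form2_simanca_local: "smooth_form2 blowup_atlas simanca_local_atlas"
  unfolding smooth_form2_def
proof (intro conjI ballI allI impI)
  fix c y v w assume "\<not> (c \<in> blowup_atlas \<and> y \<in> coords c (fst c))"
  then have "c \<notin> blowup_atlas" by (auto simp: bchart_atlas fst_bchart coords_whole)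
  then show "simanca_local_atlas c y v w = 0" by (simp add: simanca_local_atlas_def)
next
  fix c y assume "c \<in> blowup_atlas"
  then have "simanca_local_atlas c y = simanca_local y" by (simp add: simanca_local_atlas_def fun_eq_iff)
  then show "bilinear (simanca_local_atlas c y)" "simanca_local_atlas c y v v = 0" for v
    by (simp_all add: bilinear_simanca_local simanca_local_self)
next
  fix c v w assume c: "c \<in> blowup_atlas"
  then have "coords c (fst c) = UNIV" by (auto simp: bchart_atlas fst_bchart coords_whole)
  then show "smooth_on (\<lambda>y. simanca_local_atlas c y v w) (coords c (fst c))"
    using c by (simp add: simanca_local_atlas_def simanca_local_smooth)
next
  fix c d y v w assume "c \<in> blowup_atlas" "d \<in> blowup_atlas" and y: "y \<in> coords c (fst d)"
  then obtain i j where cd: "c = bchart i" "d = bchart j" by (auto simp: bchart_atlas)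
  have cA: "bchart i \<in> blowup_atlas" for i by (simp add: bchart_atlas)
  show "simanca_local_atlas c y v w = simanca_local_atlas d (transition c d y)
      (frechet_derivative (transition c d) (at y) v) (frechet_derivative (transition c d) (at y) w)"
  proof (cases "i = j")
    case True
    then show ?thesis by (simp add: cd simanca_local_atlas_def cA frechet_transition_same transition_same)
  next
    case False
    then have "y$2 \<noteq> 0" using y by (simp add: cd fst_bchart coords_other)
    then show ?thesis
      using False by (simp add: cd simanca_local_atlas_def cA frechet_transition_other transition_other simanca_local_chart_change)
  qed
qed

definition fs_factor_deriv :: "complex^2 \<Rightarrow> complex^2 \<Rightarrow> real" where
  "fs_factor_deriv y u = - (inverse ((1 + (cmod (y$2))\<^sup>2)\<^sup>2) *
        (2 * (1 + (cmod (y$2))\<^sup>2) * (2 * (Re (y$2) * Re (u$2) + Im (y$2) * Im (u$2)))) *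
         inverse ((1 + (cmod (y$2))\<^sup>2)\<^sup>2))"

definition simanca_local_deriv :: "complex^2 \<Rightarrow> complex^2 \<Rightarrow> complex^2 \<Rightarrow> complex^2 \<Rightarrow> real" where
  "simanca_local_deriv y v w u = - Im ((v$1 * u$2 + u$1 * v$2) * cnj (plane_lift y w) + plane_lift y v * cnj (w$1 * u$2 + u$1 * w$2)
     + v$2 * cnj (w$2) * of_real (fs_factor_deriv y u)) / pi"

lemma fs_factor_has_derivative:
  "(fs_factor has_derivative fs_factor_deriv y) (at y)"
proof -
  have "((\<lambda>y. (1 + (cmod (y$2))\<^sup>2)\<^sup>2) has_derivative
      (\<lambda>u. 2 * (1 + (cmod (y$2))\<^sup>2) * (2 * (Re (y$2) * Re (u$2) + Im (y$2) * Im (u$2))))) (at y)"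
    unfolding cmod_power2
    by (rule derivative_eq_intros has_derivative_nth refl | simp add: algebra_simps)+
  then show ?thesis
    unfolding fs_factor_def fs_factor_deriv_def by (rule Deriv.has_derivative_inverse[rotated]) simp
qed

lemma plane_lift_has_derivative: "((\<lambda>y. plane_lift y v) has_derivative (\<lambda>u. v$1 * u$2 + u$1 * v$2)) (at y)"
  unfolding plane_lift_def
  by (rule derivative_eq_intros has_derivative_nth refl | simp add: algebra_simps)+

lemma simanca_local_has_derivative: "((\<lambda>y. simanca_local y v w) has_derivative simanca_local_deriv y v w) (at y)"
proof -
  have of_real: "((\<lambda>y. complex_of_real (fs_factor y)) has_derivative (\<lambda>u. of_real (fs_factor_deriv y u))) (at y)"
    by (rule bounded_linear.has_derivative[OF bounded_linear_of_real fs_factor_has_derivative])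
  have "((\<lambda>y. simanca_herm y v w) has_derivative (\<lambda>u. (v$1 * u$2 + u$1 * v$2) * cnj (plane_lift y w) + plane_lift y v * cnj (w$1 * u$2 + u$1 * w$2)
     + v$2 * cnj (w$2) * of_real (fs_factor_deriv y u))) (at y)" (is "(_ has_derivative ?D) _")
    unfolding simanca_herm_def
    by (rule has_derivative_eq_rhs, rule has_derivative_add, rule has_derivative_add, rule has_derivative_const,
        rule has_derivative_mult[OF plane_lift_has_derivative bounded_linear.has_derivative[OF bounded_linear_cnj plane_lift_has_derivative]],
        rule has_derivative_mult[OF has_derivative_const of_real])
       (simp add: fun_eq_iff)
  then have "((\<lambda>y. - Im (simanca_herm y v w) / pi) has_derivative (\<lambda>u. - Im (?D u) / pi)) (at y)"
    by (intro bounded_linear.has_derivative[OF bounded_linear_divide] has_derivative_minus bounded_linear.has_derivative[OF bounded_linear_Im])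
  then show ?thesis unfolding simanca_local_def simanca_local_deriv_def .
qed

lemma simanca_local_closed: "simanca_local_deriv y v w u - simanca_local_deriv y u w v + simanca_local_deriv y u v w = 0"
proof -
  have alg: "- Im a / pi - - Im b / pi + - Im c / pi = 0" if "Im (a - b + c) = 0" for a b c
  proof -
    have "Im a = Im b - Im c" using that by simp
    then show ?thesis by (simp add: diff_divide_distrib)
  qed
  show ?thesis
    unfolding simanca_local_deriv_def
    by (rule alg) (simp add: fs_factor_deriv_def plane_lift_def algebra_simps)
qed

lemma kaehler_form_simanca_local: "kaehler_form blowup_atlas simanca_local_atlas"
  unfolding kaehler_form_def closed_form2_def
proof (intro conjI ballI allI smooth_form2_simanca_local impI)
  fix c y u v w assume c: "c \<in> blowup_atlas"
  have [simp]: "simanca_local_atlas c = simanca_local" using c by (simp add: simanca_local_atlas_def fun_eq_iff)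
  show "ext_deriv2 simanca_local_atlas c y u v w = 0"
    using simanca_local_closed[of y v w u]
    by (simp add: ext_deriv2_def frechet_derivative_at[OF simanca_local_has_derivative, symmetric])
  show "simanca_local_atlas c y (\<i> *s v) (\<i> *s w) = simanca_local_atlas c y v w"
    by (simp add: simanca_local_def simanca_herm_def plane_lift_def algebra_simps)
  assume v: "v \<noteq> 0"
  have "simanca_herm y v (\<i> *s v) = - \<i> * (v$1 * cnj (v$1) + plane_lift y v * cnj (plane_lift y v) + v$2 * cnj (v$2) * of_real (fs_factor y))"
    by (simp add: simanca_herm_def plane_lift_def algebra_simps)
  also have "\<dots> = - \<i> * of_real ((cmod (v$1))\<^sup>2 + (cmod (plane_lift y v))\<^sup>2 + (cmod (v$2))\<^sup>2 * fs_factor y)"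
    by (simp only: of_real_add of_real_mult complex_norm_square)
  finally have "simanca_local y v (\<i> *s v) = ((cmod (v$1))\<^sup>2 + (cmod (plane_lift y v))\<^sup>2 + (cmod (v$2))\<^sup>2 * fs_factor y) / pi"
    by (simp add: simanca_local_def)
  moreover have "(cmod (v$1))\<^sup>2 + (cmod (plane_lift y v))\<^sup>2 + (cmod (v$2))\<^sup>2 * fs_factor y > 0"
  proof -
    have "v$1 \<noteq> 0 \<or> v$2 \<noteq> 0" using v by (auto simp: vec_eq_iff forall_2)
    then show ?thesis
    proof
      assume "v$1 \<noteq> 0"
      then have "0 < (cmod (v$1))\<^sup>2" "0 \<le> (cmod (v$2))\<^sup>2 * fs_factor y" "0 \<le> (cmod (plane_lift y v))\<^sup>2"
        using fs_factor_pos[of y] by simp_all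
      then show ?thesis by linarith
    next
      assume "v$2 \<noteq> 0"
      then have "0 < (cmod (v$2))\<^sup>2 * fs_factor y" "0 \<le> (cmod (v$1))\<^sup>2" "0 \<le> (cmod (plane_lift y v))\<^sup>2"
        using fs_factor_pos[of y] by simp_all
      then show ?thesis by linarith
    qed
  qed
  ultimately show "associated_metric simanca_local_atlas c y v v > 0"
    by (simp add: associated_metric_def)
qed

text \<open>
  The Wirtinger derivatives are the coefficients of the complex linear and antilinear parts of
  the derivative.
\<close>
lemma dz_dzbar_eq:
  fixes F :: "complex^2 \<Rightarrow> complex"
  assumes "(F has_derivative (\<lambda>v. a1 * v$1 + b1 * cnj (v$1) + a2 * v$2 + b2 * cnj (v$2))) (at y)"
  shows "dz j F y = (if j = 1 then a1 else a2)" "dzbar j F y = (if j = 1 then b1 else b2)"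
proof -
  have f: "frechet_derivative F (at y) = (\<lambda>v. a1 * v$1 + b1 * cnj (v$1) + a2 * v$2 + b2 * cnj (v$2))"
    by (rule frechet_derivative_at[OF assms, symmetric])
  have "i * (i * x) = (i * i) * x" for i x :: complex by (simp only: mult.assoc)
  then show "dz j F y = (if j = 1 then a1 else a2)" "dzbar j F y = (if j = 1 then b1 else b2)"
    using exhaust_2[of j] by (auto simp: dz_def dzbar_def f axis_def algebra_simps)
qed

lemma dz_cong:
  assumes "open S" "y \<in> S" "\<And>z. z \<in> S \<Longrightarrow> f z = g z"
  shows "dz j f y = dz j g y"
proof -
  have "(f has_derivative D) (at y) \<longleftrightarrow> (g has_derivative D) (at y)" for D
    using has_derivative_transform_within_open[of _ _ y UNIV S] assms by metis
  then show ?thesis by (simp add: dz_def frechet_derivative_def)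
qed

lemma ddbar_form_eq:
  fixes u :: "complex^2 \<Rightarrow> real"
  assumes S: "open S" "y \<in> S"
    and du: "\<And>z. z \<in> S \<Longrightarrow> ((\<lambda>z. complex_of_real (u z)) has_derivative
        (\<lambda>v. a1 z * v$1 + b1 z * cnj (v$1) + a2 z * v$2 + b2 z * cnj (v$2))) (at z)"
    and db1: "(b1 has_derivative (\<lambda>v. h11 * v$1 + g11 * cnj (v$1) + h21 * v$2 + g21 * cnj (v$2))) (at y)"
    and db2: "(b2 has_derivative (\<lambda>v. h12 * v$1 + g12 * cnj (v$1) + h22 * v$2 + g22 * cnj (v$2))) (at y)"
    and H: "\<And>v w. h11 * (v$1 * cnj (w$1)) + h12 * (v$1 * cnj (w$2)) + h21 * (v$2 * cnj (w$1)) + h22 * (v$2 * cnj (w$2)) = H v w"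
    and herm: "\<And>v w. H w v = cnj (H v w)"
  shows "ddbar_form u y v w = - Im (H v w) / pi"
proof -
  have "dz j (dzbar k (\<lambda>z. of_real (u z))) y = dz j (if k = 1 then b1 else b2) y" for j k
    by (rule dz_cong[OF S]) (simp add: dz_dzbar_eq(2)[OF du])
  then have h: "dz j (dzbar k (\<lambda>z. of_real (u z))) y
      = (if k = 1 then if j = 1 then h11 else h21 else if j = 1 then h12 else h22)" for j k
    by (simp add: dz_dzbar_eq(1)[OF db1] dz_dzbar_eq(1)[OF db2])
  have "(\<Sum>j\<in>UNIV. \<Sum>k\<in>UNIV. dz j (dzbar k (\<lambda>z. of_real (u z))) y * (v $ j * cnj (w $ k) - w $ j * cnj (v $ k)))
      = H v w - H w v"
    unfolding H[symmetric] sum_2 h by (simp add: algebra_simps)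
  then have "ddbar_form u y v w = Re (\<i> / (2 * of_real pi) * (H v w - cnj (H v w)))"
    by (simp only: ddbar_form_def herm[of w v])
  also have "H v w - cnj (H v w) = \<i> * of_real (2 * Im (H v w))"
    by (simp add: complex_eq_iff)
  also have "\<i> / (2 * of_real pi) * (\<i> * of_real (2 * Im (H v w))) = of_real (- Im (H v w) / pi)"
    by (simp add: field_simps)
  finally show ?thesis by (simp only: Re_complex_of_real)
qed

lemma cmod_square_has_derivative:
  "((\<lambda>y. complex_of_real ((cmod (y$k))\<^sup>2)) has_derivative (\<lambda>v. cnj (z$k) * v$k + z$k * cnj (v$k))) (at z)"
  unfolding complex_norm_square
  by (rule has_derivative_eq_rhs, rule has_derivative_mult[OF has_derivative_nth
        bounded_linear.has_derivative[OF bounded_linear_cnj has_derivative_nth]])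
     (simp add: fun_eq_iff mult.commute)

text \<open>
  The derivative of a real function, regarded as complex valued, has real values; this is how a
  derivative given in complex form is seen to be one.
\<close>
lemma of_real_ln_has_derivative:
  fixes f :: "'a::real_normed_vector \<Rightarrow> real"
  assumes f: "((\<lambda>x. complex_of_real (f x)) has_derivative D) (at z)" and pos: "f z > 0"
  shows "((\<lambda>x. complex_of_real (ln (f x))) has_derivative (\<lambda>v. D v / of_real (f z))) (at z)"
proof -
  have "((\<lambda>x. Re (complex_of_real (f x))) has_derivative (\<lambda>v. Re (D v))) (at z)"
    by (rule bounded_linear.has_derivative[OF bounded_linear_Re f])
  then have Df: "(f has_derivative (\<lambda>v. Re (D v))) (at z)" by simp
  have "((\<lambda>x. complex_of_real (f x)) has_derivative (\<lambda>v. of_real (Re (D v)))) (at z)"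
    by (rule bounded_linear.has_derivative[OF bounded_linear_of_real Df])
  then have D: "D = (\<lambda>v. of_real (Re (D v)))" by (rule has_derivative_unique[OF f])
  have "((\<lambda>x. ln (f x)) has_derivative (\<lambda>v. Re (D v) * inverse (f z))) (at z)"
    using Df pos by (auto intro!: derivative_eq_intros simp: divide_inverse)
  then have "((\<lambda>x. complex_of_real (ln (f x))) has_derivative (\<lambda>v. of_real (Re (D v) * inverse (f z)))) (at z)"
    by (rule bounded_linear.has_derivative[OF bounded_linear_of_real])
  then show ?thesis by (subst D) (simp add: divide_inverse)
qed

definition local_potential :: "complex^2 \<Rightarrow> real" where
  "local_potential y = (cmod (y$1))\<^sup>2 * (1 + (cmod (y$2))\<^sup>2) + ln (1 + (cmod (y$2))\<^sup>2)"

lemma simanca_herm_hermitian: "simanca_herm y w v = cnj (simanca_herm y v w)"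
  by (simp add: simanca_herm_def mult.commute)

text \<open>
  The term $\log |t|^2$ accounts for a change of frame and contributes nothing, being
  pluriharmonic. It is included here so that one computation serves for all frames; where its
  coefficient vanishes, $t = 0$ is allowed.
\<close>
lemma local_potential_ddbar:
  assumes y: "c = 0 \<or> y$2 \<noteq> 0"
  shows "ddbar_form (\<lambda>z. a * local_potential z + c * ln ((cmod (z$2))\<^sup>2)) y v w = a * simanca_local y v w"
proof -
  let ?S = "{z::complex^2. c = 0 \<or> z$2 \<noteq> 0}"
  have S: "open ?S" using open_nth2_nonzero by (cases "c = 0") auto
  let ?q = "\<lambda>z. of_real (1 + (cmod (z$2))\<^sup>2) :: complex"
  have q0: "?q z \<noteq> 0" for z :: "complex^2"
    by (simp only: of_real_eq_0_iff one_plus_cmod2 simp_thms not_False_eq_True)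
  note sq = cmod_square_has_derivative
  have dq: "(?q has_derivative (\<lambda>v. cnj (z$2) * v$2 + z$2 * cnj (v$2))) (at z)" for z :: "complex^2"
    unfolding of_real_add using has_derivative_add[OF has_derivative_const sq[of 2 z]] by simp
  have dln: "((\<lambda>z. complex_of_real (ln (1 + (cmod (z$2))\<^sup>2))) has_derivative
      (\<lambda>v. (cnj (z$2) * v$2 + z$2 * cnj (v$2)) / ?q z)) (at z)" for z :: "complex^2"
    by (rule of_real_ln_has_derivative[OF dq]) simp
  have dln2: "((\<lambda>z. complex_of_real (c * ln ((cmod (z$2))\<^sup>2))) has_derivative
      (\<lambda>v. of_real c * (v$2 / z$2 + cnj (v$2) / cnj (z$2)))) (at z)" if "z \<in> ?S" for z :: "complex^2"
  proof (cases "c = 0")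
    case False
    then have z: "z$2 \<noteq> 0" using that by simp
    have "((\<lambda>z. complex_of_real (ln ((cmod (z$2))\<^sup>2))) has_derivative
      (\<lambda>v. (cnj (z$2) * v$2 + z$2 * cnj (v$2)) / of_real ((cmod (z$2))\<^sup>2))) (at z)"
      by (rule of_real_ln_has_derivative[OF sq]) (use z in simp)
    then have "((\<lambda>z. complex_of_real (c * ln ((cmod (z$2))\<^sup>2))) has_derivative
      (\<lambda>v. of_real c * ((cnj (z$2) * v$2 + z$2 * cnj (v$2)) / of_real ((cmod (z$2))\<^sup>2)))) (at z)"
      unfolding of_real_mult by (rule has_derivative_mult_right)
    moreover have "(cnj (z$2) * v$2 + z$2 * cnj (v$2)) / of_real ((cmod (z$2))\<^sup>2)
        = v$2 / z$2 + cnj (v$2) / cnj (z$2)" for v :: "complex^2"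
      unfolding complex_norm_square using z by (simp add: field_simps)
    ultimately show ?thesis by (simp only:)
  qed simp
  define b1 where "b1 z = of_real a * (z$1 * ?q z)" for z :: "complex^2"
  define b2 where "b2 z = of_real a * (of_real ((cmod (z$1))\<^sup>2) * z$2 + z$2 / ?q z) + of_real c / cnj (z$2)" for z :: "complex^2"
  define a1 where "a1 z = of_real a * (cnj (z$1) * ?q z)" for z :: "complex^2"
  define a2 where "a2 z = of_real a * (of_real ((cmod (z$1))\<^sup>2) * cnj (z$2) + cnj (z$2) / ?q z) + of_real c / z$2" for z :: "complex^2"
  define h22 :: complex where "h22 = of_real a * (of_real ((cmod (y$1))\<^sup>2) + of_real (fs_factor y))"
  have fs: "complex_of_real (fs_factor y) = inverse (?q y) - y$2 * cnj (y$2) * (inverse (?q y) * inverse (?q y))"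
  proof -
    have "complex_of_real (fs_factor y) = 1 / (?q y)\<^sup>2" by (simp add: fs_factor_def divide_inverse)
    also have "\<dots> = (?q y - y$2 * cnj (y$2)) / (?q y)\<^sup>2"
      by (simp only: complex_norm_square[symmetric] of_real_add) simp
    also have "\<dots> = inverse (?q y) - y$2 * cnj (y$2) * (inverse (?q y) * inverse (?q y))"
    proof -
      have "(Q - p) / Q\<^sup>2 = inverse Q - p * (inverse Q * inverse Q)" if "Q \<noteq> 0" for Q p :: complex
        using that by (simp add: field_simps power2_eq_square)
      then show ?thesis using q0[of y] by blast
    qed
    finally show ?thesis .
  qed
  have "ddbar_form (\<lambda>z. a * local_potential z + c * ln ((cmod (z$2))\<^sup>2)) y v w
      = - Im (of_real a * simanca_herm y v w) / pi"
  proof (rule ddbar_form_eq[OF S, of y _ a1 b1 a2 b2])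
    show "y \<in> ?S" using y by simp
  next
    fix z assume z: "z \<in> ?S"
    have "((\<lambda>z. complex_of_real a * (of_real ((cmod (z$1))\<^sup>2) * ?q z + of_real (ln (1 + (cmod (z$2))\<^sup>2)))
          + of_real (c * ln ((cmod (z$2))\<^sup>2))) has_derivative
        (\<lambda>v. of_real a * ((of_real ((cmod (z$1))\<^sup>2) * (cnj (z$2) * v$2 + z$2 * cnj (v$2))
            + (cnj (z$1) * v$1 + z$1 * cnj (v$1)) * ?q z)
            + (cnj (z$2) * v$2 + z$2 * cnj (v$2)) / ?q z)
          + of_real c * (v$2 / z$2 + cnj (v$2) / cnj (z$2)))) (at z)"
      by (intro has_derivative_add has_derivative_mult_right has_derivative_mult[OF sq dq] dln dln2 z)
    then show "((\<lambda>z. complex_of_real (a * local_potential z + c * ln ((cmod (z$2))\<^sup>2))) has_derivative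
        (\<lambda>v. a1 z * v$1 + b1 z * cnj (v$1) + a2 z * v$2 + b2 z * cnj (v$2))) (at z)"
      unfolding local_potential_def of_real_add of_real_mult a1_def b1_def a2_def b2_def
      by (rule has_derivative_eq_rhs) (simp add: fun_eq_iff distrib_left distrib_right add_divide_distrib mult_ac add_ac)
  next
    have "(b1 has_derivative (\<lambda>v. of_real a * (y$1 * (cnj (y$2) * v$2 + y$2 * cnj (v$2)) + v$1 * ?q y))) (at y)"
      unfolding b1_def by (intro has_derivative_mult_right has_derivative_mult has_derivative_nth dq)
    then show "(b1 has_derivative (\<lambda>v. (of_real a * ?q y) * v$1 + 0 * cnj (v$1)
        + (of_real a * (y$1 * cnj (y$2))) * v$2 + (of_real a * (y$1 * y$2)) * cnj (v$2))) (at y)"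
      by (rule has_derivative_eq_rhs) (simp add: fun_eq_iff distrib_left distrib_right mult_ac add_ac)
  next
    have inv: "((\<lambda>z. inverse (?q z)) has_derivative
        (\<lambda>v. - (inverse (?q y) * (cnj (y$2) * v$2 + y$2 * cnj (v$2)) * inverse (?q y)))) (at y)"
      by (rule Deriv.has_derivative_inverse[OF q0 dq])
    have last: "((\<lambda>z. of_real c / cnj (z$2)) has_derivative
        (\<lambda>v. - of_real c / (cnj (y$2))\<^sup>2 * cnj (v$2))) (at y)"
    proof (cases "c = 0")
      case False
      then have y2: "cnj (y$2) \<noteq> 0" using y by simp
      have "((\<lambda>z. of_real c * inverse (cnj (z$2))) has_derivative
        (\<lambda>v. of_real c * - (inverse (cnj (y$2)) * cnj (v$2) * inverse (cnj (y$2))))) (at y)"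
        by (intro has_derivative_mult_right Deriv.has_derivative_inverse[where f="\<lambda>z. cnj (z$2)"] y2
            bounded_linear.has_derivative[OF bounded_linear_cnj] has_derivative_nth)
      then show ?thesis by (simp add: divide_inverse power2_eq_square mult_ac)
    qed simp
    have "((\<lambda>z. of_real a * (of_real ((cmod (z$1))\<^sup>2) * z$2 + z$2 * inverse (?q z)) + of_real c / cnj (z$2)) has_derivative
        (\<lambda>v. of_real a * ((of_real ((cmod (y$1))\<^sup>2) * v$2 + (cnj (y$1) * v$1 + y$1 * cnj (v$1)) * y$2)
          + (y$2 * - (inverse (?q y) * (cnj (y$2) * v$2 + y$2 * cnj (v$2)) * inverse (?q y)) + v$2 * inverse (?q y)))
          + - of_real c / (cnj (y$2))\<^sup>2 * cnj (v$2))) (at y)"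
      by (intro has_derivative_add has_derivative_mult_right has_derivative_mult sq has_derivative_nth inv last)
    then show "(b2 has_derivative (\<lambda>v. (of_real a * (cnj (y$1) * y$2)) * v$1 + (of_real a * (y$1 * y$2)) * cnj (v$1)
        + h22 * v$2 + (- of_real a * (y$2 * y$2) * (inverse (?q y) * inverse (?q y)) - of_real c / (cnj (y$2))\<^sup>2) * cnj (v$2))) (at y)"
      unfolding b2_def divide_inverse[of _ "?q _"] h22_def fs
      by (rule has_derivative_eq_rhs) (simp add: fun_eq_iff distrib_left distrib_right left_diff_distrib right_diff_distrib
          divide_inverse mult_ac add_ac)
  next
    fix v w :: "complex^2"
    show "of_real a * ?q y * (v$1 * cnj (w$1)) + of_real a * (cnj (y$1) * y$2) * (v$1 * cnj (w$2))
        + of_real a * (y$1 * cnj (y$2)) * (v$2 * cnj (w$1)) + h22 * (v$2 * cnj (w$2)) = of_real a * simanca_herm y v w"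
      unfolding h22_def simanca_herm_def plane_lift_def of_real_add complex_norm_square by (simp add: algebra_simps)
    show "of_real a * simanca_herm y w v = cnj (of_real a * simanca_herm y v w)"
      by (simp add: simanca_herm_hermitian[of y w v])
  qed
  then show ?thesis by (simp add: simanca_local_def)
qed

lemma norm_square_complex2: "(norm (z::complex^2))\<^sup>2 = (cmod (z$1))\<^sup>2 + (cmod (z$2))\<^sup>2"
  by (simp add: norm_vec_def L2_set_def sum_2)

lemma simanca_potential_ddbar:
  assumes y: "z \<noteq> 0"
  defines "s \<equiv> complex_of_real ((norm z)\<^sup>2)"
  shows "ddbar_form simanca_potential z v w = - Im ((v$1 * cnj (w$1) + v$2 * cnj (w$2)) * (1 + 1 / s)
     - (v$1 * cnj (z$1) + v$2 * cnj (z$2)) * cnj (w$1 * cnj (z$1) + w$2 * cnj (z$2)) / s\<^sup>2) / pi"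
proof -
  let ?S = "- {0::complex^2}"
  let ?s = "\<lambda>z::complex^2. complex_of_real ((norm z)\<^sup>2)"
  let ?ds = "\<lambda>z v. cnj (z$1) * v$1 + z$1 * cnj (v$1) + (cnj (z$2) * v$2 + z$2 * cnj (v$2))"
  have s0: "?s z \<noteq> 0" if "z \<in> ?S" for z using that by simp
  have ds: "(?s has_derivative ?ds z) (at z)" for z
    unfolding norm_square_complex2 of_real_add
    by (intro has_derivative_add cmod_square_has_derivative)
  have dln: "((\<lambda>z. complex_of_real (ln ((norm z)\<^sup>2))) has_derivative (\<lambda>v. ?ds z v / ?s z)) (at z)" if "z \<in> ?S" for z
    by (rule of_real_ln_has_derivative[OF ds]) (use that in simp)
  have db: "((\<lambda>z. z$k * (1 + inverse (?s z))) has_derivative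
      (\<lambda>v. z$k * (- (inverse s * ?ds z v * inverse s)) + v$k * (1 + inverse s))) (at z)" for k
  proof -
    have "((\<lambda>z. 1 + inverse (?s z)) has_derivative (\<lambda>v. 0 + - (inverse s * ?ds z v * inverse s))) (at z)"
      unfolding s_def using y by (intro has_derivative_add has_derivative_const Deriv.has_derivative_inverse ds) simp
    then show ?thesis unfolding s_def by (intro has_derivative_mult has_derivative_nth) simp
  qed
  show ?thesis
  proof (rule ddbar_form_eq[of ?S z _ "\<lambda>z. cnj (z$1) * (1 + inverse (?s z))" "\<lambda>z. z$1 * (1 + inverse (?s z))"
        "\<lambda>z. cnj (z$2) * (1 + inverse (?s z))" "\<lambda>z. z$2 * (1 + inverse (?s z))"])
    show "z \<in> ?S" using y by simp
  next
    fix z assume z: "z \<in> ?S"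
    have "((\<lambda>z. ?s z + complex_of_real (ln ((norm z)\<^sup>2))) has_derivative (\<lambda>v. ?ds z v + ?ds z v / ?s z)) (at z)"
      by (intro has_derivative_add ds dln z)
    then show "((\<lambda>z. complex_of_real (simanca_potential z)) has_derivative
        (\<lambda>v. cnj (z$1) * (1 + inverse (?s z)) * v$1 + z$1 * (1 + inverse (?s z)) * cnj (v$1)
           + cnj (z$2) * (1 + inverse (?s z)) * v$2 + z$2 * (1 + inverse (?s z)) * cnj (v$2))) (at z)"
      unfolding simanca_potential_def of_real_add
      by (rule has_derivative_eq_rhs) (simp add: fun_eq_iff divide_inverse distrib_left distrib_right mult_ac add_ac)
  next
    show "((\<lambda>z. z$1 * (1 + inverse (?s z))) has_derivative (\<lambda>v. (1 + inverse s - z$1 * cnj (z$1) * inverse s * inverse s) * v$1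
       + (- z$1 * z$1 * inverse s * inverse s) * cnj (v$1) + (- z$1 * cnj (z$2) * inverse s * inverse s) * v$2
       + (- z$1 * z$2 * inverse s * inverse s) * cnj (v$2))) (at z)"
      by (rule has_derivative_eq_rhs[OF db]) (simp add: fun_eq_iff algebra_simps)
    show "((\<lambda>z. z$2 * (1 + inverse (?s z))) has_derivative (\<lambda>v. (- z$2 * cnj (z$1) * inverse s * inverse s) * v$1
       + (- z$2 * z$1 * inverse s * inverse s) * cnj (v$1) + (1 + inverse s - z$2 * cnj (z$2) * inverse s * inverse s) * v$2
       + (- z$2 * z$2 * inverse s * inverse s) * cnj (v$2))) (at z)"
      by (rule has_derivative_eq_rhs[OF db]) (simp add: fun_eq_iff algebra_simps)
  next
    fix v w :: "complex^2"
    show "(1 + inverse s - z$1 * cnj (z$1) * inverse s * inverse s) * (v$1 * cnj (w$1))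
        + (- z$2 * cnj (z$1) * inverse s * inverse s) * (v$1 * cnj (w$2))
        + (- z$1 * cnj (z$2) * inverse s * inverse s) * (v$2 * cnj (w$1))
        + (1 + inverse s - z$2 * cnj (z$2) * inverse s * inverse s) * (v$2 * cnj (w$2))
      = (v$1 * cnj (w$1) + v$2 * cnj (w$2)) * (1 + 1 / s)
        - (v$1 * cnj (z$1) + v$2 * cnj (z$2)) * cnj (w$1 * cnj (z$1) + w$2 * cnj (z$2)) / s\<^sup>2"
      by (simp add: divide_inverse power2_eq_square algebra_simps)
    have "cnj s = s" by (simp add: s_def)
    then show "(w$1 * cnj (v$1) + w$2 * cnj (v$2)) * (1 + 1 / s)
        - (w$1 * cnj (z$1) + w$2 * cnj (z$2)) * cnj (v$1 * cnj (z$1) + v$2 * cnj (z$2)) / s\<^sup>2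
      = cnj ((v$1 * cnj (w$1) + v$2 * cnj (w$2)) * (1 + 1 / s)
        - (v$1 * cnj (z$1) + v$2 * cnj (z$2)) * cnj (w$1 * cnj (z$1) + w$2 * cnj (z$2)) / s\<^sup>2)"
      by (simp add: mult_ac add_ac)
  qed (rule open_Compl[OF closed_singleton])
qed

lemma fst_cpoint_has_derivative:
  "((\<lambda>z. fst (cpoint i z)) has_derivative (\<lambda>v. \<chi> j. if j = i then v$1 else plane_lift y v)) (at y)"
proof -
  have "((\<lambda>z. fst (cpoint i z) $ j) has_derivative (\<lambda>v. if j = i then v$1 else plane_lift y v)) (at y)" for j
  proof (cases "j = i")
    case True
    then show ?thesis by (simp add: cpoint_def has_derivative_nth)
  next
    case False
    have "((\<lambda>z. z$1 * z$2) has_derivative (\<lambda>v. y$1 * v$2 + v$1 * y$2)) (at y)"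
      by (intro has_derivative_mult has_derivative_nth)
    with False show ?thesis by (simp add: cpoint_def plane_lift_def add.commute)
  qed
  then show ?thesis
    by (subst has_derivative_componentwise_within)
       (auto simp: Basis_vec_def inner_axis intro: has_derivative_inner_left)
qed

text \<open>
  The logarithmic part of the Hessian of the potential has numerator $|a_1 z_2 - a_2 z_1|^2$ by
  Lagrange's identity, and for a tangent vector coming from the chart this determinant is $-z^2
  v_2$.
\<close>
lemma pullback_hermitian:
  fixes y v w :: "complex^2" and X X' :: complex
  assumes y: "y$1 \<noteq> 0"
  defines "p \<equiv> y$1" and "q \<equiv> y$1 * y$2"
  defines "s \<equiv> p * cnj p + q * cnj q"
  shows "(v$1 * cnj (w$1) + plane_lift y v * cnj (plane_lift y w)) * (1 + 1 / s)
     - (v$1 * cnj p + plane_lift y v * cnj q) * cnj (w$1 * cnj p + plane_lift y w * cnj q) / s\<^sup>2 = simanca_herm y v w"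
proof -
  let ?A = "v$1 * cnj (w$1) + plane_lift y v * cnj (plane_lift y w)"
  let ?B = "(v$1 * cnj p + plane_lift y v * cnj q) * cnj (w$1 * cnj p + plane_lift y w * cnj q)"
  \<comment> \<open>$Q = 1 + |t|^2$, and $s = |z|^2 Q$ is the squared norm in the plane.\<close>
  define Q where "Q = complex_of_real (1 + (cmod (y$2))\<^sup>2)"
  have Q0: "Q \<noteq> 0"
    unfolding Q_def by (simp only: of_real_eq_0_iff one_plus_cmod2 simp_thms not_False_eq_True)
  have sQ: "s = p * cnj p * Q"
    unfolding s_def p_def q_def Q_def of_real_add complex_norm_square by (simp add: algebra_simps)
  have p0: "p * cnj p \<noteq> 0" using y by (simp add: p_def)
  have s0: "s \<noteq> 0" using Q0 p0 sQ by simp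
  \<comment> \<open>The determinant of the position vector and the image of \<open>v\<close> in the plane.\<close>
  have lagrange: "v$1 * q - plane_lift y v * p = - (p * p) * v$2" for v :: "complex^2"
    by (simp add: plane_lift_def p_def q_def algebra_simps)
  have "?A * s - ?B = (v$1 * q - plane_lift y v * p) * cnj (w$1 * q - plane_lift y w * p)"
    unfolding s_def by (simp add: algebra_simps)
  also have "\<dots> = (- (p * p) * v$2) * cnj (- (p * p) * w$2)"
    by (simp only: lagrange)
  finally have num: "?A * s - ?B = (p * cnj p)\<^sup>2 * (v$2 * cnj (w$2))"
    by (simp add: power2_eq_square mult_ac)
  have "?A * (1 + 1 / s) - ?B / s\<^sup>2 = ?A + (?A * s - ?B) / s\<^sup>2"
    using s0 by (simp add: diff_divide_distrib power2_eq_square distrib_left)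
  also have "(?A * s - ?B) / s\<^sup>2 = (p * cnj p)\<^sup>2 * (v$2 * cnj (w$2)) / (p * cnj p * Q)\<^sup>2"
    by (simp only: num) (simp only: sQ)
  also have "\<dots> = v$2 * cnj (w$2) * inverse (Q\<^sup>2)"
    unfolding power_mult_distrib[of _ Q] using p0 by (simp add: divide_inverse)
  also have "inverse (Q\<^sup>2) = of_real (fs_factor y)"
    by (simp add: Q_def fs_factor_def)
  finally show ?thesis by (simp add: simanca_herm_def)
qed

lemma simanca_pullback:
  fixes i :: 2
  assumes y: "y$1 \<noteq> 0"
  defines "DP \<equiv> frechet_derivative (\<lambda>z. fst (cpoint i z)) (at y)"
  shows "ddbar_form simanca_potential (fst (cpoint i y)) (DP v) (DP w) = simanca_local y v w"
proof -
  have DP: "DP v $ j = (if j = i then v$1 else plane_lift y v)" for v j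
    unfolding DP_def by (simp add: frechet_derivative_at[OF fst_cpoint_has_derivative, symmetric])
  let ?z = "fst (cpoint i y)"
  have z: "?z $ j = (if j = i then y$1 else y$1 * y$2)" for j by (simp add: cpoint_def)
  have "?z $ i \<noteq> 0" using y by (simp add: z)
  then have z0: "?z \<noteq> 0" by (metis zero_index)
  have s: "complex_of_real ((norm ?z)\<^sup>2) = y$1 * cnj (y$1) + y$1 * y$2 * cnj (y$1 * y$2)"
    unfolding norm_square_complex2 of_real_add complex_norm_square using exhaust_2[of i] by (auto simp: z)
  show ?thesis
    unfolding simanca_potential_ddbar[OF z0] s simanca_local_def pullback_hermitian[OF y, symmetric]
    using exhaust_2[of i] by (auto simp: DP z add.commute)
qed

lemma cpoint_exceptional: "cpoint i y \<in> exceptional_divisor \<longleftrightarrow> y$1 = 0"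
proof -
  have "fst (cpoint i y) = 0 \<longleftrightarrow> y$1 = 0"
    by (auto simp: cpoint_def vec_eq_iff)
  then show ?thesis using cpoint_blowup by (simp add: exceptional_divisor_def)
qed

lemma coords_off_exceptional:
  "coords (bchart i) (fst (bchart i) - exceptional_divisor) = {y. y$1 \<noteq> 0}"
  unfolding coords_bchart fst_bchart vimage_def
  by (rule Collect_cong) (simp add: cpoint_exceptional)

text \<open>
  The complement of a hyperplane is dense.
\<close>
lemma eq_if_eq_off_hyperplane:
  fixes f g :: "complex^2 \<Rightarrow> real"
  assumes f: "continuous_on UNIV f" and g: "continuous_on UNIV g"
    and eq: "\<And>y. y$1 \<noteq> 0 \<Longrightarrow> f y = g y"
  shows "f y = g y"
proof (cases "y$1 = 0")
  case True
  let ?h = "\<lambda>t::real. y + t *\<^sub>R axis 1 1"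
  have "(?h \<longlongrightarrow> y + 0 *\<^sub>R axis 1 1) (at 0)" by (intro tendsto_intros)
  then have h: "(?h \<longlongrightarrow> y) (at 0)" by simp
  have fc: "isCont f y" and gc: "isCont g y" using f g by (simp_all add: continuous_on_eq_continuous_at)
  note lf = isCont_tendsto_compose[OF fc h] and lg = isCont_tendsto_compose[OF gc h]
  have "f (?h t) = g (?h t)" if "t \<noteq> 0" for t :: real
    using that True by (intro eq) (simp add: axis_def)
  then have "((\<lambda>t. g (?h t)) \<longlongrightarrow> f y) (at 0)"
    by (intro Lim_transform_eventually[OF lf] eventually_mono[OF eventually_neq_at_within[of 0]])
  from tendsto_unique[OF _ this lg] show ?thesis by simp
qed (rule eq)

lemma smooth_on_imp_continuous_on: "smooth_on f S \<Longrightarrow> continuous_on S f"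
  unfolding smooth_on_def by (metis Ck_on.simps(1))

lemma simanca_local_atlas_pullback:
  assumes "c \<in> blowup_atlas" "y \<in> coords c (fst c - exceptional_divisor)"
  shows "simanca_local_atlas c y v w = ddbar_form simanca_potential (fst (chart_inv c y))
    (frechet_derivative (\<lambda>z. fst (chart_inv c z)) (at y) v)
    (frechet_derivative (\<lambda>z. fst (chart_inv c z)) (at y) w)"
proof -
  obtain i where c: "c = bchart i" using assms(1) unfolding bchart_atlas by (rule rangeE)
  have "y$1 \<noteq> 0" using assms(2) unfolding c coords_off_exceptional by (rule CollectD)
  then show ?thesis
    unfolding simanca_local_atlas_def if_P[OF assms(1)] unfolding c chart_inv_bchart by (rule simanca_pullback[symmetric])
qed

text \<open>
  Existence: the local formula is a Kaehler form and pulls back correctly. Uniqueness: a form is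
  continuous and is prescribed off the exceptional divisor, which is the hyperplane $z = 0$ in
  each chart.
\<close>
theorem simanca_form_eq: "simanca_form = simanca_local_atlas"
  unfolding simanca_form_def Let_def
proof (rule the_equality)
  show "kaehler_form blowup_atlas simanca_local_atlas \<and>
     (\<forall>c\<in>blowup_atlas. \<forall>y\<in>coords c (fst c - exceptional_divisor). \<forall>v w.
        simanca_local_atlas c y v w = ddbar_form simanca_potential (fst (chart_inv c y))
          (frechet_derivative (\<lambda>z. fst (chart_inv c z)) (at y) v)
          (frechet_derivative (\<lambda>z. fst (chart_inv c z)) (at y) w))"
    by (intro conjI kaehler_form_simanca_local ballI allI simanca_local_atlas_pullback)
next
  fix \<omega> assume \<omega>: "kaehler_form blowup_atlas \<omega> \<and>
     (\<forall>c\<in>blowup_atlas. \<forall>y\<in>coords c (fst c - exceptional_divisor). \<forall>v w.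
        \<omega> c y v w = ddbar_form simanca_potential (fst (chart_inv c y))
          (frechet_derivative (\<lambda>z. fst (chart_inv c z)) (at y) v)
          (frechet_derivative (\<lambda>z. fst (chart_inv c z)) (at y) w))"
  have smooth: "smooth_form2 blowup_atlas \<omega>"
    using conjunct1[OF \<omega>] unfolding kaehler_form_def closed_form2_def by (elim conjE)
  note smooth' = smooth[unfolded smooth_form2_def]
  have zero: "\<omega> c y v w = 0" if "c \<notin> blowup_atlas" for c y v w
    by (rule conjunct1[OF smooth', rule_format]) (use that in simp)
  have smooth_on: "smooth_on (\<lambda>y. \<omega> c y v w) (coords c (fst c))" if "c \<in> blowup_atlas" for c v w
    by (rule conjunct1[OF conjunct2[OF conjunct2[OF smooth']], rule_format, OF that])
  show "\<omega> = simanca_local_atlas"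
  proof (intro ext)
    fix c y v w
    show "\<omega> c y v w = simanca_local_atlas c y v w"
    proof (cases "c \<in> blowup_atlas")
      case True
      then obtain i where c: "c = bchart i" unfolding bchart_atlas by (rule rangeE)
      have sm: "smooth_on (\<lambda>y. \<omega> c y v w) UNIV"
        using smooth_on[OF True, of v w] by (simp add: c fst_bchart coords_whole)
      have off: "\<omega> c y v w = simanca_local y v w" if "y$1 \<noteq> 0" for y
      proof -
        have "y \<in> coords c (fst c - exceptional_divisor)"
          using that by (simp add: c coords_off_exceptional)
        from spec[OF spec[OF bspec[OF bspec[OF conjunct2[OF \<omega>] True] this]]]
        have "\<omega> c y v w = ddbar_form simanca_potential (fst (chart_inv c y))
            (frechet_derivative (\<lambda>z. fst (chart_inv c z)) (at y) v)
            (frechet_derivative (\<lambda>z. fst (chart_inv c z)) (at y) w)" .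
        then show ?thesis unfolding c chart_inv_bchart simanca_pullback[OF that] .
      qed
      have "\<omega> c y v w = simanca_local y v w"
        by (rule eq_if_eq_off_hyperplane[OF smooth_on_imp_continuous_on[OF sm]
              smooth_on_imp_continuous_on[OF simanca_local_smooth] off])
      then show ?thesis using True by (simp add: simanca_local_atlas_def)
    next
      case False
      then show ?thesis by (simp add: zero simanca_local_atlas_def)
    qed
  qed
qed

section \<open>The volume measure of the blow-up\<close>

text \<open>
  The sum over the permutations of four basis vectors is eight times the Pfaffian, and $8 = 2^2
  \cdot 2!$.
\<close>
lemma volume_density_pfaffian:
  fixes \<omega> :: "complex^2 \<Rightarrow> complex^2 \<Rightarrow> real"
  assumes alt: "\<And>v w. \<omega> w v = - \<omega> v w"
  shows "volume_density \<omega> =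
     \<omega> (axis 1 1) (axis 1 \<i>) * \<omega> (axis 2 1) (axis 2 \<i>)
   - \<omega> (axis 1 1) (axis 2 1) * \<omega> (axis 1 \<i>) (axis 2 \<i>)
   + \<omega> (axis 1 1) (axis 2 \<i>) * \<omega> (axis 1 \<i>) (axis 2 1)"
proof -
  define a b c d :: "2 \<times> bool" where abcd: "a = (1, False)" "b = (1, True)" "c = (2, False)" "d = (2, True)"
  have ne: "a \<noteq> b" "a \<noteq> c" "a \<noteq> d" "b \<noteq> c" "b \<noteq> d" "c \<noteq> d" by (simp_all add: abcd)
  have U: "(UNIV :: (2 \<times> bool) set) = {a, b, c, d}"
    unfolding abcd by (auto simp: UNIV_2 set_eq_iff) (metis exhaust_2)+
  define W where "W p q = \<omega> (oriented_basis p) (oriented_basis q)" for p q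
  have W: "W b a = - W a b" "W c a = - W a c" "W d a = - W a d" "W c b = - W b c" "W d b = - W b d" "W d c = - W c d"
    unfolding W_def by (rule alt)+
  have prod: "(\<Prod>j\<in>UNIV. W (\<sigma> (j, False)) (\<sigma> (j, True))) = W (\<sigma> a) (\<sigma> b) * W (\<sigma> c) (\<sigma> d)" for \<sigma>
    by (simp add: UNIV_2 abcd)
  have f1: "finite {b, c, d}" "a \<notin> {b, c, d}" and f2: "finite {c, d}" "b \<notin> {c, d}" and f3: "finite {d}" "c \<notin> {d}"
    using ne by auto
  have "(\<Sum>\<sigma> | \<sigma> permutes UNIV. of_int (sign \<sigma>) * (W (\<sigma> a) (\<sigma> b) * W (\<sigma> c) (\<sigma> d)))
      = 8 * (W a b * W c d - W a c * W b d + W a d * W b c)"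
    unfolding U
    unfolding sum_over_permutations_insert[OF f1]
    unfolding sum_over_permutations_insert[OF f2]
    unfolding sum_over_permutations_insert[OF f3]
    unfolding permutes_sing
    using ne ne[symmetric]
    by (simp add: sign_swap_id permutation_swap_id sign_compose sign_id permutation_compose transpose_def W)
  then show ?thesis
    unfolding volume_density_def prod[unfolded W_def, symmetric]
    unfolding W_def[symmetric] prod
    by (simp add: W_def oriented_basis_def abcd)
qed

definition volume_factor :: "complex^2 \<Rightarrow> real" where
  "volume_factor y = ((cmod (y$1))\<^sup>2 + 1 / (1 + (cmod (y$2))\<^sup>2)) / pi\<^sup>2"

lemma volume_density_simanca_local: "volume_density (simanca_local y) = volume_factor y"
proof -
  have "simanca_local y w v = - simanca_local y v w" for v w
    by (simp add: simanca_local_def simanca_herm_hermitian[of y w v])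
  then have "volume_density (simanca_local y) =
     simanca_local y (axis 1 1) (axis 1 \<i>) * simanca_local y (axis 2 1) (axis 2 \<i>)
   - simanca_local y (axis 1 1) (axis 2 1) * simanca_local y (axis 1 \<i>) (axis 2 \<i>)
   + simanca_local y (axis 1 1) (axis 2 \<i>) * simanca_local y (axis 1 \<i>) (axis 2 1)"
    by (rule volume_density_pfaffian)
  also have "\<dots> = ((1 + (cmod (y$2))\<^sup>2) * ((cmod (y$1))\<^sup>2 + fs_factor y)
      - (cmod (y$1))\<^sup>2 * (cmod (y$2))\<^sup>2) / pi\<^sup>2"
  proof -
    have n: "(cmod z)\<^sup>2 = Re z * Re z + Im z * Im z" for z unfolding cmod_power2 by (simp add: power2_eq_square)
    have "simanca_local y (axis 1 1) (axis 1 \<i>) = (1 + (cmod (y$2))\<^sup>2) / pi"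
      "simanca_local y (axis 2 1) (axis 2 \<i>) = ((cmod (y$1))\<^sup>2 + fs_factor y) / pi"
      by (simp_all add: simanca_local_def simanca_herm_def plane_lift_def axis_def n algebra_simps)
    moreover have "simanca_local y (axis 1 1) (axis 2 1) = - Im (y$2 * cnj (y$1)) / pi"
      "simanca_local y (axis 1 \<i>) (axis 2 \<i>) = - Im (y$2 * cnj (y$1)) / pi"
      "simanca_local y (axis 1 1) (axis 2 \<i>) = Re (y$2 * cnj (y$1)) / pi"
      "simanca_local y (axis 1 \<i>) (axis 2 1) = - Re (y$2 * cnj (y$1)) / pi"
      by (simp_all add: simanca_local_def simanca_herm_def plane_lift_def axis_def algebra_simps)
    moreover have "(cmod (y$1))\<^sup>2 * (cmod (y$2))\<^sup>2 = Im (y$2 * cnj (y$1)) * Im (y$2 * cnj (y$1)) + Re (y$2 * cnj (y$1)) * Re (y$2 * cnj (y$1))"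
      unfolding n by (simp add: algebra_simps)
    moreover have "X / pi * (Y / pi) - - I / pi * (- I / pi) + R / pi * (- R / pi) = (X * Y - (I * I + R * R)) / pi\<^sup>2"
      for X Y I R
      by (simp add: power2_eq_square add_divide_distrib diff_divide_distrib)
    ultimately show ?thesis by (simp only:)
  qed
  also have "(1 + (cmod (y$2))\<^sup>2) * ((cmod (y$1))\<^sup>2 + fs_factor y) - (cmod (y$1))\<^sup>2 * (cmod (y$2))\<^sup>2
      = (cmod (y$1))\<^sup>2 + 1 / (1 + (cmod (y$2))\<^sup>2)"
  proof -
    have "u * (c + inverse (u\<^sup>2)) - c * (u - 1) = c + 1 / u" if "u > 0" for u c :: real
      using that by (simp add: power2_eq_square algebra_simps divide_inverse)
    from this[of "1 + (cmod (y$2))\<^sup>2" "(cmod (y$1))\<^sup>2"] show ?thesis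
      unfolding fs_factor_def by simp
  qed
  finally show ?thesis by (simp add: volume_factor_def)
qed

abbreviation "blowup_borel \<equiv> sigma blowup {W. openin (manifold_topology blowup_atlas) W}"

lemma openin_sub_Pow: "{W. openin (manifold_topology blowup_atlas) W} \<subseteq> Pow blowup"
  using openin_blowup by blast

lemma space_blowup_borel: "space blowup_borel = blowup"
  and sets_blowup_borel: "sets blowup_borel = sigma_sets blowup {W. openin (manifold_topology blowup_atlas) W}"
  by (simp_all add: openin_sub_Pow)

lemma measurable_cpoint [measurable]: "cpoint i \<in> borel \<rightarrow>\<^sub>M blowup_borel"
proof (rule measurable_measure_of[OF openin_sub_Pow])
  show "cpoint i \<in> space borel \<rightarrow> blowup" using cpoint_blowup by blast
  show "cpoint i -` W \<inter> space borel \<in> sets borel" if "W \<in> {W. openin (manifold_topology blowup_atlas) W}" for W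
    using that by (simp add: openin_blowup borel_open)
qed

lemma image_cpoint_sets:
  assumes "B \<in> sets borel" shows "cpoint i ` B \<in> sets blowup_borel"
proof -
  have inj: "inj (cpoint i)" by (rule injI) (simp only: cpoint_inj)
  have op: "cpoint i ` S \<in> sets blowup_borel" if "open S" for S
    unfolding sets_blowup_borel using openin_cpoint_image[OF that] by (intro sigma_sets.Basic CollectI)
  from assms have "B \<in> sigma_sets UNIV {S. open S}" by (simp add: borel_def)
  then show ?thesis
  proof induction
    case (Basic a)
    then show ?case by (simp add: op)
  next
    case Empty
    show ?case by simp
  next
    case (Compl a)
    show ?case unfolding image_set_diff[OF inj] by (rule sets.Diff[OF op[OF open_UNIV] Compl.IH])
  next
    case (Union a)
    show ?case unfolding image_UN
      by (rule sets.countable_nat_UN) (rule image_subsetI, rule Union.IH)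
  qed
qed

lemma blowup_eq_union: "blowup = range (cpoint 1) \<union> range (cpoint 2)"
proof (intro equalityI subsetI)
  fix p assume "p \<in> blowup"
  then obtain i y where p: "p = cpoint i y" by (rule blowup_cases)
  show "p \<in> range (cpoint 1) \<union> range (cpoint 2)"
  proof (cases "i = 1")
    case True
    show ?thesis unfolding p True by (rule UnI1) (rule rangeI)
  next
    case False
    then have "i = 2" using exhaust_2 by blast
    show ?thesis unfolding p \<open>i = 2\<close> by (rule UnI2) (rule rangeI)
  qed
next
  fix p assume "p \<in> range (cpoint 1) \<union> range (cpoint 2)"
  then show "p \<in> blowup" using cpoint_blowup by (elim UnE rangeE) (simp only:)+
qed

lemma vimage_Int_range: "f -` S \<inter> range g = g ` ((\<lambda>y. f (g y)) -` S)"
  by auto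

text \<open>
  A set is a Borel set if its preimages under both inverse charts are, because inverse charts
  map Borel sets to Borel sets.
\<close>
lemma borel_measurable_blowup:
  fixes f :: "blowup_point \<Rightarrow> 'b::topological_space"
  assumes "\<And>i. (\<lambda>y. f (cpoint i y)) \<in> borel_measurable borel"
  shows "f \<in> borel_measurable blowup_borel"
proof (rule measurableI)
  fix S :: "'b set" assume S: "S \<in> sets borel"
  let ?A = "\<lambda>i. (\<lambda>y. f (cpoint i y)) -` S"
  have A: "?A i \<in> sets borel" for i
    using measurable_sets[OF assms S] by simp
  have "f -` S \<inter> space blowup_borel = cpoint 1 ` ?A 1 \<union> cpoint 2 ` ?A 2"
    unfolding space_blowup_borel
    by (subst (1) blowup_eq_union) (simp only: Int_Un_distrib vimage_Int_range)
  then show "f -` S \<inter> space blowup_borel \<in> sets blowup_borel"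
    by (simp only: sets.Un image_cpoint_sets A)
qed simp

definition blowup_vol :: "2 \<Rightarrow> blowup_point measure" where
  "blowup_vol i = distr (density lborel (\<lambda>y. ennreal (volume_factor y))) blowup_borel (cpoint i)"

lemma volume_factor_nonneg: "0 \<le> volume_factor y"
  by (simp add: volume_factor_def)

lemma volume_factor_measurable [measurable]: "volume_factor \<in> borel_measurable borel"
  unfolding volume_factor_def[abs_def] by measurable

lemma sets_blowup_vol [simp]: "sets (blowup_vol i) = sets blowup_borel"
  and space_blowup_vol [simp]: "space (blowup_vol i) = blowup"
  unfolding blowup_vol_def by (simp, simp only: space_distr space_blowup_borel)

lemma emeasure_blowup_vol:
  assumes E: "E \<in> sets blowup_borel"
  shows "emeasure (blowup_vol i) E = (\<integral>\<^sup>+y. ennreal (volume_factor y) * indicator E (cpoint i y) \<partial>lborel)"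
proof -
  have m: "cpoint i \<in> density lborel (\<lambda>y. ennreal (volume_factor y)) \<rightarrow>\<^sub>M blowup_borel"
    using measurable_cpoint by (simp cong: measurable_cong_sets)
  have B: "cpoint i -` E \<in> sets lborel"
    using measurable_sets[OF measurable_cpoint E] by simp
  have "emeasure (blowup_vol i) E = emeasure (density lborel (\<lambda>y. ennreal (volume_factor y))) (cpoint i -` E)"
    unfolding blowup_vol_def using emeasure_distr[OF m E] by simp
  also have "\<dots> = (\<integral>\<^sup>+y. ennreal (volume_factor y) * indicator (cpoint i -` E) y \<partial>lborel)"
    by (rule emeasure_density[OF _ B]) simp
  finally show ?thesis by (simp only: indicator_vimage[unfolded o_def, symmetric])
qed

text \<open>
  Both sides live over the same $z$; for fixed $z \neq 0$ the substitution $w = z t$ is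
  multiplication by a constant.
\<close>
lemma emeasure_blowup_vol_plane:
  assumes E[measurable]: "E \<in> sets blowup_borel"
  shows "emeasure (blowup_vol i) E = (\<integral>\<^sup>+z. \<integral>\<^sup>+w. ennreal ((1 + 1 / ((cmod z)\<^sup>2 + (cmod w)\<^sup>2)) / pi\<^sup>2)
     * indicator E (cpoint i (vector [z, w / z])) \<partial>lborel \<partial>lborel)"
proof -
  let ?G = "\<lambda>z w. ennreal ((1 + 1 / ((cmod z)\<^sup>2 + (cmod w)\<^sup>2)) / pi\<^sup>2) * indicator E (cpoint i (vector [z, w / z]))"
  have "emeasure (blowup_vol i) E = (\<integral>\<^sup>+z. \<integral>\<^sup>+t. ennreal (volume_factor (vector [z, t])) * indicator E (cpoint i (vector [z, t])) \<partial>lborel \<partial>lborel)"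
    unfolding emeasure_blowup_vol[OF E] by (rule nn_integral_complex2) measurable
  also have "\<dots> = (\<integral>\<^sup>+z. \<integral>\<^sup>+w. ?G z w \<partial>lborel \<partial>lborel)"
  proof (rule nn_integral_cong_AE)
    have "AE z in lborel. z \<noteq> (0::complex)" by (rule AE_lborel_singleton)
    then show "AE z in lborel. (\<integral>\<^sup>+t. ennreal (volume_factor (vector [z, t])) * indicator E (cpoint i (vector [z, t])) \<partial>lborel)
        = (\<integral>\<^sup>+w. ?G z w \<partial>lborel)"
    proof eventually_elim
      fix z :: complex assume z: "z \<noteq> 0"
      have "(\<integral>\<^sup>+w. ?G z w \<partial>lborel) = ennreal ((cmod z)\<^sup>2) * (\<integral>\<^sup>+t. ?G z (z * t) \<partial>lborel)"
        by (rule nn_integral_complex_scale[OF _ z]) measurable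
      also have "\<dots> = (\<integral>\<^sup>+t. ennreal ((cmod z)\<^sup>2) * ?G z (z * t) \<partial>lborel)"
        by (rule nn_integral_cmult[symmetric]) measurable
      also have "\<dots> = (\<integral>\<^sup>+t. ennreal (volume_factor (vector [z, t])) * indicator E (cpoint i (vector [z, t])) \<partial>lborel)"
      proof (rule nn_integral_cong)
        fix t
        have "volume_factor (vector [z, t]) = (cmod z)\<^sup>2 * ((1 + 1 / ((cmod z)\<^sup>2 + (cmod (z * t))\<^sup>2)) / pi\<^sup>2)"
        proof -
          have "x + 1 / u = x * (1 + 1 / (x * u))" if "x \<noteq> 0" "u \<noteq> 0" for x u :: real
            using that by (simp add: distrib_left)
          from this[of "(cmod z)\<^sup>2" "1 + (cmod t)\<^sup>2"] z show ?thesis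
            by (simp add: volume_factor_def norm_mult power_mult_distrib distrib_left[of "(cmod z)\<^sup>2"])
        qed
        then show "ennreal ((cmod z)\<^sup>2) * ?G z (z * t) = ennreal (volume_factor (vector [z, t])) * indicator E (cpoint i (vector [z, t]))"
          using z by (simp only: mult.assoc[symmetric] ennreal_mult'[symmetric] zero_le_power2 nonzero_mult_div_cancel_left simp_thms)
      qed
      finally show "(\<integral>\<^sup>+t. ennreal (volume_factor (vector [z, t])) * indicator E (cpoint i (vector [z, t])) \<partial>lborel)
        = (\<integral>\<^sup>+w. ?G z w \<partial>lborel)" ..
    qed
  qed
  finally show ?thesis .
qed

text \<open>
  On the plane the two descriptions differ only by the order of the coordinates.
\<close>
lemma blowup_vol_independent: "blowup_vol i = blowup_vol j"
proof -
  have "blowup_vol i = blowup_vol j" if ij: "i \<noteq> j" for i j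
  proof (rule measure_eqI)
    fix E assume "E \<in> sets (blowup_vol i)"
    then have E[measurable]: "E \<in> sets blowup_borel" by (simp only: sets_blowup_vol)
    let ?G = "\<lambda>i z w. ennreal ((1 + 1 / ((cmod z)\<^sup>2 + (cmod w)\<^sup>2)) / pi\<^sup>2) * indicator E (cpoint i (vector [z, w / z]))"
    have "emeasure (blowup_vol i) E = (\<integral>\<^sup>+z. \<integral>\<^sup>+w. ?G j w z \<partial>lborel \<partial>lborel)"
      unfolding emeasure_blowup_vol_plane[OF E, of i]
    proof (rule nn_integral_cong_AE)
      have "AE z in lborel. z \<noteq> (0::complex)" by (rule AE_lborel_singleton)
      then show "AE z in lborel. (\<integral>\<^sup>+w. ?G i z w \<partial>lborel) = (\<integral>\<^sup>+w. ?G j w z \<partial>lborel)"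
      proof eventually_elim
        fix z :: complex assume z: "z \<noteq> 0"
        show "(\<integral>\<^sup>+w. ?G i z w \<partial>lborel) = (\<integral>\<^sup>+w. ?G j w z \<partial>lborel)"
        proof (rule nn_integral_cong_AE)
          have "AE w in lborel. w \<noteq> (0::complex)" by (rule AE_lborel_singleton)
          then show "AE w in lborel. ?G i z w = ?G j w z"
          proof eventually_elim
            fix w :: complex assume w: "w \<noteq> 0"
            have "chart_change (vector [z, w / z]) = vector [w, z / w]"
              using z by (simp add: chart_change_def)
            then have "cpoint i (vector [z, w / z]) = cpoint j (vector [w, z / w])"
              using cpoint_chart_change[OF ij, of "vector [z, w / z]"] z w by simp
            then show "?G i z w = ?G j w z" by (simp only: add.commute)
          qed
        qed
      qed
    qed
    also have "\<dots> = (\<integral>\<^sup>+w. \<integral>\<^sup>+z. ?G j w z \<partial>lborel \<partial>lborel)"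
      by (rule nn_integral_lborel_swap) measurable
    also have "\<dots> = emeasure (blowup_vol j) E" by (rule emeasure_blowup_vol_plane[OF E, symmetric])
    finally show "emeasure (blowup_vol i) E = emeasure (blowup_vol j) E" .
  qed simp
  then show ?thesis by (cases "i = j") simp_all
qed

lemma range_cpoint_sets: "range (cpoint i) \<in> sets blowup_borel"
  by (rule image_cpoint_sets) simp

text \<open>
  A measure with the required values on subsets of both charts exists by
  \<open>blowup_vol_independent\<close>. It is unique because each Borel set is a disjoint union
  of subsets of the charts.
\<close>
lemma volume_measure_blowup: "volume_measure blowup_atlas simanca_form = blowup_vol i"
  unfolding volume_measure_def points_blowup simanca_form_eq
proof (rule the_equality)
  let ?char = "\<lambda>\<mu>. space \<mu> = blowup \<and> sets \<mu> = sigma_sets blowup {W. openin (manifold_topology blowup_atlas) W} \<and>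
     (\<forall>c\<in>blowup_atlas. \<forall>E\<in>sets \<mu>. E \<subseteq> fst c \<longrightarrow>
        emeasure \<mu> E = (\<integral>\<^sup>+y\<in>coords c E. ennreal (volume_density (simanca_local_atlas c y)) \<partial>lborel))"
  have val: "(\<integral>\<^sup>+y\<in>coords c E. ennreal (volume_density (simanca_local_atlas c y)) \<partial>lborel) = emeasure (blowup_vol i) E"
    if cA: "c \<in> blowup_atlas" and E: "E \<in> sets blowup_borel" for c E
  proof -
    obtain j where c: "c = bchart j" using cA unfolding bchart_atlas by (rule rangeE)
    have "simanca_local_atlas c = simanca_local" using cA by (simp add: simanca_local_atlas_def fun_eq_iff)
    then have "(\<integral>\<^sup>+y\<in>coords c E. ennreal (volume_density (simanca_local_atlas c y)) \<partial>lborel)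
        = (\<integral>\<^sup>+y. ennreal (volume_factor y) * indicator E (cpoint j y) \<partial>lborel)"
      by (simp add: volume_density_simanca_local c coords_bchart indicator_def)
    also have "\<dots> = emeasure (blowup_vol i) E"
      unfolding emeasure_blowup_vol[OF E, symmetric] by (simp only: blowup_vol_independent[of j i])
    finally show ?thesis .
  qed
  show "?char (blowup_vol i)"
  proof (intro conjI ballI impI)
    show "sets (blowup_vol i) = sigma_sets blowup {W. openin (manifold_topology blowup_atlas) W}"
      unfolding sets_blowup_vol by (rule sets_blowup_borel)
  qed (simp_all only: space_blowup_vol sets_blowup_vol val)
  fix \<mu> assume \<mu>: "?char \<mu>"
  then have sets: "sets \<mu> = sets blowup_borel" using sets_blowup_borel by simp
  have em: "emeasure \<mu> E = emeasure (blowup_vol i) E" if "E \<in> sets blowup_borel" "E \<subseteq> range (cpoint j)" for E j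
  proof -
    have c: "bchart j \<in> blowup_atlas" unfolding bchart_atlas by (rule rangeI)
    show ?thesis
      using conjunct2[OF conjunct2[OF \<mu>], unfolded sets, THEN bspec[OF _ c], THEN bspec[OF _ that(1)]] that val[OF c that(1)]
      by (simp add: fst_bchart)
  qed
  show "\<mu> = blowup_vol i"
  proof (rule measure_eqI)
    show "sets \<mu> = sets (blowup_vol i)" using sets by (simp only: sets_blowup_vol)
    fix E assume "E \<in> sets \<mu>"
    then have E: "E \<in> sets blowup_borel" by (simp only: sets)
    let ?E1 = "E \<inter> range (cpoint 1)" and ?E2 = "E - range (cpoint 1)"
    have E12: "?E1 \<in> sets blowup_borel" "?E2 \<in> sets blowup_borel"
      using E range_cpoint_sets by (simp_all only: sets.Int sets.Diff)
    have "E \<subseteq> blowup" using sets.sets_into_space[OF E] by (simp only: space_blowup_borel)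
    then have E2: "?E2 \<subseteq> range (cpoint 2)" unfolding blowup_eq_union by blast
    have un: "?E1 \<union> ?E2 = E" and dis: "?E1 \<inter> ?E2 = {}" by blast+
    have "emeasure \<mu> E = emeasure \<mu> ?E1 + emeasure \<mu> ?E2"
      using plus_emeasure[of ?E1 \<mu> ?E2] E12 by (simp only: sets un dis)
    also have "\<dots> = emeasure (blowup_vol i) ?E1 + emeasure (blowup_vol i) ?E2"
      using em[OF E12(1), of 1] em[OF E12(2) E2] by simp
    also have "\<dots> = emeasure (blowup_vol i) E"
      using plus_emeasure[of ?E1 "blowup_vol i" ?E2] E12 by (simp only: sets_blowup_vol un dis)
    finally show "emeasure \<mu> E = emeasure (blowup_vol i) E" .
  qed
qed

section \<open>The quantum line bundle\<close>

text \<open>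
  The trivializing cover is indexed by natural numbers: chart $1$ appears once, chart $2$ at all
  other indices.
\<close>
definition cover_index :: "nat \<Rightarrow> 2" where
  "cover_index n = (if n = 0 then 1 else 2)"

text \<open>
  Any choice of homogeneous coordinates; the transition functions and the metric depend only on
  the projective point.
\<close>
definition homogeneous :: "blowup_point \<Rightarrow> complex^2" where
  "homogeneous x = (SOME t. t \<in> snd x)"

text \<open>
  The pullback of the hyperplane bundle of the projective line, whose frames are the homogeneous
  coordinates.
\<close>
definition quantum_bundle :: "blowup_point line_bundle_data" where
  "quantum_bundle = \<lparr>cover = (\<lambda>n. range (cpoint (cover_index n))), transfun = (\<lambda>n n' x. homogeneous x $ cover_index n' / homogeneous x $ cover_index n)\<rparr>"

text \<open>
  The power of the Fubini--Study metric, multiplied by $e^{-m|z|^2}$.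
\<close>
definition bmet :: "nat \<Rightarrow> blowup_point bmetric" where
  "bmet m n x = exp (- (real m * (norm (fst x))\<^sup>2)) * ((cmod (homogeneous x $ cover_index n))\<^sup>2 / (norm (homogeneous x))\<^sup>2) ^ m"

lemma homogeneous_cpoint: obtains c where "c \<noteq> 0" "homogeneous (cpoint i y) = c *s affine_rep i (y$2)"
proof -
  have "affine_rep i (y$2) \<in> snd (cpoint i y)" by (simp add: cpoint_def)
  then have "homogeneous (cpoint i y) \<in> snd (cpoint i y)" unfolding homogeneous_def by (rule someI)
  then show ?thesis using that by (auto simp: cpoint_def proj_point_def)
qed

lemma homogeneous_ratio: "homogeneous (cpoint i y) $ j / homogeneous (cpoint i y) $ k = affine_rep i (y$2) $ j / affine_rep i (y$2) $ k"
  by (rule homogeneous_cpoint[of i y]) simp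

lemma homogeneous_nonzero: "homogeneous (cpoint i y) $ i \<noteq> 0"
  by (rule homogeneous_cpoint[of i y]) simp

lemma norm_affine_rep: "(norm (affine_rep i u))\<^sup>2 = 1 + (cmod u)\<^sup>2"
  unfolding norm_square_complex2 using exhaust_2[of i] by auto

lemma norm_scale_complex2: "(norm (c *s t :: complex^2))\<^sup>2 = (cmod c)\<^sup>2 * (norm t)\<^sup>2"
  by (simp add: norm_square_complex2 norm_mult power_mult_distrib distrib_left)

lemma norm_fst_cpoint: "(norm (fst (cpoint i y)))\<^sup>2 = (cmod (y$1))\<^sup>2 * (1 + (cmod (y$2))\<^sup>2)"
  by (simp add: cpoint_def norm_scale_complex2 norm_affine_rep)

lemma bmet_cpoint: "bmet m n (cpoint i y) = exp (- (real m * ((cmod (y$1))\<^sup>2 * (1 + (cmod (y$2))\<^sup>2)))) *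
    ((cmod (affine_rep i (y$2) $ cover_index n))\<^sup>2 / (1 + (cmod (y$2))\<^sup>2)) ^ m"
proof (rule homogeneous_cpoint[of i y])
  fix c :: complex assume c: "c \<noteq> 0" "homogeneous (cpoint i y) = c *s affine_rep i (y$2)"
  have "(cmod (homogeneous (cpoint i y) $ j))\<^sup>2 / (norm (homogeneous (cpoint i y)))\<^sup>2 = (cmod (affine_rep i (y$2) $ j))\<^sup>2 / (1 + (cmod (y$2))\<^sup>2)" for j
    unfolding c(2) norm_scale_complex2 norm_affine_rep using c(1)
    by (simp only: vector_smult_component norm_mult power_mult_distrib) simp
  then show ?thesis by (simp only: bmet_def norm_fst_cpoint)
qed

lemma cover_quantum_bundle [simp]: "cover quantum_bundle n = range (cpoint (cover_index n))"
  "cover (tensor_power quantum_bundle m) n = range (cpoint (cover_index n))"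
  by (simp_all add: quantum_bundle_def tensor_power_def)

lemma transfun_quantum_bundle: "transfun (tensor_power quantum_bundle m) n n' x = (homogeneous x $ cover_index n' / homogeneous x $ cover_index n) ^ m"
  by (simp add: quantum_bundle_def tensor_power_def)

lemma homogeneous_nonzero_cover: "x \<in> range (cpoint i) \<Longrightarrow> homogeneous x $ i \<noteq> 0"
  using homogeneous_nonzero by (elim rangeE) (simp only: simp_thms)

lemma coords_cover: "coords (bchart i) (range (cpoint j)) = {y. affine_rep i (y$2) $ j \<noteq> 0}"
proof (cases "i = j")
  case True
  then show ?thesis by (simp add: coords_whole)
next
  case False
  then show ?thesis by (simp add: coords_other)
qed

lemma coords_cover_Int: "coords (bchart i) (W \<inter> W') = coords (bchart i) W \<inter> coords (bchart i) W'"
  by (simp add: coords_bchart)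

lemma openin_range_cpoint: "openin (manifold_topology blowup_atlas) (range (cpoint i))"
  by (rule openin_cpoint_image[OF open_UNIV])

lemma open_coords: "open (coords (bchart i) (range (cpoint j)))"
  using openin_range_cpoint[of j] by (simp add: openin_blowup coords_bchart)

lemma holo_on_const: "holo_on (\<lambda>y. c) S"
  unfolding holo_on_def by (intro ballI exI[of _ "\<lambda>v. 0"]) simp

lemma line_bundle_quantum_bundle: "line_bundle blowup_atlas quantum_bundle"
  unfolding line_bundle_def
proof (intro conjI allI ballI)
  show "openin (manifold_topology blowup_atlas) (cover quantum_bundle n)" for n
    by (simp only: cover_quantum_bundle openin_range_cpoint)
  have "(\<Union>n. range (cpoint (cover_index n))) = range (cpoint 1) \<union> range (cpoint 2)"
  proof -
    have "range cover_index = {1, 2}" by (auto simp: cover_index_def image_iff intro: exI[of _ 0] exI[of _ 1])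
    then have "(\<Union>i\<in>range cover_index. range (cpoint i)) = (\<Union>i\<in>{1, 2}. range (cpoint i))" by (simp only:)
    then show ?thesis by (simp only: image_image Union_image_insert UN_insert UN_empty Un_empty_right)
  qed
  then show "(\<Union>n. cover quantum_bundle n) = points blowup_atlas"
    by (simp only: cover_quantum_bundle points_blowup blowup_eq_union)
next
  fix n n'
  show "holo_fun_on blowup_atlas (transfun quantum_bundle n n') (cover quantum_bundle n \<inter> cover quantum_bundle n')"
    unfolding holo_fun_on_def bchart_atlas
  proof (rule ballI, erule rangeE)
    fix c i assume c: "c = bchart i"
    let ?g = "\<lambda>y::complex^2. affine_rep i (y$2) $ cover_index n' / affine_rep i (y$2) $ cover_index n"
    let ?S = "{y::complex^2. affine_rep i (y$2) $ cover_index n \<noteq> 0 \<and> affine_rep i (y$2) $ cover_index n' \<noteq> 0}"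
    have tr: "(\<lambda>y. transfun quantum_bundle n n' (chart_inv c y)) = ?g"
      unfolding c chart_inv_bchart by (simp add: quantum_bundle_def homogeneous_ratio)
    have co: "coords c (cover quantum_bundle n \<inter> cover quantum_bundle n') = ?S"
      unfolding c coords_cover_Int cover_quantum_bundle coords_cover by blast
    consider "cover_index n = i" | "cover_index n \<noteq> i" "cover_index n' = i" | "cover_index n \<noteq> i" "cover_index n' \<noteq> i" by blast
    then have "holo_on ?g ?S"
    proof cases
      case 1
      then have "?g = (\<lambda>y. if cover_index n' = i then 1 else y$2)" by auto
      then show ?thesis
        by (cases "cover_index n' = i") (simp_all add: holo_on_const holo_on_nth)
    next
      case 2
      then have g: "?g = (\<lambda>y. chart_change y $ 2)" and S: "?S = {y. y$2 \<noteq> 0}" by simp_all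
      show ?thesis unfolding g S by (rule holo_on_compose_chart_change[OF holo_on_nth])
    next
      case 3
      then have "?S = {y. y$2 \<noteq> 0}" by simp
      then have "open ?S" using open_nth2_nonzero by (simp only:)
      then show ?thesis
        by (rule holo_on_cong[OF _ _ holo_on_const[of 1]]) (use 3 in simp)
    qed
    then show "holo_on (\<lambda>y. transfun quantum_bundle n n' (chart_inv c y)) (coords c (cover quantum_bundle n \<inter> cover quantum_bundle n'))"
      unfolding tr co .
  qed
next
  fix n n' x assume "x \<in> cover quantum_bundle n \<inter> cover quantum_bundle n'"
  then show "transfun quantum_bundle n n' x \<noteq> 0"
    unfolding cover_quantum_bundle using homogeneous_nonzero_cover by (elim IntE) (simp add: quantum_bundle_def)
next
  fix i j k x assume "x \<in> cover quantum_bundle i \<inter> cover quantum_bundle j \<inter> cover quantum_bundle k"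
  then have "homogeneous x $ cover_index j \<noteq> 0" unfolding cover_quantum_bundle by (elim IntE) (rule homogeneous_nonzero_cover)
  then show "transfun quantum_bundle i j x * transfun quantum_bundle j k x = transfun quantum_bundle i k x"
    by (simp add: quantum_bundle_def)
qed

lemma cpoint_cover: "cpoint i y \<in> range (cpoint j) \<longleftrightarrow> affine_rep i (y$2) $ j \<noteq> 0"
proof -
  have "y \<in> coords (bchart i) (range (cpoint j)) \<longleftrightarrow> affine_rep i (y$2) $ j \<noteq> 0"
    unfolding coords_cover by (rule mem_Collect_eq)
  then show ?thesis unfolding coords_bchart by (simp only: vimage_eq)
qed

lemma bmet_smooth:
  assumes S: "open S"
  shows "smooth_on (\<lambda>y. bmet m n (cpoint i y)) S"
proof -
  have d: "smooth_on (\<lambda>y. affine_rep i (y$2) $ cover_index n) S"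
    using S by (cases "cover_index n = i") (simp_all add: smooth_on_const smooth_on_nth)
  have "smooth_on (\<lambda>y. exp ((- real m) * ((cmod (y$1))\<^sup>2 * (1 + (cmod (y$2))\<^sup>2))) *
      ((cmod (affine_rep i (y$2) $ cover_index n))\<^sup>2 * inverse (1 + (cmod (y$2))\<^sup>2)) ^ m) S"
    by (intro smooth_on_mult smooth_on_exp smooth_on_power smooth_on_inverse smooth_on_add smooth_on_const
        smooth_on_cmod_square smooth_on_nth S d) simp
  then show ?thesis unfolding bmet_cpoint divide_inverse by simp
qed

lemma bmet_pos: "x \<in> range (cpoint (cover_index n)) \<Longrightarrow> bmet m n x > 0"
proof (erule rangeE)
  fix y assume x: "x = cpoint (cover_index n) y"
  show "bmet m n x > 0" unfolding x bmet_cpoint by simp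
qed

lemma bmet_nonneg: "bmet m n x \<ge> 0"
  by (simp add: bmet_def)

lemma hermitian_metric_bmet: "hermitian_metric blowup_atlas (tensor_power quantum_bundle m) (bmet m)"
  unfolding hermitian_metric_def cover_quantum_bundle
proof (intro conjI allI ballI)
  fix n
  show "smooth_fun_on blowup_atlas (bmet m n) (range (cpoint (cover_index n)))"
    unfolding smooth_fun_on_def bchart_atlas
    by (rule ballI, erule rangeE) (simp add: chart_inv_bchart bmet_smooth open_coords)
  show "0 < bmet m n x" if "x \<in> range (cpoint (cover_index n))" for x
    by (rule bmet_pos[OF that])
next
  fix n n' x assume x: "x \<in> range (cpoint (cover_index n)) \<inter> range (cpoint (cover_index n'))"
  have "homogeneous x $ cover_index n \<noteq> 0" using x by (elim IntE) (rule homogeneous_nonzero_cover)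
  then show "bmet m n' x = (cmod (transfun (tensor_power quantum_bundle m) n n' x))\<^sup>2 * bmet m n x"
    by (simp add: bmet_def transfun_quantum_bundle norm_power norm_divide power_divide power_mult_distrib
        flip: power_mult) (simp add: power_mult mult.commute[of 2 m])
qed

lemma ddbar_form_cong:
  assumes S: "open S" "y \<in> S" and eq: "\<And>z. z \<in> S \<Longrightarrow> f z = g z"
  shows "ddbar_form f y v w = ddbar_form g y v w"
proof -
  have "dzbar k (\<lambda>z. of_real (f z)) z = dzbar k (\<lambda>z. of_real (g z)) z" if "z \<in> S" for k z
  proof -
    have "((\<lambda>z. complex_of_real (f z)) has_derivative D) (at z) \<longleftrightarrow> ((\<lambda>z. complex_of_real (g z)) has_derivative D) (at z)" for D
      using has_derivative_transform_within_open[OF _ S(1) that, of "\<lambda>z. complex_of_real (f z)" D UNIV "\<lambda>z. complex_of_real (g z)"]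
        has_derivative_transform_within_open[OF _ S(1) that, of "\<lambda>z. complex_of_real (g z)" D UNIV "\<lambda>z. complex_of_real (f z)"] eq
      by auto
    then show ?thesis by (simp add: dzbar_def frechet_derivative_def)
  qed
  then have "dz j (dzbar k (\<lambda>z. of_real (f z))) y = dz j (dzbar k (\<lambda>z. of_real (g z))) y" for j k
    by (intro dz_cong[OF S])
  then show ?thesis by (simp only: ddbar_form_def)
qed

lemma frame_at_cover:
  assumes "x \<in> blowup"
  shows "x \<in> range (cpoint (cover_index (frame_at (tensor_power quantum_bundle m) x)))"
proof -
  have "\<exists>n. x \<in> range (cpoint (cover_index n))"
  proof (rule blowup_cases[OF assms])
    fix i y assume x: "x = cpoint i y"
    have "i = cover_index (if i = 1 then 0 else 1)" using exhaust_2[of i] by (auto simp: cover_index_def)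
    then show ?thesis unfolding x by (intro exI[of _ "if i = 1 then 0 else 1"]) (metis rangeI)
  qed
  then show ?thesis unfolding frame_at_def cover_quantum_bundle by (rule LeastI_ex)
qed

lemma ln_bmet:
  assumes "affine_rep i (z$2) $ cover_index n \<noteq> 0"
  shows "ln (bmet m n (cpoint i z)) = - real m * local_potential z
    + (if cover_index n = i then 0 else real m) * ln ((cmod (z$2))\<^sup>2)"
proof -
  let ?a = "(cmod (affine_rep i (z$2) $ cover_index n))\<^sup>2"
  have a: "?a > 0" using assms by simp
  have "ln (bmet m n (cpoint i z)) = - (real m * ((cmod (z$1))\<^sup>2 * (1 + (cmod (z$2))\<^sup>2)))
      + real m * (ln ?a - ln (1 + (cmod (z$2))\<^sup>2))"
    unfolding bmet_cpoint using a
    by (subst ln_mult_pos) (simp_all only: exp_gt_zero ln_exp ln_realpow ln_divide_pos one_plus_cmod2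
        divide_pos_pos zero_less_power)
  then show ?thesis using assms
    by (cases "cover_index n = i") (simp_all add: local_potential_def algebra_simps)
qed

text \<open>
  In the chart $i$ the logarithm of the metric is $-m$ times the potential, up to a multiple of
  $\log|t|^2$ for the frame of the other chart.
\<close>
lemma Ric_bmet: "Ric blowup_atlas (tensor_power quantum_bundle m) (bmet m) = (\<lambda>c y v w. real m * simanca_form c y v w)"
proof (intro ext)
  fix c y v w
  show "Ric blowup_atlas (tensor_power quantum_bundle m) (bmet m) c y v w = real m * simanca_form c y v w"
  proof (cases "c \<in> blowup_atlas")
    case True
    then obtain i where c: "c = bchart i" unfolding bchart_atlas by (rule rangeE)
    let ?n = "frame_at (tensor_power quantum_bundle m) (cpoint i y)"
    let ?c = "if cover_index ?n = i then 0 else real m"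
    have y: "affine_rep i (y$2) $ cover_index ?n \<noteq> 0"
      using frame_at_cover[OF cpoint_blowup] unfolding cpoint_cover .
    have co: "y \<in> coords c (fst c)" unfolding c fst_bchart coords_whole by (rule UNIV_I)
    let ?S = "{z::complex^2. affine_rep i (z$2) $ cover_index ?n \<noteq> 0}"
    have "open ?S" using open_nth2_nonzero by (cases "cover_index ?n = i") simp_all
    then have "ddbar_form (\<lambda>z. ln (bmet m ?n (cpoint i z))) y v w
        = ddbar_form (\<lambda>z. - real m * local_potential z + ?c * ln ((cmod (z$2))\<^sup>2)) y v w"
      by (rule ddbar_form_cong[of ?S]) (use y ln_bmet in simp_all)
    also have "\<dots> = - real m * simanca_local y v w"
      by (rule local_potential_ddbar) (use y in \<open>auto split: if_splits\<close>)
    finally show ?thesis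
      unfolding Ric_def simanca_form_eq simanca_local_atlas_def if_P[OF True] if_P[OF conjI[OF True co]]
      unfolding c chart_inv_bchart by simp
  next
    case False
    then show ?thesis by (simp add: Ric_def simanca_form_eq simanca_local_atlas_def)
  qed
qed

lemma tensor_power_1: "tensor_power L 1 = (L :: 'a line_bundle_data)"
  by (simp add: tensor_power_def)

theorem geometric_quantization_quantum_bundle: "geometric_quantization blowup_atlas simanca_form quantum_bundle bmet"
proof -
  have K: "kaehler_form blowup_atlas simanca_form" by (simp only: simanca_form_eq kaehler_form_simanca_local)
  have "cohomologous blowup_atlas simanca_form (Ric blowup_atlas quantum_bundle (bmet 1))"
    unfolding cohomologous_def
  proof (intro exI[of _ "\<lambda>c y v. 0"] conjI ballI allI)
    show "smooth_form1 blowup_atlas (\<lambda>c y v. 0)"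
      unfolding smooth_form1_def
    proof (intro conjI ballI allI impI)
      fix c :: "(blowup_point, 2) chart" assume "c \<in> blowup_atlas"
      then obtain i where c: "c = bchart i" unfolding bchart_atlas by (rule rangeE)
      show "linear (\<lambda>v::complex^2. 0 :: real)" by (rule linear_zero)
      show "smooth_on (\<lambda>y. 0 :: real) (coords c (fst c))"
        unfolding c fst_bchart by (rule smooth_on_const[OF open_coords])
    qed (rule refl)+
    fix c y v w
    have "Ric blowup_atlas quantum_bundle (bmet 1) c y v w = simanca_form c y v w"
      using fun_cong[OF fun_cong[OF fun_cong[OF fun_cong[OF Ric_bmet[of 1]]]], of c y v w]
      by (simp only: tensor_power_1)
    then show "simanca_form c y v w - Ric blowup_atlas quantum_bundle (bmet 1) c y v w = ext_deriv1 (\<lambda>c y v. 0) c y v w"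
      by (simp add: ext_deriv1_def)
  qed
  moreover have "hermitian_metric blowup_atlas quantum_bundle (bmet 1)"
    using hermitian_metric_bmet[of 1] by (simp only: tensor_power_1)
  ultimately have "simanca_form \<in> chern_class blowup_atlas quantum_bundle"
    using K unfolding chern_class_def kaehler_form_def by blast
  then show ?thesis
    unfolding geometric_quantization_def
    by (intro conjI complex_manifold_blowup K line_bundle_quantum_bundle allI impI hermitian_metric_bmet Ric_bmet)
qed

section \<open>The reproducing kernel of the sections\<close>

definition chart_frame :: "2 \<Rightarrow> nat" where
  "chart_frame i = (if i = 1 then 0 else 1)"

lemma cover_index_chart_frame [simp]: "cover_index (chart_frame i) = i"
  using exhaust_2[of i] by (auto simp: cover_index_def chart_frame_def)


lemma holo_on_imp_continuous_on: "holo_on f S \<Longrightarrow> continuous_on S f"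
  unfolding holo_on_def by (intro continuous_at_imp_continuous_on) (auto intro: has_derivative_continuous)

text \<open>
  A complex linear derivative restricted to a complex line is multiplication by a number.
\<close>
lemma holo_on_partial:
  assumes f: "holo_on f UNIV" and g: "(g has_derivative (\<lambda>v. v *s w)) (at z)"
  shows "((\<lambda>z::complex. f (g z)) has_field_derivative frechet_derivative f (at (g z)) w) (at z)"
proof -
  obtain D where D: "(f has_derivative D) (at (g z))" "\<And>c v. D (c *s v) = c * D v"
    using f unfolding holo_on_def by blast
  have "((\<lambda>z. f (g z)) has_derivative (\<lambda>v. D (v *s w))) (at z)"
    by (rule has_derivative_compose[OF g D(1)])
  then show ?thesis
    unfolding has_field_derivative_def frechet_derivative_at[OF D(1), symmetric] D(2)
    by (rule has_derivative_eq_rhs) (simp add: fun_eq_iff mult.commute)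
qed

lemma vector_has_derivative:
  "((\<lambda>z. vector [z, t] :: complex^2) has_derivative (\<lambda>v. v *s axis 1 1)) (at z)"
  "((\<lambda>t. vector [z, t] :: complex^2) has_derivative (\<lambda>v. v *s axis 2 1)) (at t)"
proof -
  have "((\<lambda>z. (vector [z, t] :: complex^2) $ j) has_derivative (\<lambda>v. (v *s axis 1 1 :: complex^2) $ j)) (at z)"
    "((\<lambda>t. (vector [z, t] :: complex^2) $ j) has_derivative (\<lambda>v. (v *s axis 2 1 :: complex^2) $ j)) (at t)" for j
    using exhaust_2[of j] by (auto simp: axis_def intro!: derivative_eq_intros)
  then show "((\<lambda>z. vector [z, t] :: complex^2) has_derivative (\<lambda>v. v *s axis 1 1)) (at z)"
    "((\<lambda>t. vector [z, t] :: complex^2) has_derivative (\<lambda>v. v *s axis 2 1)) (at t)"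
    by (subst has_derivative_componentwise_within,
       auto simp: Basis_vec_def inner_axis intro: has_derivative_inner_left)+
qed

lemma vector_eta: "vector [y$1, y$2] = (y :: complex^2)"
  by (simp add: vec_eq_iff forall_2)

context
  fixes m :: nat
begin

abbreviation "Lm \<equiv> tensor_power quantum_bundle m"

abbreviation "hol_sec \<equiv> holomorphic_section blowup_atlas Lm"

lemma hol_secD:
  assumes "hol_sec s"
  shows "c \<in> blowup_atlas \<Longrightarrow> holo_on (\<lambda>y. s n (chart_inv c y)) (coords c (cover Lm n))"
    and "x \<notin> cover Lm n \<Longrightarrow> s n x = 0"
    and "x \<in> cover Lm n \<inter> cover Lm n' \<Longrightarrow> s n x = transfun Lm n n' x * s n' x"
proof -
  note s = assms[unfolded holomorphic_section_def holo_fun_on_def]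
  show "c \<in> blowup_atlas \<Longrightarrow> holo_on (\<lambda>y. s n (chart_inv c y)) (coords c (cover Lm n))"
    by (rule bspec[OF spec[OF conjunct1[OF s]]])
  show "x \<notin> cover Lm n \<Longrightarrow> s n x = 0"
    by (rule mp[OF spec[OF spec[OF conjunct1[OF conjunct2[OF s]]]]])
  show "x \<in> cover Lm n \<inter> cover Lm n' \<Longrightarrow> s n x = transfun Lm n n' x * s n' x"
    by (rule bspec[OF spec[OF spec[OF conjunct2[OF conjunct2[OF s]]]]])
qed

lemma hol_secI:
  assumes "\<And>n c. c \<in> blowup_atlas \<Longrightarrow> holo_on (\<lambda>y. s n (chart_inv c y)) (coords c (cover Lm n))"
    and "\<And>n x. x \<notin> cover Lm n \<Longrightarrow> s n x = 0"
    and "\<And>n n' x. x \<in> cover Lm n \<inter> cover Lm n' \<Longrightarrow> s n x = transfun Lm n n' x * s n' x"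
  shows "hol_sec s"
  unfolding holomorphic_section_def holo_fun_on_def by (intro conjI allI impI ballI; rule assms; assumption)

lemma section_chart_holo:
  assumes "hol_sec s"
  shows "holo_on (\<lambda>y. s (chart_frame i) (cpoint i y)) UNIV"
proof -
  have "bchart i \<in> blowup_atlas" unfolding bchart_atlas by (rule rangeI)
  from hol_secD(1)[OF assms this, of "chart_frame i"]
  have "holo_on (\<lambda>y. s (chart_frame i) (chart_inv (bchart i) y)) (coords (bchart i) (range (cpoint i)))"
    unfolding cover_quantum_bundle cover_index_chart_frame .
  then show ?thesis unfolding chart_inv_bchart coords_whole .
qed

lemma section_glue:
  assumes s: "hol_sec s" and ij: "i \<noteq> j" and y: "y$2 \<noteq> 0"
  shows "s (chart_frame i) (cpoint i y) = (y$2) ^ m * s (chart_frame j) (cpoint j (chart_change y))"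
proof -
  have "cpoint i y \<in> range (cpoint j)" using cpoint_other[OF ij] y by simp
  then have "cpoint i y \<in> cover Lm (chart_frame i) \<inter> cover Lm (chart_frame j)" by simp
  then have "s (chart_frame i) (cpoint i y)
      = transfun Lm (chart_frame i) (chart_frame j) (cpoint i y) * s (chart_frame j) (cpoint i y)"
    by (rule hol_secD(3)[OF s])
  also have "transfun Lm (chart_frame i) (chart_frame j) (cpoint i y) = (y$2) ^ m"
    using ij by (simp add: transfun_quantum_bundle homogeneous_ratio)
  also have "s (chart_frame j) (cpoint i y) = s (chart_frame j) (cpoint j (chart_change y))"
    by (simp only: cpoint_chart_change[OF ij y])
  finally show ?thesis .
qed

text \<open>
  The components in both charts satisfy the gluing condition of
  \<open>two_chart_expansion\<close>.
\<close>
lemma section_expansion: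
  assumes s: "hol_sec s"
  obtains c where
    "\<And>y. (\<lambda>k. (y$1) ^ k * (\<Sum>b\<le>k + m. c k b * (y$2) ^ b)) sums s 0 (cpoint 1 y)"
    "\<And>y. (\<lambda>k. (y$1) ^ k * (\<Sum>b\<le>k + m. c k b * (y$2) ^ (k + m - b))) sums s 1 (cpoint 2 y)"
proof -
  define F where "F i z t = s (chart_frame i) (cpoint i (vector [z, t]))" for i z t
  note holo = section_chart_holo[OF s]
  have cont: "continuous_on UNIV (\<lambda>(z, t). F i z t)" for i
    using continuous_on_compose2[OF holo_on_imp_continuous_on[OF holo[of i]] continuous_on_vector2]
    by (simp add: F_def split_beta')
  have h1: "(\<lambda>z. F i z t) holomorphic_on UNIV" and h2: "(\<lambda>t. F i z t) holomorphic_on UNIV" for i z t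
    unfolding F_def holomorphic_on_def field_differentiable_def
    using holo_on_partial[OF holo[of i] vector_has_derivative(1)] holo_on_partial[OF holo[of i] vector_has_derivative(2)]
    by blast+
  have glue: "F 1 z t = t ^ m * F 2 (z * t) (1 / t)" if "t \<noteq> 0" for z t
    using section_glue[OF s, of 1 2 "vector [z, t]"] that by (simp add: F_def chart_change_def)
  obtain c where c: "\<And>z t. (\<lambda>k. z ^ k * (\<Sum>b\<le>k + m. c k b * t ^ b)) sums F 1 z t"
    "\<And>z t. (\<lambda>k. z ^ k * (\<Sum>b\<le>k + m. c k b * t ^ (k + m - b))) sums F 2 z t"
    using two_chart_expansion[OF cont cont h1 h2 h1 h2 glue] by blast
  show ?thesis
  proof (rule that)
    show "(\<lambda>k. (y$1) ^ k * (\<Sum>b\<le>k + m. c k b * (y$2) ^ b)) sums s 0 (cpoint 1 y)" for y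
      using c(1)[of "y$1" "y$2"] by (simp add: F_def vector_eta chart_frame_def)
    show "(\<lambda>k. (y$1) ^ k * (\<Sum>b\<le>k + m. c k b * (y$2) ^ (k + m - b))) sums s 1 (cpoint 2 y)" for y
      using c(2)[of "y$1" "y$2"] by (simp add: F_def vector_eta chart_frame_def)
  qed
qed

text \<open>
  The component of a section in a frame of length one at each point. It turns the metric into
  the standard one and sections into functions on the blow-up.
\<close>
definition unit_comp :: "blowup_point bsection \<Rightarrow> blowup_point \<Rightarrow> complex" where
  "unit_comp s x = of_real (sqrt (bmet m (frame_at Lm x) x)) * s (frame_at Lm x) x"

lemma herm_unit_comp: "herm Lm (bmet m) s t x = unit_comp s x * cnj (unit_comp t x)"
proof -
  have "complex_of_real (bmet m n x) = of_real (sqrt (bmet m n x)) * of_real (sqrt (bmet m n x))" for n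
    by (simp add: bmet_nonneg flip: of_real_mult)
  then show ?thesis by (simp add: herm_def unit_comp_def)
qed

lemma Re_herm_unit_comp: "Re (herm Lm (bmet m) s s x) = (cmod (unit_comp s x))\<^sup>2"
  unfolding herm_unit_comp complex_norm_square[symmetric] by simp

lemma frame_at_1: "frame_at Lm (cpoint 1 y) = 0"
  unfolding frame_at_def by (rule Least_eq_0) (simp add: cover_index_def)

lemma frame_at_2: "y$2 = 0 \<Longrightarrow> frame_at Lm (cpoint 2 y) = 1"
proof -
  assume y: "y$2 = 0"
  have n: "cpoint 2 y \<in> cover Lm n \<longleftrightarrow> n \<noteq> 0" for n
    using cpoint_other[of 2 1 y] y by (simp add: cover_index_def)
  show ?thesis unfolding frame_at_def n by (rule Least_equality) simp_all
qed

text \<open>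
  The squared length of the frame belonging to a chart, in the coordinates of that chart.
\<close>
definition frame_norm_sq :: "complex^2 \<Rightarrow> real" where
  "frame_norm_sq y = exp (- (real m * ((cmod (y$1))\<^sup>2 * (1 + (cmod (y$2))\<^sup>2)))) / (1 + (cmod (y$2))\<^sup>2) ^ m"

lemma unit_comp_1: "unit_comp s (cpoint 1 y) = of_real (sqrt (frame_norm_sq y)) * s 0 (cpoint 1 y)"
  by (simp add: unit_comp_def frame_at_1 bmet_cpoint cover_index_def frame_norm_sq_def power_divide)

lemma unit_comp_2: "y$2 = 0 \<Longrightarrow> unit_comp s (cpoint 2 y) = of_real (sqrt (frame_norm_sq y)) * s 1 (cpoint 2 y)"
  by (simp add: unit_comp_def frame_at_2 bmet_cpoint cover_index_def frame_norm_sq_def power_divide)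

lemma blowup_cases_unit_comp:
  assumes "x \<in> blowup"
  obtains y where "x = cpoint 1 y" | y where "x = cpoint 2 y" "y$2 = 0"
proof (rule blowup_cases[OF assms])
  fix i y assume x: "x = cpoint i y"
  show thesis
  proof (cases "i = 1")
    case True
    with x that(1) show thesis by (simp only:)
  next
    case False
    then have i: "i = 2" using exhaust_2 by blast
    show thesis
    proof (cases "y$2 = 0")
      case True
      with x i that(2) show thesis by (simp only:)
    next
      case F: False
      have "x = cpoint 1 (chart_change y)" unfolding x by (rule cpoint_chart_change[OF False F])
      with that(1) show thesis by (simp only:)
    qed
  qed
qed

lemma frame_norm_sq_measurable [measurable]: "frame_norm_sq \<in> borel_measurable borel"
  unfolding frame_norm_sq_def[abs_def] by measurable

lemma frame_norm_sq_weight: "frame_norm_sq y * volume_factor y = weight m (y$1) (y$2)"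
  by (simp add: frame_norm_sq_def volume_factor_def weight_def)

lemma frame_norm_sq_nonneg: "0 \<le> frame_norm_sq y"
  by (simp add: frame_norm_sq_def)

lemma chart_change_measurable [measurable]: "chart_change \<in> borel_measurable borel"
  unfolding chart_change_def[abs_def] by measurable

text \<open>
  In the second chart the frame used at a point changes along $t = 0$, so the function is only
  piecewise continuous there.
\<close>
lemma unit_comp_measurable:
  assumes s: "hol_sec s"
  shows "unit_comp s \<in> borel_measurable (blowup_vol 1)"
proof -
  have f[measurable]: "(\<lambda>y. s (chart_frame i) (cpoint i y)) \<in> borel_measurable borel" for i
    by (rule borel_measurable_continuous_onI[OF holo_on_imp_continuous_on[OF section_chart_holo[OF s]]])
  have f0[measurable]: "(\<lambda>y. s 0 (cpoint 1 y)) \<in> borel_measurable borel"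
    and f1[measurable]: "(\<lambda>y. s 1 (cpoint 2 y)) \<in> borel_measurable borel"
    using f[of 1] f[of 2] by (simp_all add: chart_frame_def)
  have u1[measurable]: "(\<lambda>y. unit_comp s (cpoint 1 y)) \<in> borel_measurable borel"
    unfolding unit_comp_1 by measurable
  have u2: "(\<lambda>y. unit_comp s (cpoint 2 y)) = (\<lambda>y. if y$2 = 0 then of_real (sqrt (frame_norm_sq y)) * s 1 (cpoint 2 y)
      else unit_comp s (cpoint 1 (chart_change y)))"
  proof
    fix y
    show "unit_comp s (cpoint 2 y) = (if y$2 = 0 then of_real (sqrt (frame_norm_sq y)) * s 1 (cpoint 2 y)
      else unit_comp s (cpoint 1 (chart_change y)))"
      using unit_comp_2[of y s] cpoint_chart_change[of 2 1 y] by (cases "y$2 = 0") simp_all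
  qed
  have m2: "(\<lambda>y. unit_comp s (cpoint 2 y)) \<in> borel_measurable borel"
  proof -
    have "(\<lambda>y. unit_comp s (cpoint 1 (chart_change y))) \<in> borel_measurable borel"
      by (rule measurable_compose[OF chart_change_measurable u1])
    then show ?thesis unfolding u2 by measurable
  qed
  have "unit_comp s \<in> borel_measurable blowup_borel"
  proof (rule borel_measurable_blowup)
    fix i :: 2
    show "(\<lambda>y. unit_comp s (cpoint i y)) \<in> borel_measurable borel"
      using exhaust_2[of i] u1 m2 by (elim disjE) (simp_all only:)
  qed
  then show ?thesis by (simp cong: measurable_cong_sets)
qed

abbreviation "L2_sections \<equiv> sq_int_sections blowup_atlas simanca_form Lm (bmet m)"

definition section_space :: "(blowup_point \<Rightarrow> complex) set" where "section_space = unit_comp ` L2_sections"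

lemma L2_sections_iff: "s \<in> L2_sections \<longleftrightarrow> hol_sec s \<and> (\<integral>\<^sup>+x. ennreal ((cmod (unit_comp s x))\<^sup>2) \<partial>blowup_vol 1) < \<infinity>"
  unfolding sq_int_sections_def volume_measure_blowup[of 1] Re_herm_unit_comp by blast

lemma unit_comp_linear: "unit_comp (\<lambda>i x. s i x + a * t i x) = (\<lambda>x. unit_comp s x + a * unit_comp t x)"
  by (simp add: unit_comp_def fun_eq_iff algebra_simps)

lemma unit_comp_sum: "unit_comp (\<lambda>i x. s i x - (\<Sum>b\<in>F. a b * b i x)) = (\<lambda>x. unit_comp s x - (\<Sum>b\<in>F. a b * unit_comp b x))"
  by (simp add: unit_comp_def fun_eq_iff right_diff_distrib sum_distrib_left mult_ac)

lemma holo_on_add_scaled: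
  assumes "holo_on f S" "holo_on g S"
  shows "holo_on (\<lambda>y. f y + a * g y) S"
  unfolding holo_on_def
proof
  fix x assume x: "x \<in> S"
  obtain D E where "(f has_derivative D) (at x)" "\<forall>c v. D (c *s v) = c * D v"
    "(g has_derivative E) (at x)" "\<forall>c v. E (c *s v) = c * E v"
    using assms x unfolding holo_on_def by blast
  then show "\<exists>D. ((\<lambda>y. f y + a * g y) has_derivative D) (at x) \<and> (\<forall>c v. D (c *s v) = c * D v)"
    by (intro exI[of _ "\<lambda>v. D v + a * E v"] conjI has_derivative_add has_derivative_mult_right)
       (simp_all add: algebra_simps)
qed

lemma hol_sec_add_scaled:
  assumes "hol_sec s" "hol_sec t"
  shows "hol_sec (\<lambda>i x. s i x + a * t i x)"
proof (rule hol_secI)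
  fix i c assume c: "c \<in> blowup_atlas"
  show "holo_on (\<lambda>y. s i (chart_inv c y) + a * t i (chart_inv c y)) (coords c (cover Lm i))"
    by (rule holo_on_add_scaled[OF hol_secD(1)[OF assms(1) c] hol_secD(1)[OF assms(2) c]])
next
  fix i x assume x: "x \<notin> cover Lm i"
  show "s i x + a * t i x = 0"
    unfolding hol_secD(2)[OF assms(1) x] hol_secD(2)[OF assms(2) x] by simp
next
  fix i j x assume x: "x \<in> cover Lm i \<inter> cover Lm j"
  show "s i x + a * t i x = transfun Lm i j x * (s j x + a * t j x)"
    unfolding hol_secD(3)[OF assms(1) x] hol_secD(3)[OF assms(2) x]
    by (simp only: distrib_left mult.left_commute)
qed

lemma hol_sec_zero: "hol_sec (\<lambda>i x. 0)"
  unfolding holomorphic_section_def holo_fun_on_def by (simp add: holo_on_const)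

lemma unit_comp_square_integrable:
  assumes "s \<in> L2_sections"
  shows "integrable (blowup_vol 1) (\<lambda>x. (cmod (unit_comp s x))\<^sup>2)"
proof (rule integrableI_nonneg)
  have [measurable]: "unit_comp s \<in> borel_measurable (blowup_vol 1)" using assms by (intro unit_comp_measurable) (simp add: L2_sections_iff)
  show "(\<lambda>x. (cmod (unit_comp s x))\<^sup>2) \<in> borel_measurable (blowup_vol 1)" by measurable
  show "(\<integral>\<^sup>+x. ennreal ((cmod (unit_comp s x))\<^sup>2) \<partial>blowup_vol 1) < \<infinity>" using assms by (simp add: L2_sections_iff)
qed simp

lemma L2_sections_add_scaled:
  assumes s: "s \<in> L2_sections" and t: "t \<in> L2_sections"
  shows "(\<lambda>i x. s i x + a * t i x) \<in> L2_sections"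
proof -
  have hs: "hol_sec s" "hol_sec t" using s t by (simp_all add: L2_sections_iff)
  note hst = hol_sec_add_scaled[OF hs, of a]
  have [measurable]: "unit_comp s \<in> borel_measurable (blowup_vol 1)" "unit_comp t \<in> borel_measurable (blowup_vol 1)"
    by (intro unit_comp_measurable hs)+
  have "integrable (blowup_vol 1) (\<lambda>x. (cmod (unit_comp s x + a * unit_comp t x))\<^sup>2)"
  proof (rule Bochner_Integration.integrable_bound)
    show "integrable (blowup_vol 1) (\<lambda>x. 2 * (cmod (unit_comp s x))\<^sup>2 + (2 * (cmod a)\<^sup>2) * (cmod (unit_comp t x))\<^sup>2)"
      by (intro Bochner_Integration.integrable_add integrable_mult_right unit_comp_square_integrable s t)
    show "AE x in blowup_vol 1. norm ((cmod (unit_comp s x + a * unit_comp t x))\<^sup>2)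
        \<le> norm (2 * (cmod (unit_comp s x))\<^sup>2 + (2 * (cmod a)\<^sup>2) * (cmod (unit_comp t x))\<^sup>2)"
    proof (rule AE_I2)
      fix x
      let ?p = "cmod (unit_comp s x)" and ?q = "cmod a * cmod (unit_comp t x)"
      have "cmod (unit_comp s x + a * unit_comp t x) \<le> ?p + ?q"
        using norm_triangle_ineq[of "unit_comp s x" "a * unit_comp t x"] by (simp add: norm_mult)
      then have "(cmod (unit_comp s x + a * unit_comp t x))\<^sup>2 \<le> (?p + ?q)\<^sup>2" by (intro power_mono) simp_all
      also have "\<dots> \<le> 2 * ?p\<^sup>2 + 2 * ?q\<^sup>2"
        using zero_le_power2[of "?p - ?q"] unfolding power2_sum power2_diff by linarith
      finally show "norm ((cmod (unit_comp s x + a * unit_comp t x))\<^sup>2)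
        \<le> norm (2 * (cmod (unit_comp s x))\<^sup>2 + (2 * (cmod a)\<^sup>2) * (cmod (unit_comp t x))\<^sup>2)"
        by (simp add: power_mult_distrib)
    qed
  qed measurable
  then have "(\<integral>\<^sup>+x. ennreal ((cmod (unit_comp (\<lambda>i x. s i x + a * t i x) x))\<^sup>2) \<partial>blowup_vol 1) < \<infinity>"
    unfolding unit_comp_linear by (subst nn_integral_eq_integral) simp_all
  with hst show ?thesis unfolding L2_sections_iff by (intro conjI)
qed

lemma L2_section_space: "L2_function_space (blowup_vol 1) section_space"
proof
  fix f assume "f \<in> section_space"
  then obtain s where f: "f = unit_comp s" and s: "s \<in> L2_sections" unfolding section_space_def by blast
  show "f \<in> borel_measurable (blowup_vol 1)" unfolding f using s by (intro unit_comp_measurable) (simp add: L2_sections_iff)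
  show "integrable (blowup_vol 1) (\<lambda>x. (cmod (f x))\<^sup>2)" unfolding f by (rule unit_comp_square_integrable[OF s])
next
  have u0: "unit_comp (\<lambda>i x. 0) = (\<lambda>x. 0)" by (simp add: unit_comp_def fun_eq_iff)
  have "(\<lambda>i x. 0) \<in> L2_sections" unfolding L2_sections_iff u0 by (intro conjI hol_sec_zero) simp
  then have "unit_comp (\<lambda>i x. 0) \<in> section_space" unfolding section_space_def by (rule imageI)
  then show "(\<lambda>x. 0) \<in> section_space" unfolding u0 .
next
  fix f g a assume "f \<in> section_space" "g \<in> section_space"
  then obtain s t where f: "f = unit_comp s" and g: "g = unit_comp t" and st: "s \<in> L2_sections" "t \<in> L2_sections" unfolding section_space_def by blast
  show "(\<lambda>x. f x + a * g x) \<in> section_space"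
    unfolding f g unit_comp_linear[symmetric] section_space_def by (rule imageI) (rule L2_sections_add_scaled[OF st])
qed

lemma blowup_vol_integrals:
  fixes F :: "blowup_point \<Rightarrow> complex"
  assumes F: "F \<in> borel_measurable (blowup_vol 1)"
  shows "integrable (blowup_vol 1) F \<longleftrightarrow> integrable lborel (\<lambda>y. volume_factor y *\<^sub>R F (cpoint 1 y))"
    and "(\<integral>x. F x \<partial>blowup_vol 1) = (\<integral>y. volume_factor y *\<^sub>R F (cpoint 1 y) \<partial>lborel)"
proof -
  have F': "F \<in> borel_measurable blowup_borel" using F by (simp cong: measurable_cong_sets)
  have c: "cpoint 1 \<in> density lborel (\<lambda>y. ennreal (volume_factor y)) \<rightarrow>\<^sub>M blowup_borel"
    using measurable_cpoint by (simp cong: measurable_cong_sets)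
  have Fc: "(\<lambda>y. F (cpoint 1 y)) \<in> borel_measurable lborel"
    using measurable_compose[OF measurable_cpoint F'] by simp
  have d: "AE y in lborel. 0 \<le> volume_factor y" "volume_factor \<in> borel_measurable lborel" by (simp_all add: volume_factor_nonneg)
  show "integrable (blowup_vol 1) F \<longleftrightarrow> integrable lborel (\<lambda>y. volume_factor y *\<^sub>R F (cpoint 1 y))"
    unfolding blowup_vol_def integrable_distr_eq[OF c F'] integrable_density[OF Fc d(2,1)] ..
  show "(\<integral>x. F x \<partial>blowup_vol 1) = (\<integral>y. volume_factor y *\<^sub>R F (cpoint 1 y) \<partial>lborel)"
    unfolding blowup_vol_def integral_distr[OF c F'] integral_density[OF Fc d(2,1)] ..
qed

lemma blowup_vol_nn_integral:
  assumes F: "F \<in> borel_measurable (blowup_vol 1)"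
  shows "(\<integral>\<^sup>+x. F x \<partial>blowup_vol 1) = (\<integral>\<^sup>+y. ennreal (volume_factor y) * F (cpoint 1 y) \<partial>lborel)"
proof -
  have F': "F \<in> borel_measurable blowup_borel" using F by (simp cong: measurable_cong_sets)
  have c: "cpoint 1 \<in> density lborel (\<lambda>y. ennreal (volume_factor y)) \<rightarrow>\<^sub>M blowup_borel"
    using measurable_cpoint by (simp cong: measurable_cong_sets)
  have Fc: "(\<lambda>y. F (cpoint 1 y)) \<in> borel_measurable lborel"
    using measurable_compose[OF measurable_cpoint F'] by simp
  show ?thesis
    unfolding blowup_vol_def nn_integral_distr[OF c F[unfolded blowup_vol_def]] by (rule nn_integral_density[OF _ Fc]) simp
qed

definition monomial :: "nat \<Rightarrow> nat \<Rightarrow> 2 \<Rightarrow> complex^2 \<Rightarrow> complex" where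
  "monomial k b i y = of_real (1 / sqrt (monomial_norm m k b)) * ((y$1) ^ k * (y$2) ^ (if i = 1 then b else k + m - b))"

text \<open>
  The pair $(k, b)$ stands for the normalized section $z^k t^b$ of the first chart, which is
  $z^k t^{k+m-b}$ in the second one. In the plane it is $z_1^{k+m-b} z_2^b$.
\<close>
definition mono_sec :: "nat \<times> nat \<Rightarrow> blowup_point bsection" where
  "mono_sec p n x = (if x \<in> range (cpoint (cover_index n)) then monomial (fst p) (snd p) (cover_index n) (snd (bchart (cover_index n)) x) else 0)"

lemma mono_sec_cpoint: "cover_index n = i \<Longrightarrow> mono_sec (k, b) n (cpoint i y) = monomial k b i y"
  by (simp add: mono_sec_def snd_bchart)

lemma monomial_chart_change:
  assumes b: "b \<le> k + m" and ij: "i \<noteq> j" and y: "y$2 \<noteq> 0"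
  shows "monomial k b i y = (y$2) ^ m * monomial k b j (chart_change y)"
proof -
  have low: "t ^ b = t ^ m * (t ^ k * (1 / t) ^ (k + m - b))" if "t \<noteq> 0" for t :: complex
  proof -
    have "t ^ m * (t ^ k * (1 / t) ^ (k + m - b)) = t ^ (k + m) / t ^ (k + m - b)"
      by (simp add: power_add power_divide)
    also have "\<dots> = t ^ (k + m - (k + m - b))" using that by (intro power_diff[symmetric]) auto
    finally show ?thesis using b by simp
  qed
  have high: "t ^ (k + m - b) = t ^ m * (t ^ k * (1 / t) ^ b)" if "t \<noteq> 0" for t :: complex
  proof -
    have "t ^ (k + m - b) = t ^ (k + m) / t ^ b" using that b by (intro power_diff)
    then show ?thesis by (simp add: power_add power_divide)
  qed
  consider "i = 1" "j = 2" | "i = 2" "j = 1" using ij exhaust_2[of i] exhaust_2[of j] by blast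
  then show ?thesis
  proof cases
    case 1
    then show ?thesis
      unfolding monomial_def using low[OF y] by (simp add: power_mult_distrib)
  next
    case 2
    then show ?thesis
      unfolding monomial_def using high[OF y] by (simp add: power_mult_distrib)
  qed
qed

lemma holo_on_mult:
  assumes "holo_on f S" "holo_on g S"
  shows "holo_on (\<lambda>y. f y * g y) S"
  unfolding holo_on_def
proof
  fix x assume x: "x \<in> S"
  obtain D E where "(f has_derivative D) (at x)" "\<forall>c v. D (c *s v) = c * D v"
    "(g has_derivative E) (at x)" "\<forall>c v. E (c *s v) = c * E v"
    using assms x unfolding holo_on_def by blast
  then show "\<exists>D. ((\<lambda>y. f y * g y) has_derivative D) (at x) \<and> (\<forall>c v. D (c *s v) = c * D v)"
    by (intro exI[of _ "\<lambda>v. f x * E v + D v * g x"] conjI has_derivative_mult)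
       (simp_all add: algebra_simps)
qed

lemma holo_on_power: "holo_on f S \<Longrightarrow> holo_on (\<lambda>y. f y ^ n) S"
  by (induction n) (simp_all add: holo_on_const holo_on_mult)

lemma holo_on_monomial: "holo_on (monomial k b i) S"
  unfolding monomial_def[abs_def] by (intro holo_on_mult holo_on_const holo_on_power holo_on_nth)

lemma hol_sec_mono_sec:
  assumes b: "b \<le> k + m"
  shows "hol_sec (mono_sec (k, b))"
proof (rule hol_secI)
  fix n and c :: "(blowup_point, 2) chart" assume "c \<in> blowup_atlas"
  then obtain i where c: "c = bchart i" unfolding bchart_atlas by (rule rangeE)
  show "holo_on (\<lambda>y. mono_sec (k, b) n (chart_inv c y)) (coords c (cover Lm n))"
    unfolding c chart_inv_bchart cover_quantum_bundle
  proof (cases "cover_index n = i")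
    case True
    show "holo_on (\<lambda>y. mono_sec (k, b) n (cpoint i y)) (coords (bchart i) (range (cpoint (cover_index n))))"
      unfolding mono_sec_cpoint[OF True] by (rule holo_on_monomial)
  next
    case False
    then have ij: "i \<noteq> cover_index n" by simp
    show "holo_on (\<lambda>y. mono_sec (k, b) n (cpoint i y)) (coords (bchart i) (range (cpoint (cover_index n))))"
      unfolding coords_other[OF ij]
    proof (rule holo_on_cong[OF open_nth2_nonzero _ holo_on_compose_chart_change[OF holo_on_monomial]])
      fix y :: "complex^2" assume "y \<in> {y. y$2 \<noteq> 0}"
      then have "y$2 \<noteq> 0" by simp
      from cpoint_chart_change[OF ij this] show "monomial k b (cover_index n) (chart_change y) = mono_sec (k, b) n (cpoint i y)"
        by (simp only: mono_sec_cpoint[OF refl])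
    qed
  qed
next
  fix n x assume "x \<notin> cover Lm n"
  then have "x \<notin> range (cpoint (cover_index n))" unfolding cover_quantum_bundle .
  then show "mono_sec (k, b) n x = 0" unfolding mono_sec_def by (rule if_not_P)
next
  fix n n' x assume x: "x \<in> cover Lm n \<inter> cover Lm n'"
  then obtain y where y: "x = cpoint (cover_index n) y" unfolding cover_quantum_bundle by (elim IntE rangeE)
  show "mono_sec (k, b) n x = transfun Lm n n' x * mono_sec (k, b) n' x"
  proof (cases "cover_index n = cover_index n'")
    case True
    then show ?thesis unfolding y transfun_quantum_bundle homogeneous_ratio by (simp add: mono_sec_cpoint)
  next
    case False
    have "cpoint (cover_index n) y \<in> range (cpoint (cover_index n'))" using x unfolding y cover_quantum_bundle by (rule IntD2)
    then have y2: "y$2 \<noteq> 0" unfolding cpoint_other[OF False] .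
    have "transfun Lm n n' x = (y$2) ^ m"
      unfolding y transfun_quantum_bundle homogeneous_ratio using False by simp
    moreover have "mono_sec (k, b) n' x = monomial k b (cover_index n') (chart_change y)"
      unfolding y cpoint_chart_change[OF False y2] by (rule mono_sec_cpoint[OF refl])
    moreover have "mono_sec (k, b) n x = monomial k b (cover_index n) y" unfolding y by (rule mono_sec_cpoint[OF refl])
    ultimately show ?thesis using monomial_chart_change[OF b False y2] by (simp only:)
  qed
qed

lemma unit_comp_mono_sec_1: "unit_comp (mono_sec (k, b)) (cpoint 1 y) = of_real (sqrt (frame_norm_sq y)) * monomial k b 1 y"
  unfolding unit_comp_1 by (simp only: mono_sec_cpoint[of 0 1] cover_index_def simp_thms if_True)

lemma unit_comp_mono_sec_2: "y$2 = 0 \<Longrightarrow> unit_comp (mono_sec (k, b)) (cpoint 2 y) = of_real (sqrt (frame_norm_sq y)) * monomial k b 2 y"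
proof -
  assume y: "y$2 = 0"
  have "cover_index 1 = 2" by (simp add: cover_index_def)
  from mono_sec_cpoint[OF this] show ?thesis by (simp only: unit_comp_2[OF y])
qed

context
  assumes m: "m \<ge> 1"
begin

interpretation L2: L2_function_space "blowup_vol 1" section_space by (rule L2_section_space)

lemma mono_sec_L2:
  assumes b: "b \<le> k + m"
  shows "mono_sec (k, b) \<in> L2_sections"
  unfolding L2_sections_iff
proof
  show h: "hol_sec (mono_sec (k, b))" by (rule hol_sec_mono_sec[OF b])
  have [measurable]: "unit_comp (mono_sec (k, b)) \<in> borel_measurable (blowup_vol 1)" by (rule unit_comp_measurable[OF h])
  have N: "monomial_norm m k b > 0" by (rule monomial_norm_pos[OF m])
  have "(\<integral>\<^sup>+x. ennreal ((cmod (unit_comp (mono_sec (k, b)) x))\<^sup>2) \<partial>blowup_vol 1)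
      = (\<integral>\<^sup>+y. ennreal (volume_factor y) * ennreal ((cmod (unit_comp (mono_sec (k, b)) (cpoint 1 y)))\<^sup>2) \<partial>lborel)"
    by (rule blowup_vol_nn_integral) measurable
  also have "\<dots> = (\<integral>\<^sup>+y. ennreal (1 / monomial_norm m k b) * ennreal ((cmod (((y::complex^2)$1) ^ k * (y$2) ^ b))\<^sup>2 * weight m (y$1) (y$2)) \<partial>lborel)"
  proof (rule nn_integral_cong)
    fix y :: "complex^2"
    have "volume_factor y * (cmod (unit_comp (mono_sec (k, b)) (cpoint 1 y)))\<^sup>2
        = 1 / monomial_norm m k b * ((cmod ((y$1) ^ k * (y$2) ^ b))\<^sup>2 * (frame_norm_sq y * volume_factor y))"
      unfolding unit_comp_mono_sec_1 monomial_def using N frame_norm_sq_nonneg[of y]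
      by (simp add: norm_mult norm_divide power_mult_distrib power_divide mult_ac)
    then show "ennreal (volume_factor y) * ennreal ((cmod (unit_comp (mono_sec (k, b)) (cpoint 1 y)))\<^sup>2)
        = ennreal (1 / monomial_norm m k b) * ennreal ((cmod ((y$1) ^ k * (y$2) ^ b))\<^sup>2 * weight m (y$1) (y$2))"
      using N by (simp only: ennreal_mult'[symmetric] volume_factor_nonneg frame_norm_sq_weight zero_le_divide_1_iff less_imp_le)
  qed
  also have "\<dots> = ennreal (1 / monomial_norm m k b) * ennreal (monomial_norm m k b)"
    by (subst nn_integral_cmult) (measurable, simp only: nn_integral_monomial[OF m b])
  also have "\<dots> < \<infinity>" by (simp add: ennreal_mult_less_top)
  finally show "(\<integral>\<^sup>+x. ennreal ((cmod (unit_comp (mono_sec (k, b)) x))\<^sup>2) \<partial>blowup_vol 1) < \<infinity>" .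
qed

lemma unit_comp_section_space: "s \<in> L2_sections \<Longrightarrow> unit_comp s \<in> section_space"
  unfolding section_space_def by (rule imageI)

text \<open>
  In the first chart, whose complement is a null set, this is
  \<open>coefficient_integral\<close>.
\<close>
lemma ip_mono_sec:
  assumes s: "s \<in> L2_sections" and b: "b \<le> k + m"
    and exp: "\<And>y. (\<lambda>k. (y$1) ^ k * (\<Sum>b\<le>k + m. c k b * (y$2) ^ b)) sums s 0 (cpoint 1 y)"
  shows "L2.ip (unit_comp s) (unit_comp (mono_sec (k, b))) = c k b * of_real (sqrt (monomial_norm m k b))"
proof -
  define N where "N = monomial_norm m k b"
  have N: "N > 0" unfolding N_def by (rule monomial_norm_pos[OF m])
  let ?F = "\<lambda>x. unit_comp s x * cnj (unit_comp (mono_sec (k, b)) x)"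
  let ?f = "\<lambda>y. s 0 (cpoint 1 y)"
  let ?G = "\<lambda>y. ?f y * cnj (y$1 ^ k * y$2 ^ b) * of_real (weight m (y$1) (y$2))"
  have intF: "integrable (blowup_vol 1) ?F" by (rule L2.integrable_ip[OF unit_comp_section_space[OF s] unit_comp_section_space[OF mono_sec_L2[OF b]]])
  then have F: "?F \<in> borel_measurable (blowup_vol 1)" by (rule borel_measurable_integrable)
  have FG: "volume_factor y *\<^sub>R ?F (cpoint 1 y) = of_real (1 / sqrt N) * ?G y" for y
  proof -
    have "complex_of_real (sqrt (frame_norm_sq y)) * of_real (sqrt (frame_norm_sq y)) * of_real (volume_factor y) = of_real (weight m (y$1) (y$2))"
      unfolding frame_norm_sq_weight[symmetric] of_real_mult[symmetric] using frame_norm_sq_nonneg[of y] by simp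
    then show ?thesis
      unfolding unit_comp_1[of s] unit_comp_mono_sec_1 monomial_def N_def[symmetric] scaleR_conv_of_real by (simp add: mult_ac)
  qed
  have "integrable lborel (\<lambda>y. of_real (1 / sqrt N) * ?G y)"
    using intF unfolding blowup_vol_integrals(1)[OF F] FG .
  then have intG: "integrable lborel ?G"
  proof -
    assume "integrable lborel (\<lambda>y. of_real (1 / sqrt N) * ?G y)"
    then have "integrable lborel (\<lambda>y. of_real (sqrt N) * (of_real (1 / sqrt N) * ?G y))"
      by (rule integrable_mult_right)
    moreover have "complex_of_real (sqrt N) * (of_real (1 / sqrt N) * z) = z" for z
      using N by (simp add: mult.assoc[symmetric] flip: of_real_mult)
    ultimately show ?thesis by (simp only:)
  qed
  have fm: "?f \<in> borel_measurable borel"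
  proof -
    have "hol_sec s" using s by (simp add: L2_sections_iff)
    from holo_on_imp_continuous_on[OF section_chart_holo[OF this, of 1]]
    have "continuous_on UNIV ?f" by (simp add: chart_frame_def)
    then show ?thesis by (rule borel_measurable_continuous_onI)
  qed
  have "L2.ip (unit_comp s) (unit_comp (mono_sec (k, b))) = of_real (1 / sqrt N) * (\<integral>y. ?G y \<partial>lborel)"
    unfolding L2.ip_def blowup_vol_integrals(2)[OF F] FG by (rule integral_mult_right_zero)
  also have "(\<integral>y. ?G y \<partial>lborel) = c k b * of_real N"
    unfolding N_def
  proof (rule coefficient_integral[OF m b fm _ intG])
    show "(\<lambda>j. z ^ j * (\<Sum>b\<le>j + m. c j b * t ^ b)) sums ?f (vector [z, t])" for z t
      using exp[of "vector [z, t]"] by simp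
  qed
  also have "of_real (1 / sqrt N) * (c k b * of_real N) = c k b * of_real (sqrt N)"
  proof -
    have "N = sqrt N * sqrt N" using N by simp
    then have "complex_of_real N = of_real (sqrt N) * of_real (sqrt N)" by (metis of_real_mult)
    then show ?thesis using N by simp
  qed
  finally show ?thesis unfolding N_def .
qed

definition monomial_indices :: "(nat \<times> nat) set" where "monomial_indices = {p. snd p \<le> fst p + m}"

definition degree_below :: "nat \<Rightarrow> (nat \<times> nat) set" where "degree_below n = (SIGMA k:{..<n}. {..k + m})"

lemma orthonormal_mono_sec: "L2.orthonormal monomial_indices (\<lambda>p. unit_comp (mono_sec p))"
  unfolding L2.orthonormal_def
proof (intro conjI ballI)
  fix p assume "p \<in> monomial_indices"
  then show "unit_comp (mono_sec p) \<in> section_space" using unit_comp_section_space[OF mono_sec_L2[of "snd p" "fst p"]] by (simp add: monomial_indices_def)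
next
  fix p q assume p: "p \<in> monomial_indices" and q: "q \<in> monomial_indices"
  obtain k b where p': "p = (k, b)" by (cases p)
  obtain k' b' where q': "q = (k', b')" by (cases q)
  have b: "b \<le> k + m" "b' \<le> k' + m" using p q by (simp_all add: monomial_indices_def p' q')
  define a where "a = complex_of_real (1 / sqrt (monomial_norm m k b))"
  \<comment> \<open>The expansion of a normalized monomial has a single term.\<close>
  define c where "c j i = (if j = k \<and> i = b then a else 0)" for j i
  have exp: "(\<lambda>j. (y$1) ^ j * (\<Sum>i\<le>j + m. c j i * (y$2) ^ i)) sums mono_sec (k, b) 0 (cpoint 1 y)" for y
  proof -
    have "(\<lambda>j. (y$1) ^ j * (\<Sum>i\<le>j + m. c j i * (y$2) ^ i))
        = (\<lambda>j. if j = k then a * ((y$1) ^ k * (y$2) ^ b) else 0)"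
    proof
      fix j
      show "(y$1) ^ j * (\<Sum>i\<le>j + m. c j i * (y$2) ^ i) = (if j = k then a * ((y$1) ^ k * (y$2) ^ b) else 0)"
      proof (cases "j = k")
        case True
        have "(\<Sum>i\<le>k + m. c k i * (y$2) ^ i) = (\<Sum>i\<le>k + m. if i = b then a * (y$2) ^ b else 0)"
          by (intro sum.cong) (auto simp: c_def)
        then show ?thesis using True b(1) by simp
      next
        case False
        then show ?thesis by (simp add: c_def)
      qed
    qed
    moreover have "mono_sec (k, b) 0 (cpoint 1 y) = a * ((y$1) ^ k * (y$2) ^ b)"
      by (simp add: mono_sec_cpoint[of 0 1] cover_index_def monomial_def a_def)
    ultimately show ?thesis using sums_single[of k "\<lambda>j. a * ((y$1) ^ k * (y$2) ^ b)"] by simp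
  qed
  have "L2.ip (unit_comp (mono_sec p)) (unit_comp (mono_sec q)) = c k' b' * of_real (sqrt (monomial_norm m k' b'))"
    unfolding p' q' by (rule ip_mono_sec[OF mono_sec_L2[OF b(1)] b(2) exp])
  also have "\<dots> = (if p = q then 1 else 0)"
    using monomial_norm_pos[OF m, of k b] by (auto simp: c_def p' q' a_def)
  finally show "L2.ip (unit_comp (mono_sec p)) (unit_comp (mono_sec q)) = (if p = q then 1 else 0)" .
qed

lemma mono_sec_expansion:
  assumes s: "s \<in> L2_sections" and x: "x \<in> blowup"
  shows "(\<lambda>n. \<Sum>p\<in>degree_below n. L2.ip (unit_comp s) (unit_comp (mono_sec p)) * unit_comp (mono_sec p) x) \<longlonglongrightarrow> unit_comp s x"
proof -
  have "hol_sec s" using s by (simp add: L2_sections_iff)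
  then obtain c where c: "\<And>y. (\<lambda>k. (y$1) ^ k * (\<Sum>b\<le>k + m. c k b * (y$2) ^ b)) sums s 0 (cpoint 1 y)"
    "\<And>y. (\<lambda>k. (y$1) ^ k * (\<Sum>b\<le>k + m. c k b * (y$2) ^ (k + m - b))) sums s 1 (cpoint 2 y)"
    by (rule section_expansion) blast
  have N: "complex_of_real (sqrt (monomial_norm m k b)) \<noteq> 0" for k b
    using monomial_norm_pos[OF m, of k b] by simp
  have eq: "(\<Sum>p\<in>degree_below n. L2.ip (unit_comp s) (unit_comp (mono_sec p)) * unit_comp (mono_sec p) x)
      = (\<Sum>k<n. \<Sum>b\<le>k + m. c k b * of_real (sqrt (monomial_norm m k b)) * unit_comp (mono_sec (k, b)) x)" for n
  proof -
    have "(\<Sum>p\<in>degree_below n. L2.ip (unit_comp s) (unit_comp (mono_sec p)) * unit_comp (mono_sec p) x)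
        = (\<Sum>k<n. \<Sum>b\<le>k + m. L2.ip (unit_comp s) (unit_comp (mono_sec (k, b))) * unit_comp (mono_sec (k, b)) x)"
      unfolding degree_below_def by (subst sum.Sigma) (simp_all add: split_beta')
    also have "\<dots> = (\<Sum>k<n. \<Sum>b\<le>k + m. c k b * of_real (sqrt (monomial_norm m k b)) * unit_comp (mono_sec (k, b)) x)"
      by (intro sum.cong refl arg_cong2[where f="(*)"] ip_mono_sec[OF s _ c(1)]) simp
    finally show ?thesis .
  qed
  have part: "(\<Sum>k<n. \<Sum>b\<le>k + m. c k b * of_real (sqrt (monomial_norm m k b)) * (r * monomial k b i y))
      = r * (\<Sum>k<n. (y$1) ^ k * (\<Sum>b\<le>k + m. c k b * (y$2) ^ (if i = 1 then b else k + m - b)))" for n r i y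
    unfolding sum_distrib_left monomial_def using N by (intro sum.cong refl) (simp add: mult_ac)
  show ?thesis
    unfolding eq
  proof (rule blowup_cases_unit_comp[OF x])
    fix y assume x: "x = cpoint 1 y"
    show "(\<lambda>n. \<Sum>k<n. \<Sum>b\<le>k + m. c k b * of_real (sqrt (monomial_norm m k b)) * unit_comp (mono_sec (k, b)) x) \<longlonglongrightarrow> unit_comp s x"
      unfolding x unit_comp_1[of s] unit_comp_mono_sec_1 part using c(1)[of y]
      by (intro tendsto_mult_left) (simp add: sums_def)
  next
    fix y assume x: "x = cpoint 2 y" and y: "y$2 = 0"
    show "(\<lambda>n. \<Sum>k<n. \<Sum>b\<le>k + m. c k b * of_real (sqrt (monomial_norm m k b)) * unit_comp (mono_sec (k, b)) x) \<longlonglongrightarrow> unit_comp s x"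
      unfolding x unit_comp_2[OF y, of s] unit_comp_mono_sec_2[OF y] part using c(2)[of y]
      by (intro tendsto_mult_left) (simp add: sums_def)
  qed
qed

text \<open>
  For fixed $k$ the sum over $b$ is a binomial expansion of $(1+|t|^2)^{k+m}$, and the sum over
  $k$ is then the exponential series at $m |z|^2 (1+|t|^2)$; both factors cancel with the
  squared length of the frame.
\<close>
lemma monomial_kernel:
  "(\<lambda>n. \<Sum>k<n. \<Sum>b\<le>k + m. (cmod (of_real (sqrt (frame_norm_sq y)) * monomial k b i y))\<^sup>2) \<longlonglongrightarrow> (real m)\<^sup>2"
proof -
  define p q where "p = (cmod (y$1))\<^sup>2" and "q = (cmod (y$2))\<^sup>2"
  have q: "1 + q > 0" unfolding q_def by (rule one_plus_cmod2)
  have binom: "(\<Sum>b\<le>n. real (n choose b) * q ^ (if i = 1 then b else n - b)) = (1 + q) ^ n" for n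
    using binomial_ring[of q 1 n] binomial_ring[of 1 q n] by (cases "i = 1") (simp_all add: add.commute)
  have inner: "(\<Sum>b\<le>k + m. (cmod (of_real (sqrt (frame_norm_sq y)) * monomial k b i y))\<^sup>2)
      = (real m)\<^sup>2 * (frame_norm_sq y * (1 + q) ^ m) * ((real m * p * (1 + q)) ^ k /\<^sub>R fact k)" for k
  proof -
    have "(cmod (of_real (sqrt (frame_norm_sq y)) * monomial k b i y))\<^sup>2
        = frame_norm_sq y * p ^ k * (real m ^ (k + 2) / fact k) * (real ((k + m) choose b) * q ^ (if i = 1 then b else k + m - b))"
      if "b \<le> k + m" for b
    proof -
      have N: "monomial_norm m k b > 0" by (rule monomial_norm_pos[OF m])
      have "1 / monomial_norm m k b = real m ^ (k + 2) / fact k * real ((k + m) choose b)"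
        using m by (simp add: monomial_norm_def binomial_fact[OF that] field_simps)
      moreover have "(cmod (of_real (sqrt (frame_norm_sq y)) * monomial k b i y))\<^sup>2
          = frame_norm_sq y * (1 / monomial_norm m k b) * (p ^ k * q ^ (if i = 1 then b else k + m - b))"
        unfolding monomial_def p_def q_def using N frame_norm_sq_nonneg[of y]
        by (simp add: norm_mult norm_divide norm_power power_mult_distrib power_divide power_mult[symmetric] mult_ac)
      ultimately show ?thesis by (simp add: mult_ac)
    qed
    then have "(\<Sum>b\<le>k + m. (cmod (of_real (sqrt (frame_norm_sq y)) * monomial k b i y))\<^sup>2)
        = frame_norm_sq y * p ^ k * (real m ^ (k + 2) / fact k) * (1 + q) ^ (k + m)"
      unfolding binom[symmetric] sum_distrib_left by (intro sum.cong) auto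
    then show ?thesis
      by (simp add: power_add power_mult_distrib power2_eq_square divide_inverse scaleR_conv_of_real mult_ac)
  qed
  have frame_norm_sq: "frame_norm_sq y * (1 + q) ^ m = exp (- (real m * p * (1 + q)))"
    using q unfolding frame_norm_sq_def p_def[symmetric] q_def[symmetric] by (simp add: mult.assoc)
  have "(\<lambda>n. \<Sum>k<n. (real m * p * (1 + q)) ^ k /\<^sub>R fact k) \<longlonglongrightarrow> exp (real m * p * (1 + q))"
    using exp_converges[of "real m * p * (1 + q)"] by (simp only: sums_def)
  then have "(\<lambda>n. (real m)\<^sup>2 * (frame_norm_sq y * (1 + q) ^ m) * (\<Sum>k<n. (real m * p * (1 + q)) ^ k /\<^sub>R fact k))
      \<longlonglongrightarrow> (real m)\<^sup>2 * (frame_norm_sq y * (1 + q) ^ m) * exp (real m * p * (1 + q))"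
    by (rule tendsto_mult_left)
  moreover have "(real m)\<^sup>2 * (frame_norm_sq y * (1 + q) ^ m) * exp (real m * p * (1 + q)) = (real m)\<^sup>2"
    unfolding frame_norm_sq by (simp add: mult.assoc exp_minus_inverse mult.commute[of "exp _"] exp_minus)
  ultimately show ?thesis unfolding inner sum_distrib_left by simp
qed

lemma mono_sec_kernel:
  assumes x: "x \<in> blowup"
  shows "(\<lambda>n. \<Sum>p\<in>degree_below n. (cmod (unit_comp (mono_sec p) x))\<^sup>2) \<longlonglongrightarrow> (real m)\<^sup>2"
proof -
  have eq: "(\<Sum>p\<in>degree_below n. (cmod (unit_comp (mono_sec p) x))\<^sup>2) = (\<Sum>k<n. \<Sum>b\<le>k + m. (cmod (unit_comp (mono_sec (k, b)) x))\<^sup>2)" for n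
    unfolding degree_below_def by (subst sum.Sigma) (simp_all add: split_beta')
  show ?thesis
    unfolding eq
  proof (rule blowup_cases_unit_comp[OF x])
    fix y assume x: "x = cpoint 1 y"
    show "(\<lambda>n. \<Sum>k<n. \<Sum>b\<le>k + m. (cmod (unit_comp (mono_sec (k, b)) x))\<^sup>2) \<longlonglongrightarrow> (real m)\<^sup>2"
      unfolding x unit_comp_mono_sec_1 by (rule monomial_kernel)
  next
    fix y assume x: "x = cpoint 2 y" and y: "y$2 = 0"
    show "(\<lambda>n. \<Sum>k<n. \<Sum>b\<le>k + m. (cmod (unit_comp (mono_sec (k, b)) x))\<^sup>2) \<longlonglongrightarrow> (real m)\<^sup>2"
      unfolding x unit_comp_mono_sec_2[OF y] by (rule monomial_kernel)
  qed
qed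

interpretation E: pointwise_expansion "blowup_vol 1" section_space "\<lambda>p. unit_comp (mono_sec p)" degree_below monomial_indices "\<lambda>x. (real m)\<^sup>2"
proof
  show "L2.orthonormal monomial_indices (\<lambda>p. unit_comp (mono_sec p))" by (rule orthonormal_mono_sec)
  show "finite (degree_below n)" for n by (simp add: degree_below_def)
  show "degree_below n \<subseteq> monomial_indices" for n by (auto simp: degree_below_def monomial_indices_def)
  show "degree_below n \<subseteq> degree_below n'" if "n \<le> n'" for n n' using that by (auto simp: degree_below_def)
  show "(\<lambda>n. \<Sum>p\<in>degree_below n. L2.ip f (unit_comp (mono_sec p)) * unit_comp (mono_sec p) x) \<longlonglongrightarrow> f x"
    if fV: "f \<in> section_space" and xs: "x \<in> space (blowup_vol 1)" for f x
  proof -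
    obtain s where f: "f = unit_comp s" and s: "s \<in> L2_sections" using fV unfolding section_space_def by (rule imageE)
    have "x \<in> blowup" using xs by (simp only: space_blowup_vol)
    then show ?thesis unfolding f by (rule mono_sec_expansion[OF s])
  qed
  show "(\<lambda>n. \<Sum>p\<in>degree_below n. (cmod (unit_comp (mono_sec p) x))\<^sup>2) \<longlonglongrightarrow> (real m)\<^sup>2" if "x \<in> space (blowup_vol 1)" for x
    using that mono_sec_kernel by (simp only: space_blowup_vol)
qed

lemma sec_inner_unit_comp: "sec_inner blowup_atlas simanca_form Lm (bmet m) s t = L2.ip (unit_comp s) (unit_comp t)"
  unfolding sec_inner_def volume_measure_blowup[of 1] herm_unit_comp L2.ip_def ..

text \<open>
  Orthonormal bases of sections are the complete orthonormal families in the space of their unit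
  components.
\<close>
lemma orthonormal_basis_iff:
  "orthonormal_basis blowup_atlas simanca_form Lm (bmet m) B \<longleftrightarrow> B \<subseteq> L2_sections \<and> L2.orthonormal B unit_comp \<and>
     (\<forall>s\<in>L2_sections. \<forall>e>0. \<exists>F a. finite F \<and> F \<subseteq> B \<and> L2.nsq (\<lambda>x. unit_comp s x - (\<Sum>b\<in>F. a b * unit_comp b x)) < e)"
proof -
  have "\<forall>b\<in>B. unit_comp b \<in> section_space" if "B \<subseteq> L2_sections" using that unit_comp_section_space by blast
  then show ?thesis
    unfolding orthonormal_basis_def sec_inner_unit_comp L2.orthonormal_def Let_def L2.ip_self unit_comp_sum Re_complex_of_real
    by blast
qed

text \<open>
  The monomials show that an orthonormal basis exists, and every orthonormal basis yields the
  value $m^2$.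
\<close>
theorem epsilon_eq:
  assumes x: "x \<in> blowup"
  shows "epsilon blowup_atlas simanca_form Lm (bmet m) x = (real m)\<^sup>2"
proof -
  have xs: "x \<in> space (blowup_vol 1)" using x by (simp only: space_blowup_vol)
  have any: "((\<lambda>s. (cmod (unit_comp s x))\<^sup>2) has_sum (real m)\<^sup>2) B"
    if B: "orthonormal_basis blowup_atlas simanca_form Lm (bmet m) B" for B
  proof (rule E.orthonormal_basis_kernel[OF _ xs])
    show "L2.orthonormal B unit_comp" using B unfolding orthonormal_basis_iff by (elim conjE)
    fix f :: "blowup_point \<Rightarrow> complex" and \<epsilon> :: real assume f: "f \<in> section_space" and \<epsilon>: "0 < \<epsilon>"
    obtain s where f': "f = unit_comp s" and s: "s \<in> L2_sections" using f unfolding section_space_def by (rule imageE)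
    show "\<exists>F a. finite F \<and> F \<subseteq> B \<and> L2.nsq (\<lambda>x. f x - (\<Sum>b\<in>F. a b * unit_comp b x)) < \<epsilon>"
      using B s \<epsilon> unfolding orthonormal_basis_iff f' by blast
  qed
  have inj: "inj_on mono_sec monomial_indices"
  proof (rule inj_onI, rule ccontr)
    fix p q assume pq: "p \<in> monomial_indices" "q \<in> monomial_indices" "mono_sec p = mono_sec q" "p \<noteq> q"
    have o: "\<And>p q. p \<in> monomial_indices \<Longrightarrow> q \<in> monomial_indices \<Longrightarrow> L2.ip (unit_comp (mono_sec p)) (unit_comp (mono_sec q)) = (if p = q then 1 else 0)"
      using orthonormal_mono_sec unfolding L2.orthonormal_def by blast
    have "L2.ip (unit_comp (mono_sec p)) (unit_comp (mono_sec q)) = 0" using o[OF pq(1,2)] pq(4) by simp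
    moreover have "L2.ip (unit_comp (mono_sec p)) (unit_comp (mono_sec q)) = 1" using o[OF pq(2,2)] pq(3) by simp
    ultimately show False by simp
  qed
  have basis: "orthonormal_basis blowup_atlas simanca_form Lm (bmet m) (mono_sec ` monomial_indices)"
    unfolding orthonormal_basis_iff
  proof (intro conjI ballI allI impI)
    show "mono_sec ` monomial_indices \<subseteq> L2_sections"
    proof (rule image_subsetI)
      fix p assume "p \<in> monomial_indices"
      then show "mono_sec p \<in> L2_sections" using mono_sec_L2[of "snd p" "fst p"] by (simp add: monomial_indices_def)
    qed
    show "L2.orthonormal (mono_sec ` monomial_indices) unit_comp"
      using orthonormal_mono_sec inj_on_eq_iff[OF inj] unfolding L2.orthonormal_def ball_simps by simp
    fix s and \<epsilon> :: real assume s: "s \<in> L2_sections" and \<epsilon>: "\<epsilon> > 0"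
    obtain n where n: "L2.nsq (\<lambda>x. unit_comp s x - (\<Sum>p\<in>degree_below n. L2.ip (unit_comp s) (unit_comp (mono_sec p)) * unit_comp (mono_sec p) x)) < \<epsilon>"
      using E.complete_e[OF unit_comp_section_space[OF s] \<epsilon>] by blast
    have "(\<Sum>p\<in>degree_below n. L2.ip (unit_comp s) (unit_comp (mono_sec p)) * unit_comp (mono_sec p) x)
        = (\<Sum>b\<in>mono_sec ` degree_below n. L2.ip (unit_comp s) (unit_comp b) * unit_comp b x)" for x
      by (subst sum.reindex[OF inj_on_subset[OF inj E.I_J]]) (simp add: o_def)
    then have "L2.nsq (\<lambda>x. unit_comp s x - (\<Sum>b\<in>mono_sec ` degree_below n. L2.ip (unit_comp s) (unit_comp b) * unit_comp b x)) < \<epsilon>"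
      using n by simp
    moreover have "finite (mono_sec ` degree_below n)" "mono_sec ` degree_below n \<subseteq> mono_sec ` monomial_indices"
      using E.fin_I[of n] image_mono[OF E.I_J[of n]] by simp_all
    ultimately show "\<exists>F a. finite F \<and> F \<subseteq> mono_sec ` monomial_indices \<and> L2.nsq (\<lambda>x. unit_comp s x - (\<Sum>b\<in>F. a b * unit_comp b x)) < \<epsilon>"
      by (intro exI[of _ "mono_sec ` degree_below n"] exI[of _ "\<lambda>b. L2.ip (unit_comp s) (unit_comp b)"] conjI)
  qed
  show ?thesis
    unfolding epsilon_def Re_herm_unit_comp
  proof (rule the_equality)
    show "\<exists>B. orthonormal_basis blowup_atlas simanca_form Lm (bmet m) B \<and> ((\<lambda>s. (cmod (unit_comp s x))\<^sup>2) has_sum (real m)\<^sup>2) B"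
      using basis any[OF basis] by (intro exI[of _ "mono_sec ` monomial_indices"] conjI)
    show "r = (real m)\<^sup>2"
      if r: "\<exists>B. orthonormal_basis blowup_atlas simanca_form Lm (bmet m) B \<and> ((\<lambda>s. (cmod (unit_comp s x))\<^sup>2) has_sum r) B" for r
    proof -
      obtain B where B: "orthonormal_basis blowup_atlas simanca_form Lm (bmet m) B"
        "((\<lambda>s. (cmod (unit_comp s x))\<^sup>2) has_sum r) B" using r by (elim exE conjE)
      show ?thesis by (rule has_sum_unique[OF B(2) any[OF B(1)]])
    qed
  qed
qed

end

end

theorem theorem1p1:
  shows "\<exists>L h. regular_quantization blowup_atlas simanca_form L h \<and>
    (\<forall>m\<ge>1. \<forall>x\<in>blowup.
       epsilon blowup_atlas simanca_form (tensor_power L m) (h m) x = (real m)\<^sup>2)"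
proof (intro exI[of _ quantum_bundle] exI[of _ bmet] conjI allI impI ballI)
  show "epsilon blowup_atlas simanca_form (tensor_power quantum_bundle m) (bmet m) x = (real m)\<^sup>2"
    if "1 \<le> m" "x \<in> blowup" for m x
    by (rule epsilon_eq[OF that])
  have "balanced blowup_atlas simanca_form (tensor_power quantum_bundle m) (bmet m)" if "m \<ge> 1" for m
    unfolding balanced_def points_blowup
    by (intro exI[of _ "(real m)\<^sup>2"] conjI ballI epsilon_eq[OF that]) (use that in simp)
  then show "regular_quantization blowup_atlas simanca_form quantum_bundle bmet"
    unfolding regular_quantization_def using geometric_quantization_quantum_bundle
    by (intro conjI exI[of _ 1] allI impI)
qed

end
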